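(* Let $C$ and $\tilde{C}$ be representatives of curve-germs in $(\mathbb{C}^2,0)$. Then $C$ and $\tilde C$ are topologically equivalent if and only if there exists $\epsilon_0>0$ such that for every $0<\epsilon<\epsilon_0$ the pairs $(S_\epsilon, C\cap S_\epsilon)$ and $(S_\epsilon,\tilde{C}\cap S_\epsilon)$ are homeomorphic through an orientation-preserving homeomorphism.
   Context: A curve $(C,0)$ in $(\mathbb{C}^2,0)$ is the set-germ at the origin of $f^{-1}(0)$, where $f:(\mathbb{C}^2,0)\to(\mathbb{C},0)$ is a nonzero holomorphic function germ. $D_\epsilon=\{(z,w)\in\mathbb{C}^2:|z|^2+|w|^2\le\epsilon^2\}$ and $S_\epsilon=\{(z,w)\in\mathbb{C}^2:|z|^2+|w|^2=\epsilon^2\}$. Representatives $C,\tilde C$ of curve-germs are topologically equivalent if there is $\epsilon_0>0$ such that for every $0<\epsilon<\epsilon_0$ there is an orientation-preserving homeomorphism $h:D_\epsilon\to D_\epsilon$ with $h(C\cap D_\epsilon)=\tilde C\cap D_\epsilon$. A homeomorphism of pairs $(X,A)\to(Y,B)$ is a homeomorphism $X\to Y$ carrying $A$ onto $B$. *)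

theory Defs
  imports "HOL-Homology.Homology"
begin

text \<open>
  The metric on \<^typ>\<open>complex \<times> complex\<close> is the Euclidean one, so \<^term>\<open>cball\<close> and \<^term>\<open>sphere\<close>
  around \<open>0\<close> are the usual round ball and round 3-sphere.
\<close>

lemma cball_0_eq:
  fixes r :: real
  assumes "0 < r"
  shows "cball (0 :: complex \<times> complex) r = {(z, w). (cmod z)\<^sup>2 + (cmod w)\<^sup>2 \<le> r\<^sup>2}"
  using assms by (auto simp: norm_Pair intro: real_le_lsqrt[OF less_imp_le] dest: sqrt_le_D)

lemma sphere_0_eq:
  fixes r :: real
  assumes "0 < r"
  shows "sphere (0 :: complex \<times> complex) r = {(z, w). (cmod z)\<^sup>2 + (cmod w)\<^sup>2 = r\<^sup>2}"
  using assms by (auto simp: norm_Pair)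

text \<open>
  Complex differentiability in two variables: the real Frechet derivative exists and is complex
  linear.
\<close>

definition holomorphic2_on :: "(complex \<times> complex \<Rightarrow> complex) \<Rightarrow> (complex \<times> complex) set \<Rightarrow> bool"
  where "holomorphic2_on f U \<longleftrightarrow>
    (\<forall>p\<in>U. \<exists>a b. (f has_derivative (\<lambda>(h, k). a * h + b * k)) (at p))"

text \<open>
  \<open>C\<close> is only constrained near the origin: it may be any set whose germ at \<open>0\<close> is the germ of the
  zero set of \<open>f\<close>. The germ of \<open>f\<close> being nonzero means that \<open>f\<close> vanishes identically on no
  neighbourhood of \<open>0\<close>.
\<close>

definition represents_curve_germ :: "(complex \<times> complex) set \<Rightarrow> bool"
  where "represents_curve_germ C \<longleftrightarrow>
    (\<exists>U f. open U \<and> 0 \<in> U \<and> holomorphic2_on f U \<and> f 0 = 0 \<and>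
       (\<exists>\<^sub>F p in nhds 0. f p \<noteq> 0) \<and>
       (\<forall>\<^sub>F p in nhds 0. p \<in> C \<longleftrightarrow> f p = 0))"

text \<open>
  Intended for \<open>M\<close> a compact connected orientable \<open>n\<close>-manifold with (possibly empty) boundary \<open>B\<close>.
  Then the integral homology group $H_n(M, B)$ is infinite cyclic, an orientation is a choice of
  generator (fundamental class), and a self-homeomorphism preserves the orientation iff it fixes
  the fundamental class, i.e. iff it acts as the identity on $H_n(M, B)$. That \<open>h\<close> maps \<open>B\<close> to
  itself is automatic for a homeomorphism of manifolds with boundary.
\<close>

definition orientation_preserving_homeo ::
    "nat \<Rightarrow> 'a::topological_space set \<Rightarrow> 'a set \<Rightarrow> ('a \<Rightarrow> 'a) \<Rightarrow> bool"
  where "orientation_preserving_homeo n M B h \<longleftrightarrow>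
    homeomorphic_map (top_of_set M) (top_of_set M) h \<and>
    (\<forall>c \<in> carrier (relative_homology_group (int n) (top_of_set M) B).
       hom_induced (int n) (top_of_set M) B (top_of_set M) B h c = c)"

definition topologically_equivalent ::
    "(complex \<times> complex) set \<Rightarrow> (complex \<times> complex) set \<Rightarrow> bool"
  where "topologically_equivalent C C' \<longleftrightarrow>
    (\<exists>\<epsilon>\<^sub>0>0. \<forall>\<epsilon>. 0 < \<epsilon> \<and> \<epsilon> < \<epsilon>\<^sub>0 \<longrightarrow>
       (\<exists>h. orientation_preserving_homeo 4 (cball 0 \<epsilon>) (sphere 0 \<epsilon>) h \<and>
            h ` (C \<inter> cball 0 \<epsilon>) = C' \<inter> cball 0 \<epsilon>))"

end

theory Submission
  imports
    Defs
    "HOL-Complex_Analysis.Complex_Analysis"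
    "Jordan_Normal_Form.Determinant"
begin

text \<open>
The forward direction restricts a homeomorphism of the ball to the boundary sphere: by invariance of
domain it maps the sphere to itself, and since the ball is contractible the connecting map
$H_4(D, S) \to H_3(S)$ is an isomorphism, so that the orientation is preserved on the ball iff it is
preserved on the sphere (\<open>orientation_preserving_ball_iff_sphere\<close>).

The converse rests on the local conic structure of plane curves (\<open>curve_germ_conic\<close>): for small
\<open>\<epsilon>\<close> there is a homeomorphism of the ball, fixing the sphere pointwise, that carries the straight cone
over the link \<open>C \<inter> S\<close> to \<open>C \<inter> D\<close>. A homeomorphism of links extends radially to the cones, and
conjugating this extension by the conic structures of the two curves gives a homeomorphism of the
pairs in the ball which still has the given restriction to the sphere.

The conic structure is usually obtained by integrating a vector field tangent to the curve. Here
the curve is instead described as finitely many points moving in a plane. After a unitary change of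
coordinates no tangent of the curve \<open>f = 0\<close> at the origin is the axis \<open>z = 0\<close>. Off this axis,
\<open>(z, w)\<close> is determined by the slope \<open>u = w / z\<close> together with the complex number \<open>y\<close> that has the
argument of \<open>z\<close> and the norm of \<open>(z, w)\<close>. Three facts make the curve
a family of finite sets \<open>Z y\<close> of slopes that varies continuously with \<open>y \<noteq> 0\<close>:

  \<^item> The slopes of the points with first coordinate \<open>z\<close> are the roots in a disc of a function
    \<open>g(z, \<cdot>)\<close>, holomorphic in both variables also at \<open>z = 0\<close>. The power sums of the roots are contour
    integrals, hence holomorphic in \<open>z\<close>, and the number of distinct roots is the largest size of a
    nonvanishing Hankel determinant in the power sums. Therefore it is constant for small
    \<open>z \<noteq> 0\<close> (\<open>card_roots_generically_constant\<close>).
  \<^item> A branch \<open>v\<close> of the roots satisfies \<open>\<bar>z v'(z)\<bar> \<le> 1\<close> near \<open>0\<close>, because the roots accumulate only at the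
    finitely many roots of \<open>g(0, \<cdot>)\<close> and Cauchy's estimate applies.
  \<^item> Hence \<open>\<bar>(z, z v(z))\<bar>\<close> increases along rays, so each branch meets each ray direction on each
    sphere exactly once (\<open>varying_configuration_radial_roots\<close>).

Such a family can be trivialized along rays by explicit maps. For nearby radii the points of one
configuration are pushed to those of the other by adding a small Lipschitz bump at each point, which
is a homeomorphism because it is a contractive perturbation of the identity. These pushes are
composed along the interval of radii (\<open>radial_trivialization\<close>). The resulting homeomorphism of the ball
preserves the norm, so nothing has to be controlled at the origin (\<open>conic_structure\<close>).
\<close>

section \<open>Orientations of the ball and of its boundary sphere\<close>

text \<open>
The connecting homomorphism is natural, and by the long exact sequence of the pair it is bijective
when the two neighbouring homology groups of \<open>X\<close> vanish.
\<close>

lemma trivial_boundary_identity_iff: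
  assumes h: "continuous_map X X h" "h \<in> S \<rightarrow> S"
    and t1: "trivial_group (homology_group p X)"
    and t2: "trivial_group (homology_group (p - 1) X)"
  shows "(\<forall>c \<in> carrier (relative_homology_group p X S). hom_induced p X S X S h c = c) \<longleftrightarrow>
    (\<forall>c \<in> carrier (homology_group (p - 1) (subtopology X S)).
       hom_induced (p - 1) (subtopology X S) {} (subtopology X S) {} h c = c)"
proof -
  let ?R = "relative_homology_group p X S" and ?H = "homology_group (p - 1) (subtopology X S)"
  let ?d = "hom_boundary p X S"
  have ex1: "Coset.kernel ?R ?H ?d = hom_induced p X {} X S id ` carrier (homology_group p X)"
    using homology_exactness_axiom_1[of p X S] by simp
  have ex2: "Coset.kernel ?H (homology_group (p - 1) X) (hom_induced (p - 1) (subtopology X S) {} X {} id)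
       = ?d ` carrier ?R"
    using homology_exactness_axiom_2[of p X S] by simp
  interpret d: group_hom ?R ?H ?d
    by (simp add: group_hom_def group_hom_axioms_def hom_boundary_hom)
  interpret i: group_hom ?H "homology_group (p - 1) X" "hom_induced (p - 1) (subtopology X S) {} X {} id"
    by (simp add: group_hom_def group_hom_axioms_def hom_induced_empty_hom)
  interpret j: group_hom "homology_group p X" ?R "hom_induced p X {} X S id"
    by (simp add: group_hom_def group_hom_axioms_def hom_induced_hom)
  have "Coset.kernel ?R ?H ?d = {\<one>\<^bsub>?R\<^esub>}"
    unfolding ex1 using j.image_from_trivial_group t1 by simp
  then have inj: "inj_on ?d (carrier ?R)"
    using d.inj_iff_trivial_ker by simp
  have surj: "?d ` carrier ?R = carrier ?H"
    using i.kernel_to_trivial_group[OF t2] ex2 by simp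
  have nat: "?d (hom_induced p X S X S h c) =
      hom_induced (p - 1) (subtopology X S) {} (subtopology X S) {} h (?d c)" for c
    using naturality_hom_induced[OF h, of p] by (metis comp_apply)
  show ?thesis
  proof
    assume L: "\<forall>c\<in>carrier ?R. hom_induced p X S X S h c = c"
    show "\<forall>c\<in>carrier ?H. hom_induced (p - 1) (subtopology X S) {} (subtopology X S) {} h c = c"
    proof
      fix c assume "c \<in> carrier ?H"
      then obtain e where "e \<in> carrier ?R" "c = ?d e" using surj by blast
      then show "hom_induced (p - 1) (subtopology X S) {} (subtopology X S) {} h c = c"
        using L nat[of e] by simp
    qed
  next
    assume R: "\<forall>c\<in>carrier ?H. hom_induced (p - 1) (subtopology X S) {} (subtopology X S) {} h c = c"
    show "\<forall>c\<in>carrier ?R. hom_induced p X S X S h c = c"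
    proof
      fix c assume c: "c \<in> carrier ?R"
      then have eq: "?d (hom_induced p X S X S h c) = ?d c"
        using nat[of c] R surj by auto
      show "hom_induced p X S X S h c = c"
        by (rule inj_onD[OF inj eq hom_induced_carrier c])
    qed
  qed
qed

lemma trivial_homology_group_convex:
  fixes S :: "'a::real_normed_vector set"
  assumes "convex S" "p \<noteq> 0"
  shows "trivial_group (homology_group p (top_of_set S))"
proof -
  have "contractible_space (top_of_set S)"
    using assms convex_imp_contractible by (simp)
  then show ?thesis
    using trivial_reduced_homology_group_contractible_space[of "top_of_set S" p] assms
    by (simp add: un_reduced_homology_group)
qed

text \<open>
By invariance of domain the image of the open ball is open, hence lies in the interior of the closed
ball. The same holds for the inverse.
\<close>

lemma homeomorphism_cball_sphere:
  fixes h :: "'a::euclidean_space \<Rightarrow> 'a"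
  assumes hom: "homeomorphism (cball a r) (cball a r) h k" and "0 < r"
  shows "homeomorphism (sphere a r) (sphere a r) h k"
proof -
  have sub: "f ` ball a r \<subseteq> ball a r" if "homeomorphism (cball a r) (cball a r) f g" for f g
  proof -
    have c: "continuous_on (ball a r) f" and i: "inj_on f (ball a r)"
      using homeomorphism_cont1[OF that] ball_subset_cball continuous_on_subset
        inj_on_inverseI[of "ball a r" g f] homeomorphism_apply1[OF that]
      by blast+
    have "open (f ` ball a r)"
      using invariance_of_domain[OF c _ i] by simp
    moreover have "f ` ball a r \<subseteq> cball a r"
      using homeomorphism_image1[OF that] by auto
    ultimately show ?thesis
      using interior_maximal[of "f ` ball a r" "cball a r"] by simp
  qed
  have s: "f ` sphere a r \<subseteq> sphere a r" if "homeomorphism (cball a r) (cball a r) f g" for f g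
  proof
    fix y assume "y \<in> f ` sphere a r"
    then obtain x where x: "x \<in> sphere a r" "y = f x" by auto
    then have y: "y \<in> cball a r" and g: "g y = x"
      using homeomorphism_image1[OF that] homeomorphism_apply1[OF that] by auto
    have "y \<notin> ball a r"
      using sub[OF homeomorphism_symD[OF that]] g x by fastforce
    with y show "y \<in> sphere a r" by auto
  qed
  have hs: "homeomorphism (cball a r) (cball a r) k h"
    using homeomorphism_symD[OF hom] .
  show ?thesis
  proof (rule homeomorphismI)
    show "continuous_on (sphere a r) h" "continuous_on (sphere a r) k"
      using hom by (auto simp: homeomorphism_def intro: continuous_on_subset)
    show "h ` sphere a r \<subseteq> sphere a r" "k ` sphere a r \<subseteq> sphere a r"
      using s[OF hom] s[OF hs] by auto
  qed (use homeomorphism_apply1[OF hom] homeomorphism_apply2[OF hom] in auto)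
qed

lemma homeomorphic_map_top_of_set_iff:
  "homeomorphic_map (top_of_set S) (top_of_set T) h \<longleftrightarrow> (\<exists>k. homeomorphism S T h k)"
  by (simp add: homeomorphic_map_maps)

lemma orientation_preserving_homeo_cong:
  assumes eq: "\<And>x. x \<in> M \<Longrightarrow> g x = h x"
  shows "orientation_preserving_homeo n M B g \<longleftrightarrow> orientation_preserving_homeo n M B h"
proof -
  have "hom_induced (int n) (top_of_set M) B (top_of_set M) B g = hom_induced (int n) (top_of_set M) B (top_of_set M) B h"
    by (rule hom_induced_eq) (simp add: eq)
  moreover have "homeomorphic_map (top_of_set M) (top_of_set M) g \<longleftrightarrow> homeomorphic_map (top_of_set M) (top_of_set M) h"
    using homeomorphic_map_eq[of "top_of_set M" "top_of_set M" g h]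
      homeomorphic_map_eq[of "top_of_set M" "top_of_set M" h g] eq by auto
  ultimately show ?thesis by (simp add: orientation_preserving_homeo_def)
qed

lemma orientation_preserving_ball_iff_sphere:
  fixes g :: "complex \<times> complex \<Rightarrow> complex \<times> complex"
  assumes "\<epsilon> > 0" and g: "homeomorphism (cball 0 \<epsilon>) (cball 0 \<epsilon>) g g'"
  shows "orientation_preserving_homeo 4 (cball 0 \<epsilon>) (sphere 0 \<epsilon>) g \<longleftrightarrow>
    orientation_preserving_homeo 3 (sphere 0 \<epsilon>) {} g"
proof -
  let ?X = "top_of_set (cball (0 :: complex \<times> complex) \<epsilon>)" and ?S = "sphere (0 :: complex \<times> complex) \<epsilon>"
  have gs: "homeomorphism ?S ?S g g'" by (rule homeomorphism_cball_sphere[OF g assms(1)])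
  have sub: "subtopology ?X ?S = top_of_set ?S"
    by (simp add: subtopology_subtopology Int_absorb1)
  have maps: "homeomorphic_map ?X ?X g" "homeomorphic_map (top_of_set ?S) (top_of_set ?S) g"
    using g gs by (auto simp: homeomorphic_map_top_of_set_iff)
  have "continuous_map ?X ?X g" using maps(1) by (rule homeomorphic_imp_continuous_map)
  moreover have "g \<in> ?S \<rightarrow> ?S" using homeomorphism_image1[OF gs] by auto
  moreover have "trivial_group (homology_group 4 ?X)" "trivial_group (homology_group (4 - 1) ?X)"
    by (rule trivial_homology_group_convex; simp)+
  ultimately show ?thesis
    using trivial_boundary_identity_iff[of ?X g ?S 4] maps
    by (simp add: orientation_preserving_homeo_def sub)
qed

section \<open>Cones over links\<close>

text \<open>
The straight cone with vertex \<open>0\<close> over the part of \<open>C\<close> on the sphere of radius \<open>\<epsilon>\<close>. The vertex is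
included even if that part is empty.
\<close>

definition link_cone :: "real \<Rightarrow> 'a::real_normed_vector set \<Rightarrow> 'a set"
  where "link_cone \<epsilon> C = {x \<in> cball 0 \<epsilon>. x = 0 \<or> (\<epsilon> / norm x) *\<^sub>R x \<in> C}"

text \<open>
Fixing the sphere pointwise is what allows a homeomorphism between two links to be extended to the
balls without changing it on the sphere.
\<close>

definition conic_at :: "real \<Rightarrow> 'a::real_normed_vector set \<Rightarrow> bool"
  where "conic_at \<epsilon> C \<longleftrightarrow> (\<exists>H H'. homeomorphism (cball 0 \<epsilon>) (cball 0 \<epsilon>) H H' \<and>
    (\<forall>x\<in>sphere 0 \<epsilon>. H x = x) \<and> H ` link_cone \<epsilon> C = C \<inter> cball 0 \<epsilon>)"

text \<open>
The radial extension of a self-map of the sphere of radius \<open>\<epsilon>\<close>. At the origin the factor \<open>norm x\<close>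
makes the value \<open>0\<close>.
\<close>

definition cone_map :: "real \<Rightarrow> ('a::real_normed_vector \<Rightarrow> 'a) \<Rightarrow> 'a \<Rightarrow> 'a"
  where "cone_map \<epsilon> h x = (norm x / \<epsilon>) *\<^sub>R h ((\<epsilon> / norm x) *\<^sub>R x)"

context
  fixes \<epsilon> :: real and h k :: "'a::real_normed_vector \<Rightarrow> 'a"
  assumes \<epsilon>: "\<epsilon> > 0" and hk: "homeomorphism (sphere 0 \<epsilon>) (sphere 0 \<epsilon>) h k"
begin

lemma norm_cone_map: "norm (cone_map \<epsilon> h x) = norm x"
proof (cases "x = 0")
  case False
  then have "(\<epsilon> / norm x) *\<^sub>R x \<in> sphere 0 \<epsilon>" using \<epsilon> by simp
  then have "h ((\<epsilon> / norm x) *\<^sub>R x) \<in> sphere 0 \<epsilon>" using homeomorphism_image1[OF hk] by blast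
  then show ?thesis using \<epsilon> by (simp add: cone_map_def)
qed (simp add: cone_map_def)

lemma cone_map_inverse: "cone_map \<epsilon> k (cone_map \<epsilon> h x) = x"
proof (cases "x = 0")
  case False
  then have "(\<epsilon> / norm x) *\<^sub>R x \<in> sphere 0 \<epsilon>" using \<epsilon> by simp
  then have "k (h ((\<epsilon> / norm x) *\<^sub>R x)) = (\<epsilon> / norm x) *\<^sub>R x" by (rule homeomorphism_apply1[OF hk])
  moreover have "(\<epsilon> / norm x) *\<^sub>R cone_map \<epsilon> h x = h ((\<epsilon> / norm x) *\<^sub>R x)"
    using False \<epsilon> by (simp add: cone_map_def)
  ultimately show ?thesis
    unfolding cone_map_def[of \<epsilon> k] norm_cone_map using False \<epsilon> by simp
qed (simp add: cone_map_def)

lemma continuous_on_cone_map: "continuous_on UNIV (cone_map \<epsilon> h)"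
proof -
  have "isCont (cone_map \<epsilon> h) x" for x
  proof (cases "x = 0")
    case True
    have "((\<lambda>x. norm (cone_map \<epsilon> h x)) \<longlongrightarrow> 0) (at 0)"
      unfolding norm_cone_map by (rule tendsto_norm_zero[OF tendsto_ident_at])
    then have "(cone_map \<epsilon> h \<longlongrightarrow> 0) (at 0)" by (rule tendsto_norm_zero_cancel)
    then show ?thesis using True by (simp add: continuous_at cone_map_def)
  next
    case False
    have "continuous_on (- {0}) (\<lambda>x. h ((\<epsilon> / norm x) *\<^sub>R x))"
    proof (rule continuous_on_compose2[OF homeomorphism_cont1[OF hk]])
      show "continuous_on (- {0}) (\<lambda>x :: 'a. (\<epsilon> / norm x) *\<^sub>R x)" by (intro continuous_intros) auto
      show "(\<lambda>x. (\<epsilon> / norm x) *\<^sub>R x) ` (- {0}) \<subseteq> sphere (0 :: 'a) \<epsilon>"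
        using \<epsilon> by (auto split: if_splits)
    qed
    then have "continuous_on (- {0}) (cone_map \<epsilon> h)"
      unfolding cone_map_def[abs_def] using \<epsilon> by (intro continuous_intros) auto
    then show ?thesis using False by (simp add: continuous_on_eq_continuous_at open_Compl)
  qed
  then show ?thesis by (simp add: continuous_at_imp_continuous_on)
qed

lemma cone_map_on_sphere: "x \<in> sphere 0 \<epsilon> \<Longrightarrow> cone_map \<epsilon> h x = h x"
  using \<epsilon> by (simp add: cone_map_def)

lemma cone_map_link_cone:
  assumes "h ` (C \<inter> sphere 0 \<epsilon>) \<subseteq> C'"
  shows "cone_map \<epsilon> h ` link_cone \<epsilon> C \<subseteq> link_cone \<epsilon> C'"
proof
  fix y assume "y \<in> cone_map \<epsilon> h ` link_cone \<epsilon> C"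
  then obtain x where x: "x \<in> link_cone \<epsilon> C" "y = cone_map \<epsilon> h x" by blast
  have ny: "norm y = norm x" by (simp add: x(2) norm_cone_map)
  show "y \<in> link_cone \<epsilon> C'"
  proof (cases "x = 0")
    case True
    then show ?thesis using x \<epsilon> by (simp add: cone_map_def link_cone_def)
  next
    case False
    then have "(\<epsilon> / norm x) *\<^sub>R x \<in> C \<inter> sphere 0 \<epsilon>" using x(1) \<epsilon> by (simp add: link_cone_def)
    then have "h ((\<epsilon> / norm x) *\<^sub>R x) \<in> C'" using assms by blast
    moreover have "(\<epsilon> / norm y) *\<^sub>R y = h ((\<epsilon> / norm x) *\<^sub>R x)"
      unfolding ny unfolding x(2) using False \<epsilon> by (simp add: cone_map_def)
    ultimately show ?thesis using x(1) ny by (simp add: link_cone_def)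
  qed
qed

end

lemma homeomorphism_cone_map:
  assumes "\<epsilon> > 0" "homeomorphism (sphere 0 \<epsilon>) (sphere 0 \<epsilon>) h k"
  shows "homeomorphism (cball 0 \<epsilon>) (cball 0 \<epsilon>) (cone_map \<epsilon> h) (cone_map \<epsilon> k)"
proof -
  note hk = assms and kh = assms(1) homeomorphism_symD[OF assms(2)]
  show ?thesis
    by (rule homeomorphismI)
      (auto simp: norm_cone_map[OF hk] norm_cone_map[OF kh] cone_map_inverse[OF hk] cone_map_inverse[OF kh]
        intro: continuous_on_subset[OF continuous_on_cone_map[OF hk]]
          continuous_on_subset[OF continuous_on_cone_map[OF kh]])
qed

lemma cone_map_link_cone_eq:
  fixes h :: "'a::real_normed_vector \<Rightarrow> 'a"
  assumes \<epsilon>: "\<epsilon> > 0" and hk: "homeomorphism (sphere 0 \<epsilon>) (sphere 0 \<epsilon>) h k"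
    and im: "h ` (C \<inter> sphere 0 \<epsilon>) = C' \<inter> sphere 0 \<epsilon>"
  shows "cone_map \<epsilon> h ` link_cone \<epsilon> C = link_cone \<epsilon> C'"
proof
  show "cone_map \<epsilon> h ` link_cone \<epsilon> C \<subseteq> link_cone \<epsilon> C'"
    using im by (intro cone_map_link_cone[OF \<epsilon> hk]) blast
  note kh = homeomorphism_symD[OF hk]
  have "k ` (C' \<inter> sphere 0 \<epsilon>) \<subseteq> C"
    unfolding im[symmetric] using homeomorphism_apply1[OF hk] by auto
  then have "cone_map \<epsilon> k ` link_cone \<epsilon> C' \<subseteq> link_cone \<epsilon> C"
    by (rule cone_map_link_cone[OF \<epsilon> kh])
  then have "cone_map \<epsilon> h ` cone_map \<epsilon> k ` link_cone \<epsilon> C' \<subseteq> cone_map \<epsilon> h ` link_cone \<epsilon> C"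
    by (rule image_mono)
  then show "link_cone \<epsilon> C' \<subseteq> cone_map \<epsilon> h ` link_cone \<epsilon> C"
    by (simp add: image_image cone_map_inverse[OF \<epsilon> kh])
qed

text \<open>
The radial extension of \<open>h\<close> maps one cone onto the other. It is conjugated by the conic structures of
the two sets, which leave the sphere fixed.
\<close>

lemma extend_link_homeomorphism:
  fixes h :: "'a::real_normed_vector \<Rightarrow> 'a"
  assumes \<epsilon>: "\<epsilon> > 0" and con: "conic_at \<epsilon> C" "conic_at \<epsilon> C'"
    and hk: "homeomorphism (sphere 0 \<epsilon>) (sphere 0 \<epsilon>) h k"
    and im: "h ` (C \<inter> sphere 0 \<epsilon>) = C' \<inter> sphere 0 \<epsilon>"
  obtains g g' where "homeomorphism (cball 0 \<epsilon>) (cball 0 \<epsilon>) g g'" "\<And>x. x \<in> sphere 0 \<epsilon> \<Longrightarrow> g x = h x"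
    "g ` (C \<inter> cball 0 \<epsilon>) = C' \<inter> cball 0 \<epsilon>"
proof -
  obtain H K where H: "homeomorphism (cball 0 \<epsilon>) (cball 0 \<epsilon>) H K" "\<forall>x\<in>sphere 0 \<epsilon>. H x = x"
    "H ` link_cone \<epsilon> C = C \<inter> cball 0 \<epsilon>" using con(1) unfolding conic_at_def by blast
  obtain H' K' where H': "homeomorphism (cball 0 \<epsilon>) (cball 0 \<epsilon>) H' K'" "\<forall>x\<in>sphere 0 \<epsilon>. H' x = x"
    "H' ` link_cone \<epsilon> C' = C' \<inter> cball 0 \<epsilon>" using con(2) unfolding conic_at_def by blast
  let ?g = "H' \<circ> (cone_map \<epsilon> h \<circ> K)"
  have "homeomorphism (cball 0 \<epsilon>) (cball 0 \<epsilon>) ?g ((H \<circ> cone_map \<epsilon> k) \<circ> K')"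
    by (rule homeomorphism_compose[OF homeomorphism_compose[OF homeomorphism_symD[OF H(1)]
          homeomorphism_cone_map[OF \<epsilon> hk]] H'(1)])
  moreover have "?g x = h x" if x: "x \<in> sphere 0 \<epsilon>" for x
  proof -
    have "K x = x" using homeomorphism_apply1[OF H(1), of x] H(2) x by simp
    moreover have "h x \<in> sphere 0 \<epsilon>" using homeomorphism_image1[OF hk] x by blast
    ultimately show ?thesis using H'(2) x by (simp add: cone_map_on_sphere[OF \<epsilon> hk])
  qed
  moreover have "?g ` (C \<inter> cball 0 \<epsilon>) = C' \<inter> cball 0 \<epsilon>"
  proof -
    have "K ` (C \<inter> cball 0 \<epsilon>) = link_cone \<epsilon> C"
    proof -
      have "K (H x) = x" if "x \<in> link_cone \<epsilon> C" for x
        by (rule homeomorphism_apply1[OF H(1)]) (use that in \<open>simp add: link_cone_def\<close>)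
      then show ?thesis unfolding H(3)[symmetric] by (simp add: image_image)
    qed
    moreover have "?g ` (C \<inter> cball 0 \<epsilon>) = H' ` cone_map \<epsilon> h ` K ` (C \<inter> cball 0 \<epsilon>)"
      by (simp only: image_comp)
    ultimately show ?thesis using cone_map_link_cone_eq[OF \<epsilon> hk im] H'(3) by simp
  qed
  ultimately show ?thesis by (rule that)
qed

section \<open>Finite sets depending continuously on a parameter\<close>

lemma continuous_on_locally:
  fixes f :: "'a::topological_space \<Rightarrow> 'b::topological_space"
  assumes "\<And>x. x \<in> S \<Longrightarrow> \<exists>U. open U \<and> x \<in> U \<and> continuous_on (S \<inter> U) f"
  shows "continuous_on S f"
  unfolding continuous_on_def
proof
  fix x assume x: "x \<in> S"
  then obtain U where U: "open U" "x \<in> U" "continuous_on (S \<inter> U) f" using assms by blast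
  then have "(f \<longlongrightarrow> f x) (at x within (S \<inter> U))"
    using x by (simp add: continuous_on_def)
  moreover have "at x within (S \<inter> U) = at x within S"
    by (rule at_within_nhd[of x U]) (use U in auto)
  ultimately show "(f \<longlongrightarrow> f x) (at x within S)" by simp
qed

text \<open>
Only lower semicontinuity is demanded: near each point of \<open>Z x\<close> there is a point of \<open>Z y\<close> for nearby
\<open>y\<close>. Since the number of points is constant, no point of \<open>Z y\<close> can then be elsewhere, so that
\<open>Z\<close> is locally given by \<open>k\<close> disjoint continuous functions.
\<close>

definition varying_configuration ::
    "'a::metric_space set \<Rightarrow> ('a \<Rightarrow> 'b::metric_space set) \<Rightarrow> nat \<Rightarrow> bool"
  where "varying_configuration X Z k \<longleftrightarrow>
    (\<forall>x\<in>X. finite (Z x) \<and> card (Z x) = k \<and>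
      (\<forall>p\<in>Z x. \<forall>e>0. \<forall>\<^sub>F y in at x within X. \<exists>q\<in>Z y. dist q p < e))"

lemma varying_configuration_finite:
  "varying_configuration X Z k \<Longrightarrow> x \<in> X \<Longrightarrow> finite (Z x)"
  and varying_configuration_card:
  "varying_configuration X Z k \<Longrightarrow> x \<in> X \<Longrightarrow> card (Z x) = k"
  and varying_configuration_near:
  "varying_configuration X Z k \<Longrightarrow> x \<in> X \<Longrightarrow> p \<in> Z x \<Longrightarrow> e > 0 \<Longrightarrow>
    \<forall>\<^sub>F y in at x within X. \<exists>q\<in>Z y. dist q p < e"
  by (auto simp: varying_configuration_def)

lemma finite_separated:
  fixes S :: "'a::metric_space set"
  assumes "finite S"
  shows "\<exists>d>0. \<forall>p\<in>S. \<forall>q\<in>S. p \<noteq> q \<longrightarrow> d \<le> dist p q"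
proof -
  let ?D = "insert 1 ((\<lambda>(p, q). dist p q) ` {(p, q) \<in> S \<times> S. p \<noteq> q})"
  have fin: "finite ?D"
    using assms by (intro finite.insertI finite_imageI) (auto intro: finite_subset[of _ "S \<times> S"])
  have "Min ?D > 0" using fin by (subst Min_gr_iff) auto
  moreover have "Min ?D \<le> dist p q" if "p \<in> S" "q \<in> S" "p \<noteq> q" for p q
    by (rule Min_le[OF fin]) (use that in force)
  ultimately show ?thesis by blast
qed

text \<open>
Balls of radius \<open>e\<close> around the points of \<open>Z x\<close> are disjoint, and each contains a point of \<open>Z y\<close> for
\<open>y\<close> near \<open>x\<close>. By counting it contains exactly one. Following this point gives the section.
\<close>

lemma varying_configuration_local_sections:
  assumes vc: "varying_configuration X Z k" and x: "x \<in> X" and e: "e > 0"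
    and sep: "\<forall>p\<in>Z x. \<forall>q\<in>Z x. p \<noteq> q \<longrightarrow> 2 * e \<le> dist p q"
  obtains U v where "open U" "x \<in> U"
    "\<And>y. y \<in> X \<inter> U \<Longrightarrow> bij_betw (\<lambda>p. v p y) (Z x) (Z y)"
    "\<And>p. p \<in> Z x \<Longrightarrow> continuous_on (X \<inter> U) (v p)"
    "\<And>p y. p \<in> Z x \<Longrightarrow> y \<in> X \<inter> U \<Longrightarrow> dist (v p y) p < e"
    "\<And>p q y. p \<in> Z x \<Longrightarrow> y \<in> X \<inter> U \<Longrightarrow> q \<in> Z y \<Longrightarrow> dist q p < e \<Longrightarrow> q = v p y"
proof -
  have fin: "finite (Z x)" using vc x by (rule varying_configuration_finite)
  have "\<forall>\<^sub>F y in at x within X. \<forall>p\<in>Z x. \<exists>q\<in>Z y. dist q p < e"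
    using vc x e by (intro eventually_ball_finite fin ballI varying_configuration_near)
  then obtain U where U: "open U" "x \<in> U"
      "\<And>y. y \<in> U \<Longrightarrow> y \<noteq> x \<Longrightarrow> y \<in> X \<Longrightarrow> \<forall>p\<in>Z x. \<exists>q\<in>Z y. dist q p < e"
    unfolding eventually_at_topological by metis
  have ex: "\<exists>q\<in>Z y. dist q p < e" if "y \<in> X \<inter> U" "p \<in> Z x" for y p
    using U(3)[of y] that e by (cases "y = x") (auto intro!: bexI[of _ p])
  define v where "v p y = (SOME q. q \<in> Z y \<and> dist q p < e)" for p y
  have v: "v p y \<in> Z y" "dist (v p y) p < e" if "y \<in> X \<inter> U" "p \<in> Z x" for y p
    using someI_ex[of "\<lambda>q. q \<in> Z y \<and> dist q p < e"] ex[OF that] unfolding v_def by auto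
  have inj: "inj_on (\<lambda>p. v p y) (Z x)" if y: "y \<in> X \<inter> U" for y
  proof (rule inj_onI, rule ccontr)
    fix p q assume pq: "p \<in> Z x" "q \<in> Z x" "v p y = v q y" "p \<noteq> q"
    have "dist p q \<le> dist (v p y) p + dist (v q y) q"
      using dist_triangle3[of p q "v p y"] pq(3) by (simp add: dist_commute)
    then show False using v(2)[OF y pq(1)] v(2)[OF y pq(2)] sep pq by fastforce
  qed
  have bij: "bij_betw (\<lambda>p. v p y) (Z x) (Z y)" if y: "y \<in> X \<inter> U" for y
  proof -
    have "(\<lambda>p. v p y) ` Z x = Z y"
    proof (rule card_subset_eq)
      show "finite (Z y)" using vc y by (auto intro: varying_configuration_finite)
      show "card ((\<lambda>p. v p y) ` Z x) = card (Z y)"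
        using card_image[OF inj[OF y]] vc x y by (simp add: varying_configuration_card)
    qed (use v y in auto)
    then show ?thesis using inj[OF y] by (simp add: bij_betw_def)
  qed
  have uniq: "q = v p y" if y: "y \<in> X \<inter> U" and p: "p \<in> Z x" and q: "q \<in> Z y"
      and near: "dist q p < e" for p q y
  proof -
    obtain p' where p': "p' \<in> Z x" "q = v p' y"
      using bij[OF y] q by (auto simp: bij_betw_def)
    have "p' = p"
    proof (rule ccontr)
      assume ne: "p' \<noteq> p"
      have "dist p p' \<le> dist q p + dist q p'" by (rule dist_triangle3)
      then show False
        using near v(2)[OF y p'(1)] sep p ne p' by fastforce
    qed
    then show ?thesis using p' by simp
  qed
  have cont: "continuous_on (X \<inter> U) (v p)" if p: "p \<in> Z x" for p
    unfolding continuous_on_def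
  proof
    fix y assume y: "y \<in> X \<inter> U"
    show "(v p \<longlongrightarrow> v p y) (at y within X \<inter> U)"
    proof (rule tendstoI)
      fix e' :: real assume e': "e' > 0"
      define m where "m = min e' (e - dist (v p y) p)"
      have m: "m > 0" using e' v(2)[OF y p] by (simp add: m_def)
      have "\<forall>\<^sub>F z in at y within X. \<exists>q\<in>Z z. dist q (v p y) < m"
        using vc y v(1)[OF y p] m by (auto intro: varying_configuration_near)
      then have "\<forall>\<^sub>F z in at y within X \<inter> U. \<exists>q\<in>Z z. dist q (v p y) < m"
        by (rule filter_leD[rotated]) (auto intro: at_le)
      moreover have "\<forall>\<^sub>F z in at y within X \<inter> U. z \<in> X \<inter> U"
        by (simp add: eventually_at_filter)
      ultimately show "\<forall>\<^sub>F z in at y within X \<inter> U. dist (v p z) (v p y) < e'"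
      proof eventually_elim
        case (elim z)
        then obtain q where q: "q \<in> Z z" "dist q (v p y) < m" by auto
        then have "dist q p < e"
          using dist_triangle[of q p "v p y"] by (simp add: m_def)
        then have "q = v p z" using uniq elim(2) p q(1) by blast
        then show ?case using q(2) by (simp add: m_def)
      qed
    qed
  qed
  show ?thesis
    by (rule that[of U v]) (use U bij cont v uniq in auto)
qed

lemma varying_configuration_compose:
  assumes vc: "varying_configuration X Z k" and g: "continuous_on Y g" "g ` Y \<subseteq> X"
  shows "varying_configuration Y (\<lambda>y. Z (g y)) k"
  unfolding varying_configuration_def
proof (intro ballI conjI allI impI)
  fix y assume y: "y \<in> Y"
  then have gy: "g y \<in> X" using g by auto
  show "finite (Z (g y))" "card (Z (g y)) = k"
    using vc gy by (auto intro: varying_configuration_finite varying_configuration_card)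
  fix p and e :: real assume p: "p \<in> Z (g y)" "e > 0"
  have "(g \<longlongrightarrow> g y) (at y within Y)" using g y by (simp add: continuous_on_def)
  moreover have "\<forall>\<^sub>F x in nhds (g y). x \<in> X \<longrightarrow> (\<exists>q\<in>Z x. dist q p < e)"
    using varying_configuration_near[OF vc gy p] p
    by (auto simp: eventually_at_filter elim!: eventually_mono)
      (metis dist_self)
  ultimately have "\<forall>\<^sub>F x in at y within Y. g x \<in> X \<longrightarrow> (\<exists>q\<in>Z (g x). dist q p < e)"
    by (rule eventually_compose_filterlim[rotated])
  then show "\<forall>\<^sub>F x in at y within Y. \<exists>q\<in>Z (g x). dist q p < e"
    using g by (auto simp: eventually_at_filter elim!: eventually_mono)
qed

lemma varying_configuration_subset:
  "varying_configuration X Z k \<Longrightarrow> Y \<subseteq> X \<Longrightarrow> varying_configuration Y Z k"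
  using varying_configuration_compose[of X Z k Y id] by simp

text \<open>
Symmetric expressions in the points of a configuration are continuous, as a labelling of the points
by local sections shows. This is why the pushing maps below are written as sums over configurations.
\<close>

lemma continuous_on_sum_varying_configuration:
  fixes F :: "'a::metric_space \<Rightarrow> 'b::metric_space \<Rightarrow> 'c::real_normed_vector"
  assumes vc: "varying_configuration X Z k"
    and F: "continuous_on (X \<times> UNIV) (\<lambda>(x, p). F x p)"
  shows "continuous_on X (\<lambda>x. \<Sum>p\<in>Z x. F x p)"
proof (rule continuous_on_locally)
  fix x assume x: "x \<in> X"
  obtain d where d: "d > 0" "\<And>p q. p \<in> Z x \<Longrightarrow> q \<in> Z x \<Longrightarrow> p \<noteq> q \<Longrightarrow> d \<le> dist p q"
    using finite_separated[OF varying_configuration_finite[OF vc x]] by blast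
  have e: "d / 2 > 0" "\<forall>p\<in>Z x. \<forall>q\<in>Z x. p \<noteq> q \<longrightarrow> 2 * (d / 2) \<le> dist p q"
    using d by auto
  obtain U v where U: "open U" "x \<in> U"
    and bij: "\<And>y. y \<in> X \<inter> U \<Longrightarrow> bij_betw (\<lambda>p. v p y) (Z x) (Z y)"
    and cont: "\<And>p. p \<in> Z x \<Longrightarrow> continuous_on (X \<inter> U) (v p)"
    and near: "\<And>p y. p \<in> Z x \<Longrightarrow> y \<in> X \<inter> U \<Longrightarrow> dist (v p y) p < d / 2"
    and uniq: "\<And>p q y. p \<in> Z x \<Longrightarrow> y \<in> X \<inter> U \<Longrightarrow> q \<in> Z y \<Longrightarrow> dist q p < d / 2 \<Longrightarrow> q = v p y"
    by (rule varying_configuration_local_sections[OF vc x e]) (rule that)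
  have "continuous_on (X \<inter> U) (\<lambda>y. (\<lambda>(x, p). F x p) (y, v p y))" if "p \<in> Z x" for p
    by (rule continuous_on_compose2[OF F]) (use cont[OF that] in \<open>auto intro!: continuous_intros\<close>)
  then have "continuous_on (X \<inter> U) (\<lambda>y. \<Sum>p\<in>Z x. F y (v p y))"
    by (intro continuous_on_sum) simp
  then have "continuous_on (X \<inter> U) (\<lambda>y. \<Sum>p\<in>Z y. F y p)"
    by (rule continuous_on_eq) (rule sum.reindex_bij_betw[OF bij])
  then show "\<exists>U. open U \<and> x \<in> U \<and> continuous_on (X \<inter> U) (\<lambda>y. \<Sum>p\<in>Z y. F y p)"
    using U by blast
qed

lemma varying_configuration_covering_space:
  fixes Z :: "'a::metric_space \<Rightarrow> 'b::metric_space set"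
  assumes vc: "varying_configuration X Z k" and k: "k > 0"
  shows "covering_space (SIGMA x:X. Z x) fst X"
  unfolding covering_space_def
proof (intro conjI ballI)
  let ?E = "SIGMA x:X. Z x"
  show "continuous_on ?E fst" by (rule continuous_on_fst[OF continuous_on_id])
  have "Z x \<noteq> {}" if "x \<in> X" for x
    using varying_configuration_card[OF vc that] k by auto
  then show "fst ` ?E = X" by force
  fix x assume x: "x \<in> X"
  obtain d where d: "d > 0" "\<And>p q. p \<in> Z x \<Longrightarrow> q \<in> Z x \<Longrightarrow> p \<noteq> q \<Longrightarrow> d \<le> dist p q"
    using finite_separated[OF varying_configuration_finite[OF vc x]] by blast
  have e: "d / 2 > 0" "\<forall>p\<in>Z x. \<forall>q\<in>Z x. p \<noteq> q \<longrightarrow> 2 * (d / 2) \<le> dist p q"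
    using d by auto
  obtain U v where U: "open U" "x \<in> U"
    and bij: "\<And>y. y \<in> X \<inter> U \<Longrightarrow> bij_betw (\<lambda>p. v p y) (Z x) (Z y)"
    and cont: "\<And>p. p \<in> Z x \<Longrightarrow> continuous_on (X \<inter> U) (v p)"
    and near: "\<And>p y. p \<in> Z x \<Longrightarrow> y \<in> X \<inter> U \<Longrightarrow> dist (v p y) p < d / 2"
    and uniq: "\<And>p q y. p \<in> Z x \<Longrightarrow> y \<in> X \<inter> U \<Longrightarrow> q \<in> Z y \<Longrightarrow> dist q p < d / 2 \<Longrightarrow> q = v p y"
    by (rule varying_configuration_local_sections[OF vc x e]) (rule that)
  define sheet where "sheet p = (\<lambda>y. (y, v p y)) ` (X \<inter> U)" for p
  have vZ: "v p y \<in> Z y" if "p \<in> Z x" "y \<in> X \<inter> U" for p y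
    using bij[OF that(2)] that(1) by (auto simp: bij_betw_def)
  show "\<exists>T. x \<in> T \<and> openin (top_of_set X) T \<and>
           (\<exists>V. \<Union> V = ?E \<inter> fst -` T \<and> (\<forall>u\<in>V. openin (top_of_set ?E) u) \<and>
                pairwise disjnt V \<and> (\<forall>u\<in>V. \<exists>q. homeomorphism u T fst q))"
  proof (intro exI[of _ "X \<inter> U"] exI[of _ "sheet ` Z x"] conjI ballI)
    show "\<Union> (sheet ` Z x) = ?E \<inter> fst -` (X \<inter> U)"
    proof
      show "?E \<inter> fst -` (X \<inter> U) \<subseteq> \<Union> (sheet ` Z x)"
      proof
        fix e assume "e \<in> ?E \<inter> fst -` (X \<inter> U)"
        then obtain y q where e: "e = (y, q)" "y \<in> X \<inter> U" "q \<in> Z y" by auto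
        then obtain p where "p \<in> Z x" "q = v p y" using bij[OF e(2)] by (auto simp: bij_betw_def)
        then show "e \<in> \<Union> (sheet ` Z x)" using e by (auto simp: sheet_def)
      qed
    qed (auto simp: sheet_def vZ)
    show "openin (top_of_set ?E) u" if "u \<in> sheet ` Z x" for u
    proof -
      obtain p where p: "p \<in> Z x" "u = sheet p" using \<open>u \<in> sheet ` Z x\<close> by auto
      have "u = ?E \<inter> (U \<times> ball p (d / 2))"
      proof
        show "u \<subseteq> ?E \<inter> (U \<times> ball p (d / 2))"
          using near[OF p(1)] vZ[OF p(1)] by (auto simp: p(2) sheet_def dist_commute)
        show "?E \<inter> (U \<times> ball p (d / 2)) \<subseteq> u"
          using uniq[OF p(1)] by (auto simp: p(2) sheet_def dist_commute)
      qed
      then show ?thesis using U by (auto intro!: openin_open_Int open_Times)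
    qed
    show "pairwise disjnt (sheet ` Z x)"
    proof (clarsimp simp: pairwise_def disjnt_def)
      fix p p' assume p: "p \<in> Z x" "p' \<in> Z x" "sheet p \<noteq> sheet p'"
      show "sheet p \<inter> sheet p' = {}"
      proof (rule ccontr)
        assume "sheet p \<inter> sheet p' \<noteq> {}"
        then obtain y where y: "y \<in> X \<inter> U" "v p y = v p' y" by (auto simp: sheet_def)
        then have "p = p'" using bij[OF y(1)] p by (auto simp: bij_betw_def inj_on_def)
        then show False using p by simp
      qed
    qed
    show "\<exists>q. homeomorphism u (X \<inter> U) fst q" if "u \<in> sheet ` Z x" for u
    proof -
      obtain p where p: "p \<in> Z x" "u = sheet p" using \<open>u \<in> sheet ` Z x\<close> by auto
      have "homeomorphism u (X \<inter> U) fst (\<lambda>y. (y, v p y))"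
        by (rule homeomorphismI)
          (use cont[OF p(1)] in \<open>auto simp: p(2) sheet_def intro!: continuous_intros\<close>)
      then show ?thesis by blast
    qed
  qed (use x U in auto)
qed

text \<open>
The total space of a configuration is a covering of its base, and a convex base is simply connected,
so the identity lifts through every point of a fibre.
\<close>

lemma varying_configuration_global_sections:
  fixes X :: "'a::euclidean_space set" and Z :: "'a \<Rightarrow> 'b::euclidean_space set"
  assumes vc: "varying_configuration X Z k" and X: "open X" "convex X" and a: "a \<in> X"
  obtains v where "\<And>x. x \<in> X \<Longrightarrow> bij_betw (\<lambda>p. v p x) (Z a) (Z x)"
    "\<And>p. p \<in> Z a \<Longrightarrow> continuous_on X (v p)"
proof (cases "k = 0")
  case True
  then have "Z x = {}" if "x \<in> X" for x
    using varying_configuration_finite[OF vc that] varying_configuration_card[OF vc that] by simp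
  then show ?thesis using a by (intro that[of "\<lambda>p x. p"]) (auto simp: bij_betw_def)
next
  case False
  let ?E = "SIGMA x:X. Z x"
  have cov: "covering_space ?E fst X"
    using varying_configuration_covering_space[OF vc] False by simp
  have sc: "simply_connected X" using X by (simp add: convex_imp_simply_connected)
  have lpc: "locally path_connected X" using X(1) by (rule open_imp_locally_path_connected)
  have "\<exists>g. continuous_on X g \<and> g \<in> X \<rightarrow> ?E \<and> g a = (a, p) \<and> (\<forall>y\<in>X. fst (g y) = y)"
    if p: "p \<in> Z a" for p
  proof -
    have ap: "(a, p) \<in> ?E" using a p by simp
    show ?thesis
      by (rule covering_space_lift_strong[OF cov ap a sc lpc, of id])
        (auto intro!: continuous_intros)
  qed
  then obtain g where g: "\<And>p. p \<in> Z a \<Longrightarrow> continuous_on X (g p)"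
    "\<And>p. p \<in> Z a \<Longrightarrow> g p \<in> X \<rightarrow> ?E" "\<And>p. p \<in> Z a \<Longrightarrow> g p a = (a, p)"
    "\<And>p y. p \<in> Z a \<Longrightarrow> y \<in> X \<Longrightarrow> fst (g p y) = y"
    by metis
  have inZ: "snd (g p x) \<in> Z x" if "p \<in> Z a" "x \<in> X" for p x
    using g(2)[OF that(1)] g(4)[OF that] that(2) by force
  have inj: "inj_on (\<lambda>p. snd (g p x)) (Z a)" if x: "x \<in> X" for x
  proof (rule inj_onI)
    fix p q assume pq: "p \<in> Z a" "q \<in> Z a" "snd (g p x) = snd (g q x)"
    then have eq: "g p x = g q x" using g(4) x by (metis prod_eqI)
    have "g p a = g q a"
      by (rule covering_space_lift_unique[where f = id and T = X, OF cov, of "g p" x "g q" a])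
        (use eq g pq x a X in \<open>auto intro: convex_connected\<close>)
    then show "p = q" using g(3) pq by simp
  qed
  show ?thesis
  proof (rule that[of "\<lambda>p x. snd (g p x)"])
    fix x assume x: "x \<in> X"
    have "(\<lambda>p. snd (g p x)) ` Z a = Z x"
    proof (rule card_subset_eq)
      show "finite (Z x)" using vc x by (rule varying_configuration_finite)
      show "card ((\<lambda>p. snd (g p x)) ` Z a) = card (Z x)"
        using card_image[OF inj[OF x]] vc x a by (simp add: varying_configuration_card)
    qed (use inZ x in auto)
    then show "bij_betw (\<lambda>p. snd (g p x)) (Z a) (Z x)" using inj[OF x] by (simp add: bij_betw_def)
  qed (use g in \<open>auto intro!: continuous_intros\<close>)
qed

section \<open>Pushing one configuration onto a nearby one\<close>

text \<open>
The inverse at \<open>y\<close> exists by Banach's fixed point theorem. Because the expansion constant is uniform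
in \<open>y\<close>, the inverse is continuous in both variables.
\<close>

lemma perturbed_identity_inverse:
  fixes d :: "'a::topological_space \<Rightarrow> 'b::banach \<Rightarrow> 'b"
  assumes cont: "continuous_on (Y \<times> UNIV) (\<lambda>(y, x). d y x)"
    and lip: "\<And>y x x'. y \<in> Y \<Longrightarrow> norm (d y x - d y x') \<le> norm (x - x') / 2"
  obtains g where "continuous_on (Y \<times> UNIV) (\<lambda>(y, x). g y x)"
    "\<And>y x. y \<in> Y \<Longrightarrow> g y (x + d y x) = x" "\<And>y x. y \<in> Y \<Longrightarrow> g y x + d y (g y x) = x"
proof -
  have expand: "norm (x - x') \<le> 2 * norm ((x + d y x) - (x' + d y x'))" if "y \<in> Y" for y x x'
  proof -
    have "x - x' = ((x + d y x) - (x' + d y x')) - (d y x - d y x')" by simp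
    then have "norm (x - x') \<le> norm ((x + d y x) - (x' + d y x')) + norm (d y x - d y x')"
      by (metis norm_triangle_ineq4)
    then show ?thesis using lip[OF that, of x x'] by linarith
  qed
  have "\<exists>x. x + d y x = w" if y: "y \<in> Y" for y w
  proof -
    have "\<exists>!x. w - d y x = x"
    proof (rule banach_fix_type)
      show "\<forall>x x'. dist (w - d y x) (w - d y x') \<le> 1 / 2 * dist x x'"
        using lip[OF y] by (simp add: dist_norm norm_minus_commute)
    qed auto
    then obtain x where "w - d y x = x" by auto
    then show ?thesis by (metis diff_add_cancel)
  qed
  then obtain g where g: "\<And>y w. y \<in> Y \<Longrightarrow> g y w + d y (g y w) = w" by metis
  show ?thesis
  proof (rule that[OF _ _ g])
    show "g y (x + d y x) = x" if "y \<in> Y" for y x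
      using expand[OF that, of "g y (x + d y x)" x] g[OF that] by simp
    show "continuous_on (Y \<times> UNIV) (\<lambda>(y, x). g y x)"
      unfolding continuous_on_def
    proof
      fix q assume "q \<in> Y \<times> (UNIV :: 'b set)"
      then obtain y0 w0 where q: "q = (y0, w0)" "y0 \<in> Y" by auto
      let ?F = "at q within Y \<times> (UNIV :: 'b set)"
      let ?x = "g y0 w0"
      have "continuous_on (Y \<times> UNIV) (\<lambda>p. (\<lambda>(y, x). d y x) (fst p, ?x))"
        by (rule continuous_on_compose2[OF cont]) (auto intro!: continuous_intros)
      then have "((\<lambda>p. d (fst p) ?x) \<longlongrightarrow> d y0 ?x) ?F"
        using q by (auto simp: continuous_on_def)
      moreover have "(snd \<longlongrightarrow> w0) ?F"
        using tendsto_snd[OF tendsto_ident_at, of q "Y \<times> (UNIV :: 'b set)"] q by simp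
      ultimately have "((\<lambda>p. 2 * norm (snd p - (?x + d (fst p) ?x))) \<longlongrightarrow> 2 * norm (w0 - (?x + d y0 ?x))) ?F"
        by (intro tendsto_intros)
      then have lim: "((\<lambda>p. 2 * norm (snd p - (?x + d (fst p) ?x))) \<longlongrightarrow> 0) ?F"
        using g[OF q(2), of w0] by simp
      have "((\<lambda>p. g (fst p) (snd p) - ?x) \<longlongrightarrow> 0) ?F"
      proof (rule Lim_null_comparison[OF _ lim])
        have "\<forall>\<^sub>F p in ?F. p \<in> Y \<times> UNIV" by (simp add: eventually_at_filter)
        then show "\<forall>\<^sub>F p in ?F. norm (g (fst p) (snd p) - ?x) \<le> 2 * norm (snd p - (?x + d (fst p) ?x))"
        proof eventually_elim
          case (elim p)
          then have "fst p \<in> Y" by auto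
          then show ?case using expand[of "fst p" "g (fst p) (snd p)" ?x] g[of "fst p" "snd p"] by simp
        qed
      qed
      then show "((\<lambda>(y, x). g y x) \<longlongrightarrow> (case q of (y, x) \<Rightarrow> g y x)) ?F"
        unfolding case_prod_beta using q by (simp add: LIM_zero_iff)
    qed
  qed
qed

definition separated :: "real \<Rightarrow> 'a::metric_space set \<Rightarrow> bool"
  where "separated \<sigma> P \<longleftrightarrow> (\<forall>p\<in>P. \<forall>q\<in>P. p \<noteq> q \<longrightarrow> \<sigma> \<le> dist p q)"

text \<open>
The displacement at \<open>x\<close> which moves every \<open>p \<in> P\<close> to its close neighbour in \<open>Q\<close>. The first factor is
a bump around \<open>p\<close>. The second factor selects the neighbour: it is \<open>1\<close> if the distance of \<open>p\<close> and \<open>q\<close>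
is at most \<open>\<sigma> / 4\<close> and \<open>0\<close> if it is at least \<open>\<sigma> / 2\<close>. Using a cut-off instead of
the neighbour itself keeps the formula continuous in the two configurations.
\<close>

definition push :: "real \<Rightarrow> 'a::real_normed_vector set \<Rightarrow> 'a set \<Rightarrow> 'a \<Rightarrow> 'a"
  where "push \<sigma> P Q x = (\<Sum>p\<in>P. \<Sum>q\<in>Q.
    (max 0 (1 - 4 * dist x p / \<sigma>) * max 0 (min 1 (2 - 4 * dist p q / \<sigma>))) *\<^sub>R (q - p))"

text \<open>
The bumps of \<open>push\<close> have radius \<open>\<sigma> / 4\<close> and so are disjoint. A bump has slope \<open>4 / \<sigma>\<close> and
is multiplied by a vector of length at most \<open>\<sigma> / 16\<close>, which leaves Lipschitz constant
\<open>1 / 4\<close> for each of them.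
\<close>

locale close_configurations =
  fixes \<sigma> :: real and P Q :: "'a::real_normed_vector set"
  assumes \<sigma>: "\<sigma> > 0" and fin: "finite P" "finite Q" and card: "card P = card Q"
    and sepP: "separated \<sigma> P" and sepQ: "separated \<sigma> Q"
    and near: "\<And>p. p \<in> P \<Longrightarrow> \<exists>q\<in>Q. dist p q < \<sigma> / 16"
begin

definition partner :: "'a \<Rightarrow> 'a"
  where "partner p = (SOME q. q \<in> Q \<and> dist p q < \<sigma> / 16)"

lemma partner: assumes "p \<in> P" shows "partner p \<in> Q" "dist p (partner p) < \<sigma> / 16"
  using someI_ex[of "\<lambda>q. q \<in> Q \<and> dist p q < \<sigma> / 16"] near[OF assms] by (auto simp: partner_def)

lemma partner_unique: "p \<in> P \<Longrightarrow> q \<in> Q \<Longrightarrow> dist p q < \<sigma> / 2 \<Longrightarrow> q = partner p"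
  using partner[of p] sepQ \<sigma> dist_triangle3[of q "partner p" p]
  by (auto simp: separated_def) (smt (verit) field_sum_of_halves)

lemma partner_image: "partner ` P = Q"
proof (rule card_subset_eq[OF fin(2)])
  have "inj_on partner P"
  proof (rule inj_onI, rule ccontr)
    fix p p' assume p: "p \<in> P" "p' \<in> P" "partner p = partner p'" "p \<noteq> p'"
    have "dist p p' \<le> dist p (partner p) + dist p' (partner p)" by (rule dist_triangle2)
    then show False using partner[OF p(1)] partner[OF p(2)] p sepP \<sigma> by (fastforce simp: separated_def)
  qed
  then show "card (partner ` P) = card Q" by (simp add: card_image card)
qed (use partner in auto)

lemma push_eq: "push \<sigma> P Q x = (\<Sum>p\<in>P. max 0 (1 - 4 * dist x p / \<sigma>) *\<^sub>R (partner p - p))"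
  unfolding push_def
proof (rule sum.cong[OF refl])
  fix p assume p: "p \<in> P"
  let ?b = "max 0 (1 - 4 * dist x p / \<sigma>)" and ?c = "\<lambda>q. max 0 (min 1 (2 - 4 * dist p q / \<sigma>))"
  have "?c q = 0" if "q \<in> Q - {partner p}" for q
  proof -
    have "dist p q \<ge> \<sigma> / 2" using partner_unique[OF p, of q] that by force
    then show ?thesis using \<sigma> by (simp add: field_simps)
  qed
  then have "(\<Sum>q\<in>Q. (?b * ?c q) *\<^sub>R (q - p)) = (\<Sum>q\<in>{partner p}. (?b * ?c q) *\<^sub>R (q - p))"
    using partner[OF p] fin by (intro sum.mono_neutral_right) auto
  moreover have "?c (partner p) = 1"
    using partner(2)[OF p] \<sigma> by (simp add: field_simps)
  ultimately show "(\<Sum>q\<in>Q. (?b * ?c q) *\<^sub>R (q - p)) = ?b *\<^sub>R (partner p - p)" by simp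
qed

text \<open>
At most one bump is active at \<open>x\<close> and at most one at \<open>x'\<close>, so the difference has at most two terms,
each with Lipschitz constant \<open>1 / 4\<close>.
\<close>

lemma push_lipschitz: "norm (push \<sigma> P Q x - push \<sigma> P Q x') \<le> norm (x - x') / 2"
proof -
  let ?b = "\<lambda>x p. max 0 (1 - 4 * dist x p / \<sigma>)"
  define N where "N x = {p \<in> P. dist x p < \<sigma> / 4}" for x
  have b0: "?b x p = 0" if "p \<in> P - N x" for x p
    using that \<sigma> by (auto simp: N_def field_simps)
  have N1: "card (N x) \<le> 1" for x
  proof -
    have "p = q" if "p \<in> N x" "q \<in> N x" for p q
    proof (rule ccontr)
      assume "p \<noteq> q"
      then have "\<sigma> \<le> dist p q" using that sepP by (auto simp: N_def separated_def)
      then show False using that dist_triangle3[of p q x] \<sigma> by (auto simp: N_def)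
    qed
    then show ?thesis using card_le_Suc0_iff_eq[of "N x"] fin by (auto simp: N_def)
  qed
  have "push \<sigma> P Q x - push \<sigma> P Q x' = (\<Sum>p\<in>P. (?b x p - ?b x' p) *\<^sub>R (partner p - p))"
    unfolding push_eq by (simp add: sum_subtractf scaleR_left_diff_distrib)
  also have "\<dots> = (\<Sum>p\<in>N x \<union> N x'. (?b x p - ?b x' p) *\<^sub>R (partner p - p))"
    by (rule sum.mono_neutral_right) (use fin b0 in \<open>auto simp: N_def\<close>)
  finally have eq: "push \<sigma> P Q x - push \<sigma> P Q x' = (\<Sum>p\<in>N x \<union> N x'. (?b x p - ?b x' p) *\<^sub>R (partner p - p))" .
  have "norm (push \<sigma> P Q x - push \<sigma> P Q x')
      \<le> (\<Sum>p\<in>N x \<union> N x'. norm ((?b x p - ?b x' p) *\<^sub>R (partner p - p)))"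
    unfolding eq by (rule norm_sum)
  also have "\<dots> \<le> (\<Sum>p\<in>N x \<union> N x'. norm (x - x') / 4)"
  proof (rule sum_mono)
    fix p assume "p \<in> N x \<union> N x'"
    then have p: "p \<in> P" by (auto simp: N_def)
    have "\<bar>?b x p - ?b x' p\<bar> \<le> \<bar>4 * dist x p / \<sigma> - 4 * dist x' p / \<sigma>\<bar>" by (auto simp: max_def abs_if)
    also have "\<dots> = 4 / \<sigma> * \<bar>dist x p - dist x' p\<bar>"
    proof -
      have "4 * dist x p / \<sigma> - 4 * dist x' p / \<sigma> = 4 / \<sigma> * (dist x p - dist x' p)"
        by (simp add: diff_divide_distrib right_diff_distrib)
      then show ?thesis using \<sigma> by (simp only: abs_mult) simp
    qed
    also have "\<dots> \<le> 4 / \<sigma> * norm (x - x')"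
    proof (rule mult_left_mono)
      show "\<bar>dist x p - dist x' p\<bar> \<le> norm (x - x')"
        using abs_dist_diff_le[of x p x'] by (simp only: dist_commute[of p x'] dist_norm[of x x'])
    qed (use \<sigma> in simp)
    finally have b: "\<bar>?b x p - ?b x' p\<bar> \<le> 4 / \<sigma> * norm (x - x')" .
    have "norm (partner p - p) \<le> \<sigma> / 16"
      using partner(2)[OF p] by (simp add: dist_norm norm_minus_commute)
    from mult_mono[OF b this]
    have "norm ((?b x p - ?b x' p) *\<^sub>R (partner p - p)) \<le> (4 / \<sigma> * norm (x - x')) * (\<sigma> / 16)"
      using \<sigma> by simp
    then show "norm ((?b x p - ?b x' p) *\<^sub>R (partner p - p)) \<le> norm (x - x') / 4" using \<sigma> by simp
  qed
  also have "\<dots> = card (N x \<union> N x') * (norm (x - x') / 4)" by simp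
  also have "\<dots> \<le> 2 * (norm (x - x') / 4)"
  proof (rule mult_right_mono)
    show "real (card (N x \<union> N x')) \<le> 2"
      using card_Un_le[of "N x" "N x'"] N1[of x] N1[of x'] by linarith
  qed simp
  finally show ?thesis by simp
qed

lemma push_image: "(\<lambda>x. x + push \<sigma> P Q x) ` P = Q"
proof -
  have "p + push \<sigma> P Q p = partner p" if p: "p \<in> P" for p
  proof -
    have "max 0 (1 - 4 * dist p q / \<sigma>) = 0" if "q \<in> P - {p}" for q
    proof -
      have "\<sigma> \<le> dist p q" using sepP p that by (auto simp: separated_def)
      then have "1 \<le> 4 * dist p q / \<sigma>" using \<sigma> by (simp add: field_simps)
      then show ?thesis by simp
    qed
    then have "(\<Sum>q\<in>P. max 0 (1 - 4 * dist p q / \<sigma>) *\<^sub>R (partner q - q)) =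
        (\<Sum>q\<in>{p}. max 0 (1 - 4 * dist p q / \<sigma>) *\<^sub>R (partner q - q))"
      using p fin by (intro sum.mono_neutral_right) auto
    then show ?thesis unfolding push_eq by simp
  qed
  then show ?thesis using partner_image by (metis (mono_tags, lifting) image_cong)
qed

lemma push_outside:
  assumes "P \<subseteq> ball 0 K" "K + 1 \<le> norm x" "\<sigma> \<le> 4"
  shows "push \<sigma> P Q x = 0"
  unfolding push_eq
proof (rule sum.neutral, rule ballI)
  fix p assume "p \<in> P"
  then have "norm p < K" using assms(1) by auto
  then have "dist x p \<ge> 1" using assms(2) norm_triangle_ineq2[of x p] by (simp add: dist_norm)
  then have "1 - 4 * dist x p / \<sigma> \<le> 0" using \<sigma> assms(3) by (simp add: field_simps)
  then show "max 0 (1 - 4 * dist x p / \<sigma>) *\<^sub>R (partner p - p) = 0" by simp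
qed

end

lemma push_self:
  assumes "\<sigma> > 0" "finite P" "separated \<sigma> P"
  shows "push \<sigma> P P x = 0"
proof -
  interpret close_configurations \<sigma> P P
    by standard (use assms in \<open>auto intro!: bexI\<close>)
  have "partner p = p" if "p \<in> P" for p using partner_unique[OF that that] \<sigma> by simp
  then show ?thesis by (simp add: push_eq)
qed

text \<open>
A property of points and radii that passes to smaller radii holds with a uniform radius on a compact
set if it does so locally.
\<close>

lemma compact_uniform_radius:
  fixes S :: "'a::metric_space set"
  assumes S: "compact S"
    and loc: "\<And>x. x \<in> S \<Longrightarrow> \<exists>U \<sigma>. open U \<and> x \<in> U \<and> \<sigma> > 0 \<and> (\<forall>y\<in>S \<inter> U. R y \<sigma>)"
    and anti: "\<And>x \<sigma> \<tau>. R x \<sigma> \<Longrightarrow> 0 < \<tau> \<Longrightarrow> \<tau> \<le> \<sigma> \<Longrightarrow> R x \<tau>"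
  obtains \<sigma> where "\<sigma> > 0" "\<And>x. x \<in> S \<Longrightarrow> R x (\<sigma> :: real)"
proof -
  obtain U r where U: "\<And>x. x \<in> S \<Longrightarrow> open (U x) \<and> x \<in> U x \<and> r x > (0::real) \<and> (\<forall>y\<in>S \<inter> U x. R y (r x))"
    using loc by metis
  obtain T where T: "T \<subseteq> S" "finite T" "S \<subseteq> (\<Union>x\<in>T. U x)"
    using compactE_image[OF S, of S U] U by blast
  define \<sigma> where "\<sigma> = Min (insert 1 (r ` T))"
  have "\<sigma> > 0" unfolding \<sigma>_def using T U by (subst Min_gr_iff) auto
  moreover have "R x \<sigma>" if x: "x \<in> S" for x
  proof -
    obtain t where t: "t \<in> T" "x \<in> U t" using T x by auto
    then have "R x (r t)" using U[of t] T x by auto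
    moreover have "\<sigma> \<le> r t" unfolding \<sigma>_def using T t by (intro Min_le) auto
    ultimately show ?thesis using anti \<open>\<sigma> > 0\<close> by blast
  qed
  ultimately show ?thesis by (rule that)
qed

text \<open>
Uniformity is obtained in two rounds: the separation \<open>\<sigma>\<close> is fixed first, since the admissible
displacement \<open>\<sigma> / 16\<close> depends on it.
\<close>

lemma varying_configuration_uniform:
  fixes Z :: "'a::metric_space \<Rightarrow> 'b::real_normed_vector set"
  assumes vc: "varying_configuration X Z k" and S: "compact S" "S \<subseteq> X"
  obtains \<sigma> \<tau> where "0 < \<sigma>" "\<sigma> \<le> 4" "0 < \<tau>" "\<And>y. y \<in> S \<Longrightarrow> separated \<sigma> (Z y)"
    "\<And>y y'. y \<in> S \<Longrightarrow> y' \<in> S \<Longrightarrow> dist y y' < \<tau> \<Longrightarrow> close_configurations \<sigma> (Z y) (Z y')"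
proof -
  have vcS: "varying_configuration S Z k" using varying_configuration_subset[OF vc S(2)] .
  have local: "\<exists>U v. open U \<and> x \<in> U \<and> (\<forall>y\<in>S \<inter> U. bij_betw (\<lambda>p. v p y) (Z x) (Z y)) \<and>
      (\<forall>y\<in>S \<inter> U. \<forall>p\<in>Z x. dist (v p y) p < e)"
    if x: "x \<in> S" and e: "e > 0" "separated (2 * e) (Z x)" for x e
  proof -
    have e2: "\<forall>p\<in>Z x. \<forall>q\<in>Z x. p \<noteq> q \<longrightarrow> 2 * e \<le> dist p q" using e(2) by (simp add: separated_def)
    obtain U v where U: "open U" "x \<in> U"
      and bij: "\<And>y. y \<in> S \<inter> U \<Longrightarrow> bij_betw (\<lambda>p. v p y) (Z x) (Z y)"
      and "\<And>p. p \<in> Z x \<Longrightarrow> continuous_on (S \<inter> U) (v p)"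
      and near: "\<And>p y. p \<in> Z x \<Longrightarrow> y \<in> S \<inter> U \<Longrightarrow> dist (v p y) p < e"
      and "\<And>p q y. p \<in> Z x \<Longrightarrow> y \<in> S \<inter> U \<Longrightarrow> q \<in> Z y \<Longrightarrow> dist q p < e \<Longrightarrow> q = v p y"
      by (rule varying_configuration_local_sections[OF vcS x e(1) e2]) (rule that)
    show ?thesis using U bij near by (intro exI[of _ U] exI[of _ v]) auto
  qed
  have sepx: "\<exists>d>0. separated d (Z x)" if "x \<in> S" for x
    using finite_separated[OF varying_configuration_finite[OF vcS that]] by (simp add: separated_def)
  obtain \<sigma>0 where \<sigma>0: "\<sigma>0 > 0" "\<And>y. y \<in> S \<Longrightarrow> separated \<sigma>0 (Z y)"
  proof (rule compact_uniform_radius[OF S(1), of "\<lambda>y \<sigma>. separated \<sigma> (Z y)"])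
    fix x assume x: "x \<in> S"
    then obtain d where d: "d > 0" "separated d (Z x)" using sepx by blast
    have sep4: "separated (2 * (d / 4)) (Z x)" using d by (fastforce simp: separated_def)
    have "d / 4 > 0" using d by simp
    from local[OF x this sep4] obtain U v where U: "open U" "x \<in> U"
      "\<forall>y\<in>S \<inter> U. bij_betw (\<lambda>p. v p y) (Z x) (Z y)" "\<forall>y\<in>S \<inter> U. \<forall>p\<in>Z x. dist (v p y) p < d / 4"
      by (elim exE conjE)
    have "separated (d / 2) (Z y)" if y: "y \<in> S \<inter> U" for y
      unfolding separated_def
    proof (intro ballI impI)
      fix q q' assume q: "q \<in> Z y" "q' \<in> Z y" "q \<noteq> q'"
      then obtain p p' where p: "p \<in> Z x" "p' \<in> Z x" "q = v p y" "q' = v p' y"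
        using bspec[OF U(3) y] unfolding bij_betw_def by blast
      then have "d \<le> dist p p'" using d q by (auto simp: separated_def)
      moreover have "dist p p' \<le> dist p q + dist q q' + dist q' p'"
        by (meson add_right_mono dist_triangle order_trans)
      ultimately show "d / 2 \<le> dist q q'"
        using bspec[OF bspec[OF U(4) y] p(1)] bspec[OF bspec[OF U(4) y] p(2)] p by (simp add: dist_commute)
    qed
    then show "\<exists>U \<sigma>. open U \<and> x \<in> U \<and> \<sigma> > 0 \<and> (\<forall>y\<in>S \<inter> U. separated \<sigma> (Z y))"
      using U(1,2) d by (intro exI[of _ U] exI[of _ "d / 2"]) auto
  next
    show "separated \<tau> (Z x)" if "separated \<sigma> (Z x)" "0 < \<tau>" "\<tau> \<le> \<sigma>" for x \<sigma> \<tau>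
      using that by (fastforce simp: separated_def)
  qed (rule that)
  define \<sigma> where "\<sigma> = min 4 \<sigma>0"
  have \<sigma>: "0 < \<sigma>" "\<sigma> \<le> 4" "\<And>y. y \<in> S \<Longrightarrow> separated \<sigma> (Z y)"
    using \<sigma>0 by (auto simp: \<sigma>_def separated_def intro: min.coboundedI2)
  obtain \<tau> where \<tau>: "\<tau> > 0" "\<And>x. x \<in> S \<Longrightarrow>
     (\<forall>y\<in>S. \<forall>y'\<in>S. dist x y < \<tau> \<and> dist x y' < \<tau> \<longrightarrow> (\<forall>p\<in>Z y. \<exists>q\<in>Z y'. dist p q < \<sigma> / 16))"
  proof (rule compact_uniform_radius[OF S(1), of "\<lambda>x \<tau>. \<forall>y\<in>S. \<forall>y'\<in>S. dist x y < \<tau> \<and> dist x y' < \<tau> \<longrightarrow>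
      (\<forall>p\<in>Z y. \<exists>q\<in>Z y'. dist p q < \<sigma> / 16)"])
    fix x assume x: "x \<in> S"
    have sep: "separated (2 * (\<sigma> / 32)) (Z x)"
      using \<sigma>(1) \<sigma>(3)[OF x] by (fastforce simp: separated_def)
    have "\<sigma> / 32 > 0" using \<sigma>(1) by simp
    from local[OF x this sep] obtain U v where U: "open U" "x \<in> U"
      "\<forall>y\<in>S \<inter> U. bij_betw (\<lambda>p. v p y) (Z x) (Z y)" "\<forall>y\<in>S \<inter> U. \<forall>p\<in>Z x. dist (v p y) p < \<sigma> / 32"
      by (elim exE conjE)
    obtain r where r: "r > 0" "ball x r \<subseteq> U" using U openE by blast
    have "\<exists>q\<in>Z y'. dist p q < \<sigma> / 16"
      if z: "z \<in> ball x (r / 2)" and y: "y \<in> S" "y' \<in> S" "dist z y < r / 2" "dist z y' < r / 2"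
        and p: "p \<in> Z y" for z y y' p
    proof -
      have "dist x y < r" "dist x y' < r"
        using z y dist_triangle[of x y z] dist_triangle[of x y' z] by auto
      then have yU: "y \<in> S \<inter> U" "y' \<in> S \<inter> U" using r y by auto
      then obtain p0 where p0: "p0 \<in> Z x" "p = v p0 y"
        using bspec[OF U(3) yU(1)] p unfolding bij_betw_def by blast
      have "v p0 y' \<in> Z y'" using bspec[OF U(3) yU(2)] p0 unfolding bij_betw_def by blast
      moreover have "dist p (v p0 y') < \<sigma> / 16"
        using dist_triangle2[of p "v p0 y'" p0] bspec[OF bspec[OF U(4) yU(1)] p0(1)] bspec[OF bspec[OF U(4) yU(2)] p0(1)] p0 by simp
      ultimately show ?thesis by blast
    qed
    then show "\<exists>U \<tau>. open U \<and> x \<in> U \<and> \<tau> > 0 \<and> (\<forall>z\<in>S \<inter> U. \<forall>y\<in>S. \<forall>y'\<in>S.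
        dist z y < \<tau> \<and> dist z y' < \<tau> \<longrightarrow> (\<forall>p\<in>Z y. \<exists>q\<in>Z y'. dist p q < \<sigma> / 16))"
      using r by (intro exI[of _ "ball x (r / 2)"] exI[of _ "r / 2"]) auto
  next
    fix x and \<sigma>' \<tau>' :: real
    assume "\<forall>y\<in>S. \<forall>y'\<in>S. dist x y < \<sigma>' \<and> dist x y' < \<sigma>' \<longrightarrow> (\<forall>p\<in>Z y. \<exists>q\<in>Z y'. dist p q < \<sigma> / 16)"
      "\<tau>' \<le> \<sigma>'"
    then show "\<forall>y\<in>S. \<forall>y'\<in>S. dist x y < \<tau>' \<and> dist x y' < \<tau>' \<longrightarrow> (\<forall>p\<in>Z y. \<exists>q\<in>Z y'. dist p q < \<sigma> / 16)"
      by (meson less_le_trans)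
  qed (rule that)
  show ?thesis
  proof (rule that[OF \<sigma>(1,2) \<tau>(1) \<sigma>(3)])
    fix y y' assume y: "y \<in> S" "y' \<in> S" "dist y y' < \<tau>"
    show "close_configurations \<sigma> (Z y) (Z y')"
    proof
      show "\<exists>q\<in>Z y'. dist p q < \<sigma> / 16" if "p \<in> Z y" for p
        using \<tau>(2)[OF y(1)] y \<tau>(1) that by auto
    qed (use \<sigma> y vcS in \<open>auto simp: varying_configuration_finite varying_configuration_card\<close>)
  qed
qed

section \<open>Transport of configurations along rays\<close>

lemma continuous_on_push:
  fixes Z :: "'a::metric_space \<Rightarrow> 'b::real_normed_vector set" and Y :: "'c::metric_space set"
  assumes vc: "varying_configuration X Z k"
    and g: "continuous_on Y g" "g ` Y \<subseteq> X" and h: "continuous_on Y h" "h ` Y \<subseteq> X"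
  shows "continuous_on (Y \<times> UNIV) (\<lambda>(y, x). push \<sigma> (Z (g y)) (Z (h y)) x)"
proof -
  have "continuous_on (Y \<times> UNIV) (\<lambda>z. g (fst z))"
    by (rule continuous_on_compose2[OF g(1)]) (auto intro: continuous_on_fst continuous_on_id)
  then have vg: "varying_configuration (Y \<times> (UNIV :: 'b set)) (\<lambda>z. Z (g (fst z))) k"
    by (rule varying_configuration_compose[OF vc]) (use g in auto)
  have "continuous_on ((Y \<times> UNIV) \<times> UNIV) (\<lambda>z. h (fst (fst z)))"
    by (rule continuous_on_compose2[OF h(1)]) (auto intro!: continuous_on_fst continuous_on_id)
  then have vh: "varying_configuration ((Y \<times> (UNIV :: 'b set)) \<times> (UNIV :: 'b set)) (\<lambda>z. Z (h (fst (fst z)))) k"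
    by (rule varying_configuration_compose[OF vc]) (use h in auto)
  let ?f = "\<lambda>(x :: 'b) p q. (max 0 (1 - 4 * dist x p / \<sigma>) * max 0 (min 1 (2 - 4 * dist p q / \<sigma>))) *\<^sub>R (q - p)"
  have "continuous_on (((Y \<times> UNIV) \<times> UNIV) \<times> UNIV) (\<lambda>(z, q). ?f (snd (fst z)) (snd z) q)"
    unfolding case_prod_beta divide_inverse
    by (intro continuous_on_scaleR continuous_on_mult continuous_on_max continuous_on_min continuous_on_const
        continuous_on_diff continuous_on_dist continuous_on_fst continuous_on_snd continuous_on_id)
  from continuous_on_sum_varying_configuration[OF vh this]
  have "continuous_on ((Y \<times> UNIV) \<times> UNIV) (\<lambda>(z, p). \<Sum>q\<in>Z (h (fst z)). ?f (snd z) p q)"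
    by (simp add: case_prod_beta)
  from continuous_on_sum_varying_configuration[OF vg this]
  show ?thesis by (simp add: push_def case_prod_beta)
qed

text \<open>
Homeomorphisms over the identity of the punctured plane of parameters \<open>y\<close>, with fibre the plane.
Being the identity outside a fixed disc in each fibre is what will allow an extension over the axis
that corresponds to infinite slope.
\<close>

definition fibre_homeomorphism ::
    "real \<Rightarrow> (complex \<Rightarrow> complex \<Rightarrow> complex) \<Rightarrow> (complex \<Rightarrow> complex \<Rightarrow> complex) \<Rightarrow> bool"
  where "fibre_homeomorphism L \<Psi> \<Psi>' \<longleftrightarrow>
    continuous_on ((- {0}) \<times> UNIV) (\<lambda>(y, x). \<Psi> y x) \<and>
    continuous_on ((- {0}) \<times> UNIV) (\<lambda>(y, x). \<Psi>' y x) \<and>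
    (\<forall>y x. y \<noteq> 0 \<longrightarrow> \<Psi>' y (\<Psi> y x) = x \<and> \<Psi> y (\<Psi>' y x) = x \<and> (L \<le> norm x \<longrightarrow> \<Psi> y x = x))"

lemma fibre_homeomorphism_compose:
  assumes "fibre_homeomorphism L \<Psi> \<Psi>'" "fibre_homeomorphism L \<Phi> \<Phi>'"
  shows "fibre_homeomorphism L (\<lambda>y x. \<Psi> y (\<Phi> y x)) (\<lambda>y x. \<Phi>' y (\<Psi>' y x))"
proof -
  have comp: "continuous_on ((- {0}) \<times> UNIV) (\<lambda>(y, x). f y (g y x))"
    if f: "continuous_on ((- {0}) \<times> UNIV) (\<lambda>(y, x). f y x)"
      and g: "continuous_on ((- {0}) \<times> UNIV) (\<lambda>(y, x). g y x)" for f g :: "complex \<Rightarrow> complex \<Rightarrow> complex"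
  proof -
    have "continuous_on ((- {0}) \<times> UNIV) (\<lambda>z. (\<lambda>(y, x). f y x) (fst z, (\<lambda>(y, x). g y x) z))"
      by (rule continuous_on_compose2[OF f])
        (auto intro!: continuous_on_Pair[OF continuous_on_fst[OF continuous_on_id] g])
    then show ?thesis by (simp add: case_prod_beta)
  qed
  show ?thesis
    using assms comp unfolding fibre_homeomorphism_def by auto
qed

text \<open>
The point on the ray of \<open>y\<close> whose radius is the one in \<open>[a, b]\<close> closest to that of \<open>y\<close>.
\<close>

definition clamp_radius :: "real \<Rightarrow> real \<Rightarrow> complex \<Rightarrow> complex"
  where "clamp_radius a b y = of_real (max a (min b (norm y))) * sgn y"

lemma continuous_on_sgn_complex: "continuous_on (- {0}) (sgn :: complex \<Rightarrow> complex)"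
  unfolding sgn_div_norm by (intro continuous_intros) auto

lemma continuous_on_clamp_radius: "continuous_on (- {0}) (clamp_radius a b)"
  unfolding clamp_radius_def[abs_def] by (intro continuous_intros continuous_on_sgn_complex)

lemma norm_clamp_radius: "y \<noteq> 0 \<Longrightarrow> 0 \<le> a \<Longrightarrow> norm (clamp_radius a b y) = max a (min b (norm y))"
  by (simp add: clamp_radius_def norm_mult norm_sgn)

locale radial_configuration =
  fixes Z :: "complex \<Rightarrow> complex set" and \<epsilon> K :: real and k :: nat
  assumes \<epsilon>: "\<epsilon> > 0"
    and vc: "varying_configuration (cball 0 \<epsilon> - {0}) Z k"
    and bound: "\<And>y. y \<in> cball 0 \<epsilon> - {0} \<Longrightarrow> Z y \<subseteq> ball 0 K"
begin

text \<open>
A family of homeomorphisms which follows the configuration along each ray from radius \<open>b\<close> inwards to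
radius \<open>a\<close>. By clamping the radius it is defined for all \<open>y \<noteq> 0\<close>, so that transports over
adjacent intervals can be composed without any gluing.
\<close>

definition transport :: "real \<Rightarrow> real \<Rightarrow> (complex \<Rightarrow> complex \<Rightarrow> complex) \<Rightarrow> (complex \<Rightarrow> complex \<Rightarrow> complex) \<Rightarrow> bool"
  where "transport a b \<Psi> \<Psi>' \<longleftrightarrow> fibre_homeomorphism (K + 1) \<Psi> \<Psi>' \<and>
    (\<forall>y x. y \<noteq> 0 \<longrightarrow> b \<le> norm y \<longrightarrow> \<Psi> y x = x) \<and>
    (\<forall>y. y \<noteq> 0 \<longrightarrow> \<Psi> y ` Z (of_real b * sgn y) = Z (clamp_radius a b y))"

lemma transport_trans:
  assumes ab: "transport a b \<Psi> \<Psi>'" and bc: "transport b c \<Phi> \<Phi>'" and le: "a \<le> b" "b \<le> c"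
  shows "transport a c (\<lambda>y x. \<Psi> y (\<Phi> y x)) (\<lambda>y x. \<Phi>' y (\<Psi>' y x))"
  unfolding transport_def
proof (intro conjI allI impI)
  show "fibre_homeomorphism (K + 1) (\<lambda>y x. \<Psi> y (\<Phi> y x)) (\<lambda>y x. \<Phi>' y (\<Psi>' y x))"
    using ab bc by (auto simp: transport_def intro: fibre_homeomorphism_compose)
next
  fix y x assume "y \<noteq> (0::complex)" "c \<le> norm y"
  then show "\<Psi> y (\<Phi> y x) = x" using ab bc le by (simp add: transport_def)
next
  fix y :: complex assume y: "y \<noteq> 0"
  have \<Phi>: "\<Phi> y ` Z (of_real c * sgn y) = Z (clamp_radius b c y)"
    using bc y by (simp add: transport_def)
  have im: "(\<lambda>x. \<Psi> y (\<Phi> y x)) ` Z (of_real c * sgn y) = \<Psi> y ` Z (clamp_radius b c y)"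
    by (simp add: \<Phi>[symmetric] image_image)
  show "(\<lambda>x. \<Psi> y (\<Phi> y x)) ` Z (of_real c * sgn y) = Z (clamp_radius a c y)"
  proof (cases "b \<le> norm y")
    case True
    then have "\<Psi> y x = x" for x using ab y by (simp add: transport_def)
    then have "(\<lambda>x. \<Psi> y (\<Phi> y x)) ` Z (of_real c * sgn y) = Z (clamp_radius b c y)"
      unfolding im by simp
    also have "clamp_radius b c y = clamp_radius a c y"
      using True le by (simp add: clamp_radius_def max_def min_def)
    finally show ?thesis .
  next
    case False
    then have "clamp_radius b c y = of_real b * sgn y" "clamp_radius a c y = clamp_radius a b y"
      using le by (simp_all add: clamp_radius_def max_def min_def)
    then show ?thesis unfolding im using ab y by (simp add: transport_def)
  qed
qed

text \<open>
On a thin annulus the configuration on the outer circle is so close to all others on the same ray that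
one push suffices.
\<close>

lemma transport_short:
  assumes x: "0 < x" "x \<le> \<epsilon>"
  obtains d where "d > 0" "\<And>a b. 0 < a \<Longrightarrow> a \<le> x \<Longrightarrow> x \<le> b \<Longrightarrow> b \<le> \<epsilon> \<Longrightarrow> b - a < d \<Longrightarrow> \<exists>\<Psi> \<Psi>'. transport a b \<Psi> \<Psi>'"
proof -
  define S where "S = cball (0::complex) \<epsilon> - ball 0 (x / 2)"
  have S: "compact S" "S \<subseteq> cball 0 \<epsilon> - {0}"
    using x by (auto simp: S_def intro!: compact_diff)
  obtain \<sigma> \<tau> where \<sigma>: "0 < \<sigma>" "\<sigma> \<le> 4" "0 < \<tau>" "\<And>y. y \<in> S \<Longrightarrow> separated \<sigma> (Z y)"
    "\<And>y y'. y \<in> S \<Longrightarrow> y' \<in> S \<Longrightarrow> dist y y' < \<tau> \<Longrightarrow> close_configurations \<sigma> (Z y) (Z y')"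
    by (rule varying_configuration_uniform[OF vc S]) (rule that)
  show ?thesis
  proof (rule that[of "min \<tau> (x / 2)"])
    fix a b assume ab: "0 < a" "a \<le> x" "x \<le> b" "b \<le> \<epsilon>" "b - a < min \<tau> (x / 2)"
    have ax: "x / 2 < a" "b - a < \<tau>" using ab by auto
    define g where "g y = of_real b * sgn y" for y :: complex
    define h where "h = clamp_radius a b"
    have gS: "g y \<in> S" and hS: "h y \<in> S" and gh: "dist (g y) (h y) < \<tau>" if "y \<noteq> 0" for y
    proof -
      have ng: "norm (g y) = b" using that ab by (simp add: g_def norm_mult norm_sgn)
      have nh: "norm (h y) = max a (min b (norm y))" using that ab by (simp add: h_def norm_clamp_radius)
      show "g y \<in> S" using ng ab x by (auto simp: S_def)
      show "h y \<in> S" using nh ab ax by (auto simp: S_def)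
      have "g y - h y = of_real (b - max a (min b (norm y))) * sgn y"
        by (simp add: g_def h_def clamp_radius_def left_diff_distrib)
      then have "dist (g y) (h y) = \<bar>b - max a (min b (norm y))\<bar>"
        using that by (simp add: dist_norm norm_mult norm_sgn del: of_real_diff)
      then show "dist (g y) (h y) < \<tau>" using ab(2,3) ax(2) \<sigma>(3) by (auto simp: max_def min_def)
    qed
    have cc: "close_configurations \<sigma> (Z (g y)) (Z (h y))" if "y \<noteq> 0" for y
      using \<sigma>(5) gS hS gh that by blast
    define d where "d y = push \<sigma> (Z (g y)) (Z (h y))" for y
    have cg: "continuous_on (- {0}) g"
      unfolding g_def[abs_def] by (intro continuous_intros continuous_on_sgn_complex)
    have ch: "continuous_on (- {0}) h" unfolding h_def by (rule continuous_on_clamp_radius)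
    have cd: "continuous_on ((- {0}) \<times> UNIV) (\<lambda>(y, x). d y x)"
      unfolding d_def
      by (rule continuous_on_push[OF vc cg _ ch]) (use gS hS S(2) in auto)
    obtain \<Psi>' where \<Psi>': "continuous_on ((- {0}) \<times> UNIV) (\<lambda>(y, x). \<Psi>' y x)"
      "\<And>y x. y \<in> - {0} \<Longrightarrow> \<Psi>' y (x + d y x) = x" "\<And>y x. y \<in> - {0} \<Longrightarrow> \<Psi>' y x + d y (\<Psi>' y x) = x"
    proof (rule perturbed_identity_inverse[OF cd])
      show "norm (d y x - d y x') \<le> norm (x - x') / 2" if "y \<in> - {0}" for y x x'
        unfolding d_def by (rule close_configurations.push_lipschitz) (use cc that in auto)
    qed (rule that)
    have "transport a b (\<lambda>y x. x + d y x) \<Psi>'"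
      unfolding transport_def fibre_homeomorphism_def
    proof (intro conjI allI impI)
      show "continuous_on ((- {0}) \<times> UNIV) (\<lambda>(y, x). x + d y x)"
        using cd unfolding case_prod_beta by (intro continuous_intros)
      fix y x :: complex assume y: "y \<noteq> 0"
      have "Z (g y) \<subseteq> ball 0 K" by (rule bound) (use gS[OF y] S(2) in blast)
      then show "x + d y x = x" if "K + 1 \<le> norm x"
        using close_configurations.push_outside[OF cc[OF y] _ that \<sigma>(2)] by (simp add: d_def)
      show "x + d y x = x" if "b \<le> norm y"
      proof -
        have "h y = g y" using that ab by (simp add: g_def h_def clamp_radius_def max_def min_def)
        moreover have "finite (Z (g y))"
          using varying_configuration_finite[OF vc] gS[OF y] S(2) by blast
        ultimately show ?thesis using push_self[OF \<sigma>(1) _ \<sigma>(4)[OF gS[OF y]]] by (simp add: d_def)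
      qed
      show "(\<lambda>x. x + d y x) ` Z (of_real b * sgn y) = Z (clamp_radius a b y)"
        using close_configurations.push_image[OF cc[OF y]] by (simp add: d_def g_def h_def)
    qed (use \<Psi>' in auto)
    then show "\<exists>\<Psi> \<Psi>'. transport a b \<Psi> \<Psi>'" by blast
  qed (use \<sigma> x in auto)
qed

text \<open>
Transports exist locally and compose, so bisection of the interval of radii gives them on every
compact interval.
\<close>

lemma transport_exists:
  assumes "0 < a" "a \<le> b" "b \<le> \<epsilon>"
  shows "\<exists>\<Psi> \<Psi>'. transport a b \<Psi> \<Psi>'"
proof -
  have "0 < a \<and> b \<le> \<epsilon> \<longrightarrow> (\<exists>\<Psi> \<Psi>'. transport a b \<Psi> \<Psi>')"
  proof (rule Bolzano[OF assms(2), of "\<lambda>a b. 0 < a \<and> b \<le> \<epsilon> \<longrightarrow> (\<exists>\<Psi> \<Psi>'. transport a b \<Psi> \<Psi>')"])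
    fix a b c assume "0 < a \<and> b \<le> \<epsilon> \<longrightarrow> (\<exists>\<Psi> \<Psi>'. transport a b \<Psi> \<Psi>')"
      "0 < b \<and> c \<le> \<epsilon> \<longrightarrow> (\<exists>\<Psi> \<Psi>'. transport b c \<Psi> \<Psi>')" "a \<le> b" "b \<le> c"
    then show "0 < a \<and> c \<le> \<epsilon> \<longrightarrow> (\<exists>\<Psi> \<Psi>'. transport a c \<Psi> \<Psi>')"
      using transport_trans by (meson less_le_trans order_trans)
  next
    fix x assume x: "a \<le> x" "x \<le> b"
    then have x': "0 < x" "x \<le> \<epsilon>" using assms by auto
    show "\<exists>d>0. \<forall>a b. a \<le> x \<and> x \<le> b \<and> b - a < d \<longrightarrow> 0 < a \<and> b \<le> \<epsilon> \<longrightarrow> (\<exists>\<Psi> \<Psi>'. transport a b \<Psi> \<Psi>')"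
      by (rule transport_short[OF x']) blast
  qed
  then show ?thesis using assms by blast
qed

text \<open>
Infinitely many transports, over the intervals between the radii \<open>\<epsilon> / (n + 1)\<close>, are composed. At each \<open>y\<close>
only finitely many of them differ from the identity.
\<close>

theorem radial_trivialization:
  obtains \<Phi> \<Phi>' where "fibre_homeomorphism (K + 1) \<Phi> \<Phi>'"
    "\<And>y x. \<epsilon> \<le> norm y \<Longrightarrow> \<Phi> y x = x"
    "\<And>y. y \<in> cball 0 \<epsilon> - {0} \<Longrightarrow> \<Phi> y ` Z (of_real \<epsilon> * sgn y) = Z y"
proof -
  define b where "b n = \<epsilon> / real (Suc n)" for n
  have b: "0 < b n" "b (Suc n) \<le> b n" "b n \<le> \<epsilon>" for n
    using \<epsilon> by (auto simp: b_def field_simps)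
  have mono: "b n \<le> b m" if "m \<le> n" for m n
    using \<epsilon> that by (auto simp: b_def intro!: divide_left_mono)
  have "\<exists>\<Psi> \<Psi>'. transport (b (Suc n)) (b n) \<Psi> \<Psi>'" for n
    using transport_exists b by simp
  then obtain \<Psi> \<Psi>' where \<Psi>: "\<And>n. transport (b (Suc n)) (b n) (\<Psi> n) (\<Psi>' n)" by metis
  define \<Phi> where "\<Phi> = rec_nat (\<lambda>y x. x) (\<lambda>n \<phi> y x. \<Psi> n y (\<phi> y x))"
  define \<Phi>' where "\<Phi>' = rec_nat (\<lambda>y x. x) (\<lambda>n \<phi> y x. \<phi> y (\<Psi>' n y x))"
  have \<Phi>0: "\<Phi> 0 = (\<lambda>y x. x)" "\<Phi>' 0 = (\<lambda>y x. x)" by (simp_all add: \<Phi>_def \<Phi>'_def)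
  have \<Phi>Suc: "\<Phi> (Suc n) = (\<lambda>y x. \<Psi> n y (\<Phi> n y x))" "\<Phi>' (Suc n) = (\<lambda>y x. \<Phi>' n y (\<Psi>' n y x))" for n
    by (simp_all add: \<Phi>_def \<Phi>'_def)
  have id: "transport \<epsilon> \<epsilon> (\<lambda>y x. x) (\<lambda>y x. x)"
    by (auto simp: transport_def fibre_homeomorphism_def clamp_radius_def case_prod_beta
        intro!: continuous_on_snd continuous_on_id)
  have tr: "transport (b n) \<epsilon> (\<Phi> n) (\<Phi>' n)" for n
  proof (induction n)
    case 0
    then show ?case using id by (simp add: \<Phi>0 b_def)
  next
    case (Suc n)
    show ?case unfolding \<Phi>Suc by (rule transport_trans[OF \<Psi> Suc]) (use b in auto)
  qed
  have stable: "\<Phi> (n + j) y = \<Phi> n y" "\<Phi>' (n + j) y = \<Phi>' n y" if "y \<noteq> 0" "b n \<le> norm y" for n j y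
  proof (induction j)
    case (Suc j)
    have "b (n + j) \<le> norm y" using mono[of n "n + j"] that by simp
    then have id1: "\<Psi> (n + j) y x = x" for x using \<Psi>[of "n + j"] that by (simp add: transport_def)
    then have id2: "\<Psi>' (n + j) y x = x" for x
      using \<Psi>[of "n + j"] that unfolding transport_def fibre_homeomorphism_def by metis
    { case 1 then show ?case using Suc id1 by (simp add: \<Phi>Suc) }
    { case 2 then show ?case using Suc id2 by (simp add: \<Phi>Suc) }
  qed simp_all
  define N where "N y = nat \<lceil>\<epsilon> / norm y\<rceil>" for y :: complex
  have N: "b (N y) \<le> norm y" if "y \<noteq> 0" for y
  proof -
    have "\<epsilon> / norm y \<le> real (Suc (N y))" unfolding N_def by linarith
    then show ?thesis using that by (simp add: b_def field_simps)
  qed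
  define \<Theta> where "\<Theta> y = \<Phi> (N y) y" for y
  define \<Theta>' where "\<Theta>' y = \<Phi>' (N y) y" for y
  have eq: "\<Theta> y = \<Phi> n y" "\<Theta>' y = \<Phi>' n y" if "y \<noteq> 0" "b n \<le> norm y" for n y
    using stable[OF that, of "N y"] stable[OF that(1) N[OF that(1)], of n]
    by (simp_all add: \<Theta>_def \<Theta>'_def add.commute)
  have fh: "fibre_homeomorphism (K + 1) (\<Phi> n) (\<Phi>' n)" for n using tr by (simp add: transport_def)
  have cont: "continuous_on ((- {0}) \<times> UNIV) (\<lambda>(y, x). \<theta> y x)"
    if c: "\<And>n. continuous_on ((- {0}) \<times> UNIV) (\<lambda>(y, x). \<phi> n y x)"
      and e: "\<And>n y. y \<noteq> 0 \<Longrightarrow> b n \<le> norm y \<Longrightarrow> \<theta> y = \<phi> n y"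
    for \<theta> :: "complex \<Rightarrow> complex \<Rightarrow> complex" and \<phi>
  proof (rule continuous_on_locally)
    fix z :: "complex \<times> complex" assume "z \<in> (- {0}) \<times> UNIV"
    then obtain y x where z: "z = (y, x)" "y \<noteq> 0" by auto
    \<comment> \<open>halving makes the inequality \<open>b n < norm y\<close> strict, so that it defines a neighbourhood of \<open>y\<close>\<close>
    define n where "n = N (y / 2)"
    have bn: "b n < norm y" using N[of "y / 2"] z b(1)[of n] unfolding n_def by (simp add: norm_divide)
    let ?U = "{w. b n < norm (w :: complex)} \<times> (UNIV :: complex set)"
    have "open {w. b n < norm (w :: complex)}" by (intro open_Collect_less continuous_intros)
    then have "open ?U" by (intro open_Times) auto
    moreover have "continuous_on (((- {0}) \<times> UNIV) \<inter> ?U) (\<lambda>(y, x). \<theta> y x)"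
      using continuous_on_subset[OF c[of n], of "((- {0}) \<times> UNIV) \<inter> ?U"]
    proof (rule continuous_on_eq)
      fix q assume "q \<in> ((- {0}) \<times> UNIV) \<inter> ?U"
      then have "\<theta> (fst q) = \<phi> n (fst q)" by (intro e) auto
      then show "(\<lambda>(y, x). \<phi> n y x) q = (\<lambda>(y, x). \<theta> y x) q" by (simp add: case_prod_beta)
    qed auto
    ultimately show "\<exists>U. open U \<and> z \<in> U \<and> continuous_on (((- {0}) \<times> UNIV) \<inter> U) (\<lambda>(y, x). \<theta> y x)"
      using bn z by (intro exI[of _ ?U]) auto
  qed
  show ?thesis
  proof (rule that[of \<Theta> \<Theta>'])
    have "continuous_on ((- {0}) \<times> UNIV) (\<lambda>(y, x). \<Theta> y x)"
      by (rule cont[of \<Phi>]) (use fh eq in \<open>auto simp: fibre_homeomorphism_def\<close>)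
    moreover have "continuous_on ((- {0}) \<times> UNIV) (\<lambda>(y, x). \<Theta>' y x)"
      by (rule cont[of \<Phi>']) (use fh eq in \<open>auto simp: fibre_homeomorphism_def\<close>)
    ultimately show "fibre_homeomorphism (K + 1) \<Theta> \<Theta>'"
      using fh unfolding fibre_homeomorphism_def \<Theta>_def \<Theta>'_def by blast
    show "\<Theta> y x = x" if "\<epsilon> \<le> norm y" for y x
    proof -
      have "\<Theta> y = \<Phi> 0 y" by (rule eq) (use that \<epsilon> in \<open>auto simp: b_def\<close>)
      then show ?thesis by (simp add: \<Phi>0)
    qed
    show "\<Theta> y ` Z (of_real \<epsilon> * sgn y) = Z y" if y: "y \<in> cball 0 \<epsilon> - {0}" for y
    proof -
      have "\<Theta> y ` Z (of_real \<epsilon> * sgn y) = Z (clamp_radius (b (N y)) \<epsilon> y)"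
        using tr[of "N y"] y by (simp add: \<Theta>_def transport_def)
      also have "clamp_radius (b (N y)) \<epsilon> y = y"
      proof -
        have "max (b (N y)) (min \<epsilon> (norm y)) = norm y" using y N[of y] by auto
        then show ?thesis using y by (simp add: clamp_radius_def sgn_eq)
      qed
      finally show ?thesis .
    qed
  qed
qed

end

section \<open>From configurations in the fibres to a conic structure\<close>

text \<open>
The point \<open>(z, z u)\<close> of slope \<open>u\<close> with norm \<open>\<bar>y\<bar>\<close> for which \<open>z\<close> is a positive multiple of \<open>y\<close>. In these
coordinates the scaling by positive reals acts on \<open>y\<close> only, and spheres are given by \<open>\<bar>y\<bar>\<close>.
\<close>

definition chart :: "complex \<Rightarrow> complex \<Rightarrow> complex \<times> complex"
  where "chart y u = (y / of_real (sqrt (1 + (norm u)\<^sup>2)), y / of_real (sqrt (1 + (norm u)\<^sup>2)) * u)"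

definition slope :: "complex \<times> complex \<Rightarrow> complex"
  where "slope p = snd p / fst p"

definition radial :: "complex \<times> complex \<Rightarrow> complex"
  where "radial p = sgn (fst p) * of_real (norm p)"

lemma sqrt_1_plus_norm2_gt_0: "sqrt (1 + (norm u)\<^sup>2) > 0" "sqrt (1 + (norm u)\<^sup>2) \<noteq> 0"
proof -
  have "1 + (norm u)\<^sup>2 > 0" by (rule add_pos_nonneg) auto
  then show "sqrt (1 + (norm u)\<^sup>2) > 0" "sqrt (1 + (norm u)\<^sup>2) \<noteq> 0" by auto
qed

lemma norm_chart [simp]: "norm (chart y u) = norm y"
proof -
  have eq: "sqrt (a\<^sup>2 + (a * b)\<^sup>2) = a * sqrt (1 + b\<^sup>2)" if "a \<ge> 0" for a b :: real
    using that real_sqrt_mult[of "a\<^sup>2" "1 + b\<^sup>2"] by (simp add: power_mult_distrib distrib_left)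
  let ?s = "sqrt (1 + (norm u)\<^sup>2)"
  have "norm (chart y u) = norm y / ?s * ?s"
    using eq[of "norm y / ?s" "norm u"] sqrt_1_plus_norm2_gt_0(1)[of u]
    by (simp add: chart_def norm_Pair norm_divide norm_mult)
  also have "\<dots> = norm y"
    by (rule nonzero_eq_divide_eq[THEN iffD1]) (use sqrt_1_plus_norm2_gt_0(1)[of u] in linarith, rule refl)
  finally show ?thesis .
qed

lemma chart_scaleR: "chart (of_real c * y) u = c *\<^sub>R chart y u"
  by (simp add: chart_def scaleR_conv_of_real)

lemma fst_chart_nonzero: "y \<noteq> 0 \<Longrightarrow> fst (chart y u) \<noteq> 0"
  using sqrt_1_plus_norm2_gt_0(1)[of u] by (auto simp: chart_def simp del: real_sqrt_gt_0_iff)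

lemma slope_chart: "y \<noteq> 0 \<Longrightarrow> slope (chart y u) = u"
  using fst_chart_nonzero[of y u] by (simp add: slope_def chart_def)

lemma radial_chart: "y \<noteq> 0 \<Longrightarrow> radial (chart y u) = y"
proof -
  assume y: "y \<noteq> 0"
  have s: "sgn (y / of_real s) = sgn y" if "s > 0" for s :: real
    using that by (simp add: sgn_divide sgn_of_real)
  have "sgn (fst (chart y u)) = sgn y"
    unfolding chart_def fst_conv by (rule s[OF sqrt_1_plus_norm2_gt_0(1)])
  then show ?thesis using y by (simp add: radial_def sgn_eq)
qed

lemma chart_radial_slope:
  assumes "fst p \<noteq> 0"
  shows "chart (radial p) (slope p) = p" "radial p \<noteq> 0"
proof -
  obtain z w where p: "p = (z, w)" "z \<noteq> 0" using assms by (cases p) auto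
  let ?s = "sqrt (1 + (norm (w / z))\<^sup>2)"
  have "norm p = norm z * ?s"
  proof -
    have "(norm z)\<^sup>2 + (norm w)\<^sup>2 = (norm z)\<^sup>2 * (1 + (norm (w / z))\<^sup>2)"
      using p(2) by (simp add: norm_divide power_divide distrib_left)
    then show ?thesis unfolding p(1) norm_Pair by (simp only: real_sqrt_mult) simp
  qed
  then have r: "radial p = z * of_real ?s"
    using p(2) by (simp add: radial_def p(1) sgn_eq)
  have s0: "of_real ?s \<noteq> (0 :: complex)" using sqrt_1_plus_norm2_gt_0(1)[of "w / z"] by (metis less_irrefl of_real_eq_0_iff)
  show "radial p \<noteq> 0" unfolding r using s0 p(2) by (rule no_zero_divisors[rotated])
  have "radial p / of_real ?s = z" unfolding r by (rule nonzero_mult_div_cancel_right[OF s0])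
  then show "chart (radial p) (slope p) = p"
    using p(2) by (simp add: chart_def slope_def p(1))
qed

text \<open>
The map of the plane \<open>\<complex>\<^sup>2\<close> induced by a family of maps of slopes, extended by the identity to the axis
of infinite slope.
\<close>

definition spread :: "(complex \<Rightarrow> complex \<Rightarrow> complex) \<Rightarrow> complex \<times> complex \<Rightarrow> complex \<times> complex"
  where "spread \<Psi> p = (if fst p = 0 then p else chart (radial p) (\<Psi> (radial p) (slope p)))"

lemma fibre_homeomorphism_sym:
  "fibre_homeomorphism L \<Psi> \<Psi>' \<Longrightarrow> fibre_homeomorphism L \<Psi>' \<Psi>"
  unfolding fibre_homeomorphism_def by metis

lemma norm_spread [simp]: "norm (spread \<Psi> p) = norm p"
proof (cases "fst p = 0")
  case False
  then have "norm (spread \<Psi> p) = norm (radial p)" by (simp add: spread_def)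
  also have "\<dots> = norm p" using chart_radial_slope(1)[OF False] by (metis norm_chart)
  finally show ?thesis .
qed (simp add: spread_def)

lemma spread_chart: "y \<noteq> 0 \<Longrightarrow> spread \<Psi> (chart y u) = chart y (\<Psi> y u)"
  by (simp add: spread_def fst_chart_nonzero radial_chart slope_chart)

lemma spread_inverse:
  assumes "fibre_homeomorphism L \<Psi> \<Psi>'"
  shows "spread \<Psi>' (spread \<Psi> p) = p"
proof (cases "fst p = 0")
  case False
  note c = chart_radial_slope[OF False]
  have "spread \<Psi> p = chart (radial p) (\<Psi> (radial p) (slope p))" using False by (simp add: spread_def)
  then have "spread \<Psi>' (spread \<Psi> p) = chart (radial p) (\<Psi>' (radial p) (\<Psi> (radial p) (slope p)))"
    using c(2) by (simp add: spread_chart)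
  also have "\<dots> = p" using assms c by (simp add: fibre_homeomorphism_def)
  finally show ?thesis .
qed (simp add: spread_def)

text \<open>
At points of the axis other than the origin the map is locally the identity, because large slopes are
fixed. At the origin it is continuous because it preserves the norm.
\<close>

lemma continuous_on_spread:
  assumes fh: "fibre_homeomorphism L \<Psi> \<Psi>'"
  shows "continuous_on UNIV (spread \<Psi>)"
proof -
  have nz: "of_real (sqrt (1 + (norm u)\<^sup>2)) \<noteq> (0 :: complex)" for u :: complex
    using sqrt_1_plus_norm2_gt_0(1)[of u] by (metis less_irrefl of_real_eq_0_iff)
  have chart: "continuous_on S (\<lambda>q. chart (f q) (g q))"
    if "continuous_on S f" "continuous_on S g" for S :: "(complex \<times> complex) set" and f g
    unfolding chart_def using that by (intro continuous_intros ballI nz)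
  have "isCont (spread \<Psi>) p" for p
  proof -
    consider "p = 0" | "fst p = 0" "snd p \<noteq> 0" | "fst p \<noteq> 0" by (cases p) (auto simp: zero_prod_def)
    then show ?thesis
    proof cases
      case 1
      have "((\<lambda>x. norm (spread \<Psi> x)) \<longlongrightarrow> 0) (at 0)"
        using tendsto_norm_zero[OF tendsto_ident_at[of "0 :: complex \<times> complex" UNIV]] by simp
      then have "(spread \<Psi> \<longlongrightarrow> 0) (at 0)" by (rule tendsto_norm_zero_cancel)
      moreover have "spread \<Psi> 0 = 0" by (simp add: spread_def)
      ultimately show ?thesis using 1 by (simp add: continuous_at)
    next
      case 2
      let ?U = "{q :: complex \<times> complex. L * norm (fst q) < norm (snd q)}"
      have U: "open ?U" by (intro open_Collect_less continuous_intros)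
      have "spread \<Psi> q = q" if "q \<in> ?U" for q
      proof (cases "fst q = 0")
        case False
        then have "L \<le> norm (slope q)" using that by (simp add: slope_def norm_divide field_simps)
        then have "\<Psi> (radial q) (slope q) = slope q"
          using fh chart_radial_slope(2)[OF False] by (simp add: fibre_homeomorphism_def)
        then show ?thesis using False chart_radial_slope(1)[OF False] by (simp add: spread_def)
      qed (simp add: spread_def)
      then have "continuous_on ?U (spread \<Psi>)" by (intro continuous_on_eq[OF continuous_on_id]) auto
      moreover have "p \<in> ?U" using 2 by simp
      ultimately show ?thesis using U continuous_on_eq_continuous_at by blast
    next
      case 3
      let ?U = "{q :: complex \<times> complex. fst q \<noteq> 0}"
      have U: "open ?U" by (intro open_Collect_neq continuous_intros)
      have rad: "continuous_on ?U radial"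
        unfolding radial_def[abs_def] by (intro continuous_intros) auto
      have slo: "continuous_on ?U slope"
        unfolding slope_def[abs_def] by (intro continuous_intros) auto
      have "continuous_on ?U (\<lambda>q. (\<lambda>(y, x). \<Psi> y x) (radial q, slope q))"
      proof (rule continuous_on_compose2[of "(- {0}) \<times> UNIV"])
        show "continuous_on ((- {0}) \<times> UNIV) (\<lambda>(y, x). \<Psi> y x)"
          using fh by (simp add: fibre_homeomorphism_def)
        show "continuous_on ?U (\<lambda>q. (radial q, slope q))" by (rule continuous_on_Pair[OF rad slo])
      qed (use chart_radial_slope(2) in auto)
      then have "continuous_on ?U (\<lambda>q. chart (radial q) (\<Psi> (radial q) (slope q)))"
        by (intro chart rad) simp
      then have "continuous_on ?U (spread \<Psi>)" by (rule continuous_on_eq) (simp add: spread_def)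
      then show ?thesis using U 3 continuous_on_eq_continuous_at by blast
    qed
  qed
  then show ?thesis by (simp add: continuous_at_imp_continuous_on)
qed

context radial_configuration
begin

text \<open>
The cone over the link consists of the points whose slope lies in the configuration over the
outermost point of the ray, and the trivialization carries this configuration to the one over \<open>y\<close>.
\<close>

theorem conic_structure:
  fixes C :: "(complex \<times> complex) set"
  assumes "0 \<in> C"
    and axis: "\<And>w. w \<noteq> 0 \<Longrightarrow> norm w \<le> \<epsilon> \<Longrightarrow> (0, w) \<notin> C"
    and C: "\<And>y u. y \<in> cball 0 \<epsilon> - {0} \<Longrightarrow> chart y u \<in> C \<longleftrightarrow> u \<in> Z y"
  obtains H H' where "homeomorphism (cball 0 \<epsilon>) (cball 0 \<epsilon>) H H'"
    "\<And>x. x \<in> sphere 0 \<epsilon> \<Longrightarrow> H x = x" "H ` link_cone \<epsilon> C = C \<inter> cball 0 \<epsilon>"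
proof -
  obtain \<Phi> \<Phi>' where fh: "fibre_homeomorphism (K + 1) \<Phi> \<Phi>'"
    and id: "\<And>y x. \<epsilon> \<le> norm y \<Longrightarrow> \<Phi> y x = x"
    and im: "\<And>y. y \<in> cball 0 \<epsilon> - {0} \<Longrightarrow> \<Phi> y ` Z (of_real \<epsilon> * sgn y) = Z y"
    by (rule radial_trivialization) (rule that)
  let ?H = "spread \<Phi>" and ?H' = "spread \<Phi>'"
  note inv = spread_inverse[OF fh] spread_inverse[OF fibre_homeomorphism_sym[OF fh]]
  have hom: "homeomorphism (cball 0 \<epsilon>) (cball 0 \<epsilon>) ?H ?H'"
  proof (rule homeomorphismI)
    show "continuous_on (cball 0 \<epsilon>) ?H" "continuous_on (cball 0 \<epsilon>) ?H'"
      using continuous_on_spread[OF fh] continuous_on_spread[OF fibre_homeomorphism_sym[OF fh]]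
      by (auto intro: continuous_on_subset)
  qed (auto simp: inv)
  have key: "?H x \<in> C \<longleftrightarrow> x \<in> link_cone \<epsilon> C" if x: "x \<in> cball 0 \<epsilon>" for x
  proof (cases "fst x = 0")
    case True
    obtain w where w: "x = (0, w)" using True by (cases x) auto
    have nw: "norm x = norm w" by (simp add: w norm_Pair)
    have Hx: "?H x = x" by (simp add: spread_def True)
    have nw': "norm w \<le> \<epsilon>" using x nw by simp
    show ?thesis
    proof (cases "w = 0")
      case True
      then have "x = 0" by (simp add: w zero_prod_def)
      then show ?thesis using Hx assms(1) \<epsilon> by (simp add: link_cone_def)
    next
      case False
      then have "x \<notin> C" "(\<epsilon> / norm x) *\<^sub>R x \<notin> C" "x \<noteq> 0"
        using axis[of w] axis[of "(\<epsilon> / norm x) *\<^sub>R w"] nw nw' \<epsilon> by (auto simp: w zero_prod_def)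
      then show ?thesis by (simp add: Hx link_cone_def)
    qed
  next
    case False
    define y u where "y = radial x" and "u = slope x"
    have xy: "x = chart y u" and y0: "y \<noteq> 0" using chart_radial_slope[OF False] by (auto simp: y_def u_def)
    have ny: "norm y = norm x" by (simp add: xy)
    have y: "y \<in> cball 0 \<epsilon> - {0}" using x y0 ny by simp
    have y': "of_real \<epsilon> * sgn y \<in> cball 0 \<epsilon> - {0}" using y0 \<epsilon> by (simp add: norm_mult norm_sgn sgn_zero_iff)
    have inj: "\<Phi> y a = \<Phi> y b \<Longrightarrow> a = b" for a b
      using fh y0 unfolding fibre_homeomorphism_def by metis
    have sc: "(\<epsilon> / norm x) *\<^sub>R x = chart (of_real \<epsilon> * sgn y) u"
    proof -
      have "of_real \<epsilon> * sgn y = of_real (\<epsilon> / norm x) * y" by (simp add: sgn_eq ny)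
      then show ?thesis using chart_scaleR xy by metis
    qed
    have "?H x \<in> C \<longleftrightarrow> chart y (\<Phi> y u) \<in> C" using xy y0 by (simp add: spread_chart)
    also have "\<dots> \<longleftrightarrow> \<Phi> y u \<in> \<Phi> y ` Z (of_real \<epsilon> * sgn y)" using C[OF y] im[OF y] by simp
    also have "\<dots> \<longleftrightarrow> u \<in> Z (of_real \<epsilon> * sgn y)" using inj by blast
    also have "\<dots> \<longleftrightarrow> (\<epsilon> / norm x) *\<^sub>R x \<in> C" using C[OF y'] sc by simp
    also have "\<dots> \<longleftrightarrow> x \<in> link_cone \<epsilon> C" using x False by (auto simp: link_cone_def)
    finally show ?thesis .
  qed
  show ?thesis
  proof (rule that[OF hom])
    show "?H x = x" if "x \<in> sphere 0 \<epsilon>" for x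
    proof (cases "fst x = 0")
      case False
      have "norm (radial x) = norm x" using chart_radial_slope(1)[OF False] by (metis norm_chart)
      then show ?thesis using that False id chart_radial_slope(1)[OF False] by (simp add: spread_def)
    qed (simp add: spread_def)
    show "?H ` link_cone \<epsilon> C = C \<inter> cball 0 \<epsilon>"
    proof
      show "?H ` link_cone \<epsilon> C \<subseteq> C \<inter> cball 0 \<epsilon>"
      proof
        fix p assume "p \<in> ?H ` link_cone \<epsilon> C"
        then obtain x where x: "x \<in> link_cone \<epsilon> C" "p = ?H x" by blast
        then have "x \<in> cball 0 \<epsilon>" by (simp add: link_cone_def)
        then show "p \<in> C \<inter> cball 0 \<epsilon>" using key[of x] x by simp
      qed
      show "C \<inter> cball 0 \<epsilon> \<subseteq> ?H ` link_cone \<epsilon> C"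
      proof
        fix p assume p: "p \<in> C \<inter> cball 0 \<epsilon>"
        have "?H' p \<in> link_cone \<epsilon> C" using key[of "?H' p"] p by (simp add: inv)
        then show "p \<in> ?H ` link_cone \<epsilon> C" by (rule rev_image_eqI) (simp add: inv)
      qed
    qed
  qed
qed

end

section \<open>Circle integrals depending on a parameter\<close>

lemma circle_integral_continuous:
  fixes F :: "'a::topological_space \<Rightarrow> complex \<Rightarrow> complex"
  assumes "continuous_on (A \<times> sphere c r) (\<lambda>(z, u). F z u)" "0 \<le> r"
  shows "continuous_on A (\<lambda>z. contour_integral (circlepath c r) (F z))"
proof -
  have "continuous_on (A \<times> cbox 0 1) (\<lambda>(z, x::real). F z (circlepath c r x))"
  proof -
    have "continuous_on (A \<times> cbox 0 1) (\<lambda>p::'a \<times> real. (\<lambda>(z, u). F z u) (fst p, circlepath c r (snd p)))"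
    proof (rule continuous_on_compose2[OF assms(1)])
      show "continuous_on (A \<times> cbox 0 1) (\<lambda>p::'a \<times> real. (fst p, circlepath c r (snd p)))"
        unfolding circlepath by (intro continuous_intros)
      have "circlepath c r x \<in> sphere c r" if "x \<in> {0..1}" for x
        using that path_image_circlepath_nonneg[OF assms(2), of c] by (auto simp: path_image_def)
      then show "(\<lambda>p::'a \<times> real. (fst p, circlepath c r (snd p))) ` (A \<times> cbox 0 1) \<subseteq> A \<times> sphere c r"
        by auto
    qed
    then show ?thesis by (simp add: case_prod_beta)
  qed
  then have "continuous_on (A \<times> cbox 0 1) (\<lambda>(z, x::real). F z (circlepath c r x) *
        vector_derivative (circlepath c r) (at x))"
    unfolding vector_derivative_circlepath case_prod_beta
    by (intro continuous_intros) (auto simp: case_prod_beta)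
  from integral_continuous_on_param[OF this] show ?thesis
    unfolding contour_integral_integral by simp
qed

text \<open>
Cauchy's integral formula expresses the derivative by the values on a circle, and these depend
continuously on the parameter.
\<close>

lemma deriv_continuous_on_Times:
  fixes F :: "'a::topological_space \<Rightarrow> complex \<Rightarrow> complex"
  assumes cont: "continuous_on (A \<times> B) (\<lambda>(z, u). F z u)" and B: "open B"
    and hol: "\<And>z. z \<in> A \<Longrightarrow> F z holomorphic_on B"
  shows "continuous_on (A \<times> B) (\<lambda>(z, u). deriv (F z) u)"
proof (rule continuous_on_locally)
  fix p assume "p \<in> A \<times> B"
  then obtain z0 u0 where p: "p = (z0, u0)" "z0 \<in> A" "u0 \<in> B" by auto
  then obtain r where r: "r > 0" "cball u0 r \<subseteq> B" using B open_contains_cball by metis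
  have eq: "deriv (F z) u = contour_integral (circlepath u0 r) (\<lambda>w. F z w / (w - u)^2) / (2 * pi * \<i>)"
    if "z \<in> A" "u \<in> ball u0 r" for z u
  proof -
    have "F z holomorphic_on cball u0 r" using hol[OF that(1)] r(2) holomorphic_on_subset by blast
    then have "(F z has_field_derivative (1 / (2 * of_real pi * \<i>) *
        contour_integral (circlepath u0 r) (\<lambda>w. F z w / (w - u)^2))) (at u)"
      using Cauchy_derivative_integral_circlepath(2)[of u0 r "F z" u] that(2)
      by (simp add: holomorphic_on_imp_continuous_on holomorphic_on_subset)
    then show ?thesis by (simp add: DERIV_imp_deriv)
  qed
  have "continuous_on ((A \<times> ball u0 r) \<times> sphere u0 r) (\<lambda>(q, w). F (fst q) w / (w - snd q)^2)"
    unfolding case_prod_beta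
  proof (intro continuous_intros)
    have "continuous_on ((A \<times> ball u0 r) \<times> sphere u0 r) (\<lambda>x. (\<lambda>(z, u). F z u) (fst (fst x), snd x))"
      by (rule continuous_on_compose2[OF cont]) (use r in \<open>auto intro!: continuous_intros\<close>)
    then show "continuous_on ((A \<times> ball u0 r) \<times> sphere u0 r) (\<lambda>x. F (fst (fst x)) (snd x))"
      by simp
  qed auto
  from circle_integral_continuous[OF this]
  have "continuous_on (A \<times> ball u0 r)
      (\<lambda>q. contour_integral (circlepath u0 r) (\<lambda>w. F (fst q) w / (w - snd q)^2) / (2 * pi * \<i>))"
    using r by (intro continuous_intros) auto
  then have "continuous_on (A \<times> ball u0 r) (\<lambda>(z, u). deriv (F z) u)"
    by (rule continuous_on_eq) (auto simp: eq)
  moreover have "A \<times> B \<inter> (UNIV \<times> ball u0 r) = A \<times> ball u0 r" using r ball_subset_cball by blast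
  ultimately show "\<exists>U. open U \<and> p \<in> U \<and> continuous_on (A \<times> B \<inter> U) (\<lambda>(z, u). deriv (F z) u)"
    using p r by (intro exI[of _ "UNIV \<times> ball u0 r"]) (auto intro: open_Times)
qed

text \<open>
Differentiation under the integral sign: the derivative of the integrand is jointly continuous by
Cauchy's integral formula.
\<close>

lemma circle_integral_holomorphic:
  fixes F :: "complex \<Rightarrow> complex \<Rightarrow> complex"
  assumes cont: "continuous_on (A \<times> sphere c r) (\<lambda>(z, u). F z u)" and A: "open A" and r: "0 \<le> r"
    and hol: "\<And>u. u \<in> sphere c r \<Longrightarrow> (\<lambda>z. F z u) holomorphic_on A"
  shows "(\<lambda>z. contour_integral (circlepath c r) (F z)) holomorphic_on A"
proof -
  have cp: "circlepath c r x \<in> sphere c r" if "x \<in> {0..1}" for x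
    using that path_image_circlepath_nonneg[OF r, of c] by (auto simp: path_image_def)
  have swap: "continuous_on (sphere c r \<times> A) (\<lambda>(u, z). F z u)"
  proof -
    have "continuous_on (sphere c r \<times> A) (\<lambda>p. (\<lambda>(z, u). F z u) (snd p, fst p))"
      by (rule continuous_on_compose2[OF cont]) (auto intro!: continuous_intros)
    then show ?thesis by (simp add: case_prod_beta)
  qed
  have dc: "continuous_on (sphere c r \<times> A) (\<lambda>(u, z). deriv (\<lambda>z. F z u) z)"
    by (rule deriv_continuous_on_Times[OF swap A hol])
  have "(\<lambda>z. contour_integral (circlepath c r) (F z)) holomorphic_on ball z0 e"
    if e: "ball z0 e \<subseteq> A" for z0 e
  proof -
    let ?v = "\<lambda>x::real. vector_derivative (circlepath c r) (at x)"
    have "(\<lambda>z. integral (cbox 0 1) (\<lambda>x. F z (circlepath c r x) * ?v x)) holomorphic_on ball z0 e"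
    proof (rule leibniz_rule_holomorphic)
      fix z and x :: real assume zx: "z \<in> ball z0 e" "x \<in> cbox 0 1"
      then have "((\<lambda>z. F z (circlepath c r x)) has_field_derivative
          deriv (\<lambda>z. F z (circlepath c r x)) z) (at z)"
        using holomorphic_derivI[OF hol A] cp e by auto
      then show "((\<lambda>z. F z (circlepath c r x) * ?v x) has_field_derivative
          deriv (\<lambda>z. F z (circlepath c r x)) z * ?v x) (at z within ball z0 e)"
        by (intro DERIV_cmult_right) (rule has_field_derivative_at_within)
    next
      fix z assume z: "z \<in> ball z0 e"
      have "continuous_on (cbox 0 1) (\<lambda>x. (\<lambda>(z, u). F z u) (z, circlepath c r x))"
        by (rule continuous_on_compose2[OF cont])
          (use z e cp in \<open>auto simp: circlepath intro!: continuous_intros\<close>)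
      then show "(\<lambda>x. F z (circlepath c r x) * ?v x) integrable_on cbox 0 1"
        unfolding vector_derivative_circlepath
        by (intro integrable_continuous continuous_intros) auto
    next
      have "continuous_on (ball z0 e \<times> cbox 0 1)
          (\<lambda>p. (\<lambda>(u, z). deriv (\<lambda>z. F z u) z) (circlepath c r (snd p), fst p))"
        by (rule continuous_on_compose2[OF dc])
          (use e cp in \<open>auto simp: circlepath intro!: continuous_intros\<close>)
      then show "continuous_on (ball z0 e \<times> cbox 0 1)
          (\<lambda>(z, x). deriv (\<lambda>z. F z (circlepath c r x)) z * ?v x)"
        unfolding vector_derivative_circlepath case_prod_beta
        by (intro continuous_intros) auto
    qed auto
    then show ?thesis unfolding contour_integral_integral by simp
  qed
  then show ?thesis
    using A by (subst holomorphic_on_open) (auto elim!: openE simp: holomorphic_on_open)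
qed

lemma deriv_holomorphic_param:
  fixes F :: "complex \<Rightarrow> complex \<Rightarrow> complex"
  assumes cont: "continuous_on (A \<times> B) (\<lambda>(z, u). F z u)" and A: "open A" and B: "open B"
    and hol1: "\<And>u. u \<in> B \<Longrightarrow> (\<lambda>z. F z u) holomorphic_on A"
    and hol2: "\<And>z. z \<in> A \<Longrightarrow> F z holomorphic_on B"
    and u: "u \<in> B"
  shows "(\<lambda>z. deriv (F z) u) holomorphic_on A"
proof -
  obtain r where r: "r > 0" "cball u r \<subseteq> B" using B u open_contains_cball by metis
  have sub: "sphere u r \<subseteq> B" using r sphere_cball by blast
  have "(\<lambda>z. contour_integral (circlepath u r) (\<lambda>w. F z w / (w - u)^2)) holomorphic_on A"
  proof (rule circle_integral_holomorphic[OF _ A])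
    show "continuous_on (A \<times> sphere u r) (\<lambda>(z, w). F z w / (w - u)^2)"
      using continuous_on_subset[OF cont, of "A \<times> sphere u r"] sub r
      unfolding case_prod_beta by (intro continuous_intros) auto
  qed (use r sub in \<open>auto intro!: holomorphic_intros hol1\<close>)
  then have "(\<lambda>z. contour_integral (circlepath u r) (\<lambda>w. F z w / (w - u)^2) / (2 * pi * \<i>)) holomorphic_on A"
    by (intro holomorphic_intros) auto
  then show ?thesis
  proof (rule holomorphic_transform)
    fix z assume z: "z \<in> A"
    have "F z holomorphic_on cball u r" using hol2[OF z] r(2) holomorphic_on_subset by blast
    then have "(F z has_field_derivative (1 / (2 * of_real pi * \<i>) *
        contour_integral (circlepath u r) (\<lambda>w. F z w / (w - u)^2))) (at u)"
      using Cauchy_derivative_integral_circlepath(2)[of u r "F z" u] r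
      by (simp add: holomorphic_on_imp_continuous_on holomorphic_on_subset)
    then show "contour_integral (circlepath u r) (\<lambda>w. F z w / (w - u)^2) / (2 * pi * \<i>) = deriv (F z) u"
      by (simp add: DERIV_imp_deriv)
  qed
qed

text \<open>
Joint continuity extends over the exceptional value \<open>a\<close>, since the values near \<open>a\<close> are given by a
Cauchy integral over a circle that avoids \<open>a\<close>.
\<close>

lemma removable_continuous_on_Times:
  fixes G :: "complex \<Rightarrow> 'a::topological_space \<Rightarrow> complex"
  assumes cont: "continuous_on ((B - {a}) \<times> T) (\<lambda>(t, v). G t v)" and B: "open B"
    and hol: "\<And>v. v \<in> T \<Longrightarrow> (\<lambda>t. G t v) holomorphic_on B"
  shows "continuous_on (B \<times> T) (\<lambda>(t, v). G t v)"
proof (rule continuous_on_locally)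
  fix p assume "p \<in> B \<times> T"
  then obtain t v where p: "p = (t, v)" "t \<in> B" "v \<in> T" by auto
  show "\<exists>U. open U \<and> p \<in> U \<and> continuous_on (B \<times> T \<inter> U) (\<lambda>(t, v). G t v)"
  proof (cases "t = a")
    case False
    then show ?thesis
      using p by (intro exI[of _ "(- {a}) \<times> UNIV"])
        (auto intro!: open_Times continuous_on_subset[OF cont])
  next
    case True
    then obtain r where r: "r > 0" "cball a r \<subseteq> B" using p B open_contains_cball by metis
    have eq: "G t v = contour_integral (circlepath a r) (\<lambda>w. G w v / (w - t)) / (2 * pi * \<i>)"
      if "v \<in> T" "t \<in> ball a r" for t v
    proof -
      have "(\<lambda>t. G t v) holomorphic_on cball a r" using hol[OF that(1)] r(2) holomorphic_on_subset by blast
      from Cauchy_integral_circlepath_simple[OF this, of t] that(2) show ?thesis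
        by (simp add: contour_integral_unique dist_norm norm_minus_commute)
    qed
    have sub: "sphere a r \<subseteq> B - {a}" using r by auto
    have "continuous_on ((ball a r \<times> T) \<times> sphere a r) (\<lambda>(q, w). G w (snd q) / (w - fst q))"
      unfolding case_prod_beta
    proof (intro continuous_intros)
      have "continuous_on ((ball a r \<times> T) \<times> sphere a r) (\<lambda>x. (\<lambda>(t, v). G t v) (snd x, snd (fst x)))"
        by (rule continuous_on_compose2[OF cont]) (use sub in \<open>auto intro!: continuous_intros\<close>)
      then show "continuous_on ((ball a r \<times> T) \<times> sphere a r) (\<lambda>x. G (snd x) (snd (fst x)))"
        by simp
    qed auto
    from circle_integral_continuous[OF this]
    have "continuous_on (ball a r \<times> T)
        (\<lambda>q. contour_integral (circlepath a r) (\<lambda>w. G w (snd q) / (w - fst q)) / (2 * pi * \<i>))"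
      using r by (intro continuous_intros) auto
    then have "continuous_on (ball a r \<times> T) (\<lambda>(t, v). G t v)"
      by (rule continuous_on_eq) (auto simp: eq)
    moreover have "B \<times> T \<inter> (ball a r \<times> UNIV) = ball a r \<times> T" using r ball_subset_cball by blast
    ultimately show ?thesis
      using p r True by (intro exI[of _ "ball a r \<times> UNIV"]) (auto intro: open_Times)
  qed
qed

lemma removable_holomorphic_param:
  fixes G :: "complex \<Rightarrow> complex \<Rightarrow> complex"
  assumes cont: "continuous_on (B \<times> T) (\<lambda>(t, v). G t v)" and B: "open B" "a \<in> B" and T: "open T"
    and hol: "\<And>v. v \<in> T \<Longrightarrow> (\<lambda>t. G t v) holomorphic_on B"
    and hol2: "\<And>t. t \<in> B - {a} \<Longrightarrow> G t holomorphic_on T"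
  shows "G a holomorphic_on T"
proof -
  obtain r where r: "r > 0" "cball a r \<subseteq> B" using B open_contains_cball by metis
  have sub: "sphere a r \<subseteq> B - {a}" using r by auto
  have "(\<lambda>v. contour_integral (circlepath a r) (\<lambda>w. G w v / (w - a)) / (2 * pi * \<i>)) holomorphic_on T"
  proof (intro holomorphic_intros circle_integral_holomorphic[OF _ T])
    have "continuous_on (T \<times> sphere a r) (\<lambda>p. (\<lambda>(t, v). G t v) (snd p, fst p))"
      by (rule continuous_on_compose2[OF cont]) (use sub in \<open>auto intro!: continuous_intros\<close>)
    then show "continuous_on (T \<times> sphere a r) (\<lambda>(v, w). G w v / (w - a))"
      unfolding case_prod_beta using r by (intro continuous_intros) auto
  qed (use r sub hol2 in \<open>auto intro!: holomorphic_intros\<close>)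
  then show ?thesis
  proof (rule holomorphic_transform)
    fix v assume v: "v \<in> T"
    have "(\<lambda>t. G t v) holomorphic_on cball a r" using hol[OF v] r(2) holomorphic_on_subset by blast
    from Cauchy_integral_circlepath_simple[OF this, of a] r
    show "contour_integral (circlepath a r) (\<lambda>w. G w v / (w - a)) / (2 * pi * \<i>) = G a v"
      by (simp add: contour_integral_unique)
  qed
qed

section \<open>Roots of a holomorphic family of holomorphic functions\<close>

text \<open>
For \<open>z\<close> near \<open>z0\<close> the modulus of \<open>F z\<close> at the centre is smaller than on the circle, which the
minimum modulus principle forbids for a function without zeros in the disc.
\<close>

lemma root_persists:
  fixes F :: "'a::topological_space \<Rightarrow> complex \<Rightarrow> complex"
  assumes cont: "continuous_on (A \<times> cball u r) (\<lambda>(z, u). F z u)" and z0: "z0 \<in> A" and r: "r > 0"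
    and hol: "\<And>z. z \<in> A \<Longrightarrow> F z holomorphic_on ball u r"
    and root: "F z0 u = 0" and nz: "\<And>w. w \<in> sphere u r \<Longrightarrow> F z0 w \<noteq> 0"
  shows "\<forall>\<^sub>F z in at z0 within A. \<exists>w\<in>ball u r. F z w = 0"
proof -
  have contz: "continuous_on (cball u r) (F z)" if "z \<in> A" for z
  proof -
    have "continuous_on (cball u r) (\<lambda>w. (\<lambda>(z, u). F z u) (z, w))"
      by (rule continuous_on_compose2[OF cont]) (use that in \<open>auto intro!: continuous_intros\<close>)
    then show ?thesis by simp
  qed
  have "continuous_on (sphere u r) (\<lambda>w. norm (F z0 w))"
    by (intro continuous_on_norm continuous_on_subset[OF contz[OF z0]]) auto
  moreover have "sphere u r \<noteq> {}" using r by simp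
  ultimately obtain w0 where w0: "w0 \<in> sphere u r" "\<And>w. w \<in> sphere u r \<Longrightarrow> norm (F z0 w0) \<le> norm (F z0 w)"
    using continuous_attains_inf[of "sphere u r"] by (metis compact_sphere)
  define e where "e = norm (F z0 w0) / 3"
  have e: "e > 0" using nz[OF w0(1)] by (simp add: e_def)
  obtain X where X: "z0 \<in> X" "open X"
      "\<forall>z\<in>X \<inter> A. \<forall>t\<in>cball u r. dist ((\<lambda>(z, u). F z u) (z, t)) ((\<lambda>(z, u). F z u) (z0, t)) \<le> e"
    using continuous_on_prod_compactE[OF cont compact_cball z0 e] by blast
  have "\<exists>w\<in>ball u r. F z w = 0" if z: "z \<in> X" "z \<in> A" for z
  proof -
    have d: "norm (F z t - F z0 t) \<le> e" if "t \<in> cball u r" for t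
      using X(3) z that by (auto simp: dist_norm)
    obtain w where "w \<in> ball u r" "F z w = 0"
    proof (rule holomorphic_contract_to_zero[OF contz[OF z(2)] hol[OF z(2)] r])
      fix w assume w: "norm (u - w) = r"
      have "norm (F z u) \<le> e" using d[of u] root r by simp
      moreover have "3 * e \<le> norm (F z0 w)" using w0(2)[of w] w by (simp add: e_def dist_norm)
      moreover have "norm (F z0 w) \<le> norm (F z w) + e"
        using d[of w] w norm_triangle_sub[of "F z0 w" "F z w"] by (simp add: dist_norm norm_minus_commute)
      ultimately show "norm (F z u) < norm (F z w)" using e by linarith
    qed
    then show ?thesis by blast
  qed
  then show ?thesis unfolding eventually_at_topological using X by blast
qed

lemma eventually_nonzero_on_compact:
  fixes F :: "'a::topological_space \<Rightarrow> 'b::topological_space \<Rightarrow> complex"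
  assumes cont: "continuous_on (A \<times> K) (\<lambda>(z, u). F z u)" and z0: "z0 \<in> A" and K: "compact K"
    and nz: "\<And>w. w \<in> K \<Longrightarrow> F z0 w \<noteq> 0"
  shows "\<forall>\<^sub>F z in at z0 within A. \<forall>w\<in>K. F z w \<noteq> 0"
proof (cases "K = {}")
  case False
  have "continuous_on K (\<lambda>w. (\<lambda>(z, u). F z u) (z0, w))"
    by (rule continuous_on_compose2[OF cont]) (use z0 in \<open>auto intro!: continuous_intros\<close>)
  then have "continuous_on K (\<lambda>w. norm (F z0 w))" by (auto intro: continuous_on_norm)
  then obtain w0 where w0: "w0 \<in> K" "\<And>w. w \<in> K \<Longrightarrow> norm (F z0 w0) \<le> norm (F z0 w)"
    using continuous_attains_inf[OF K False] by blast
  define e where "e = norm (F z0 w0) / 2"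
  have e: "e > 0" using nz[OF w0(1)] by (simp add: e_def)
  obtain X where X: "z0 \<in> X" "open X"
      "\<forall>z\<in>X \<inter> A. \<forall>t\<in>K. dist ((\<lambda>(z, u). F z u) (z, t)) ((\<lambda>(z, u). F z u) (z0, t)) \<le> e"
    using continuous_on_prod_compactE[OF cont K z0 e] by blast
  have "F z w \<noteq> 0" if "z \<in> X" "z \<in> A" "w \<in> K" for z w
  proof
    assume "F z w = 0"
    moreover have "dist (F z w) (F z0 w) \<le> e" using X(3) that by auto
    ultimately have "norm (F z0 w) \<le> e" by simp
    then show False using w0(2)[OF that(3)] e unfolding e_def by linarith
  qed
  then show ?thesis unfolding eventually_at_topological using X by blast
qed simp

text \<open>
Holomorphic functions \<open>F z\<close> on a disc, depending holomorphically on \<open>z\<close>, whose zeros stay off the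
circle of radius \<open>r\<close>. The larger radius \<open>R\<close> makes room for integration over this circle.
\<close>

locale root_family =
  fixes F :: "complex \<Rightarrow> complex \<Rightarrow> complex" and A :: "complex set" and c :: complex and r R :: real
  assumes A: "open A" and r: "0 < r" "r < R"
    and cont: "continuous_on (A \<times> ball c R) (\<lambda>(z, u). F z u)"
    and hol1: "\<And>u. u \<in> ball c R \<Longrightarrow> (\<lambda>z. F z u) holomorphic_on A"
    and hol2: "\<And>z. z \<in> A \<Longrightarrow> F z holomorphic_on ball c R"
    and nz: "\<And>z u. z \<in> A \<Longrightarrow> u \<in> sphere c r \<Longrightarrow> F z u \<noteq> 0"
begin

definition roots :: "complex \<Rightarrow> complex set"
  where "roots z = {u \<in> ball c r. F z u = 0}"

definition moment :: "nat \<Rightarrow> complex \<Rightarrow> complex"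
  where "moment p z = contour_integral (circlepath c r) (\<lambda>u. deriv (F z) u * u ^ p / F z u) / (2 * pi * \<i>)"

lemma not_constant_zero: "z \<in> A \<Longrightarrow> \<exists>w\<in>ball c R. F z w \<noteq> 0"
  using nz[of z "c + of_real r"] r by (intro bexI[of _ "c + of_real r"]) (auto simp: dist_norm)

lemma finite_zeros: 
  assumes "z \<in> A" "q < R" shows "finite {u \<in> cball c q. F z u = 0}"
proof (cases "F z constant_on ball c R")
  case True
  then have "F z u \<noteq> 0" if "u \<in> ball c R" for u
    using not_constant_zero[OF assms(1)] that by (metis constant_on_def)
  then have "{u \<in> cball c q. F z u = 0} = {}" using assms(2) by fastforce
  then show ?thesis by (metis finite.emptyI)
next
  case False
  then show ?thesis
    using holomorphic_compact_finite_zeros[OF hol2[OF assms(1)], of "cball c q"] assms(2)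
    by (auto simp: cball_subset_ball_iff)
qed

lemma finite_roots: "z \<in> A \<Longrightarrow> finite (roots z)"
  by (rule finite_subset[OF _ finite_zeros[of z r]]) (use r in \<open>auto simp: roots_def\<close>)

lemma zorder_pos:
  assumes "z \<in> A" "u \<in> roots z"
  shows "zorder (F z) u > 0"
  using zorder_exist_zero[OF hol2[OF assms(1)], of u] not_constant_zero[OF assms(1)] assms(2) r
  by (auto simp: roots_def)

text \<open>
By the argument principle the moments are the power sums of the roots, counted with multiplicity.
\<close>

lemma moment_eq:
  assumes z: "z \<in> A"
  shows "moment p z = (\<Sum>u\<in>roots z. of_int (zorder (F z) u) * u ^ p)"
proof -
  define q where "q = (r + R) / 2"
  have q: "r < q" "q < R" using r by (auto simp: q_def)
  let ?Z = "{w \<in> ball c q. F z w = 0 \<or> w \<in> {}}"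
  have fin: "finite ?Z" by (rule finite_subset[OF _ finite_zeros[OF z q(2)]]) auto
  have sub: "ball c q \<subseteq> ball c R" using q by (simp add: ball_subset_ball_iff)
  have pi: "path_image (circlepath c r) = sphere c r" using r by simp
  have "contour_integral (circlepath c r) (\<lambda>u. deriv (F z) u * u ^ p / F z u) = 2 * pi * \<i> *
      (\<Sum>u\<in>?Z. winding_number (circlepath c r) u * u ^ p * zorder (F z) u)"
  proof (rule argument_principle)
    show "path_image (circlepath c r) \<subseteq> ball c q - ?Z"
      unfolding pi using nz[OF z] q by auto
    show "\<forall>w. w \<notin> ball c q \<longrightarrow> winding_number (circlepath c r) w = 0"
    proof (intro allI impI winding_number_zero_outside)
      fix w assume "w \<notin> ball c q"
      then show "w \<notin> cball c r" using q by auto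
    qed (use r in \<open>auto simp: pi\<close>)
    show "F z holomorphic_on ball c q - {}" using hol2[OF z] sub by (auto intro: holomorphic_on_subset)
  qed (use fin in \<open>auto intro!: holomorphic_intros\<close>)
  also have "(\<Sum>u\<in>?Z. winding_number (circlepath c r) u * u ^ p * zorder (F z) u)
      = (\<Sum>u\<in>roots z. winding_number (circlepath c r) u * u ^ p * zorder (F z) u)"
  proof (rule sum.mono_neutral_right[OF fin])
    show "\<forall>u\<in>?Z - roots z. winding_number (circlepath c r) u * u ^ p * zorder (F z) u = 0"
    proof
      fix u assume u: "u \<in> ?Z - roots z"
      then have "u \<notin> cball c r" using nz[OF z, of u] by (auto simp: roots_def)
      then have "winding_number (circlepath c r) u = 0"
        by (intro winding_number_zero_outside[of _ "cball c r"]) (use r in \<open>auto simp: pi\<close>)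
      then show "winding_number (circlepath c r) u * u ^ p * zorder (F z) u = 0" by simp
    qed
  qed (use q in \<open>auto simp: roots_def\<close>)
  also have "\<dots> = (\<Sum>u\<in>roots z. of_int (zorder (F z) u) * u ^ p)"
    by (intro sum.cong refl)
      (auto simp: roots_def winding_number_circlepath dist_norm norm_minus_commute)
  finally show ?thesis by (simp add: moment_def)
qed

lemma moment_holomorphic: "moment p holomorphic_on A"
proof -
  have sub: "sphere c r \<subseteq> ball c R" using r by auto
  have dc: "continuous_on (A \<times> ball c R) (\<lambda>(z, u). deriv (F z) u)"
    by (rule deriv_continuous_on_Times[OF cont open_ball hol2])
  have "(\<lambda>z. contour_integral (circlepath c r) (\<lambda>u. deriv (F z) u * u ^ p / F z u)) holomorphic_on A"
  proof (rule circle_integral_holomorphic[OF _ A])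
    have s: "A \<times> sphere c r \<subseteq> A \<times> ball c R" using sub by auto
    show "continuous_on (A \<times> sphere c r) (\<lambda>(z, u). deriv (F z) u * u ^ p / F z u)"
      using continuous_on_subset[OF cont s] continuous_on_subset[OF dc s] nz
      unfolding case_prod_beta by (intro continuous_intros) auto
    show "(\<lambda>z. deriv (F z) u * u ^ p / F z u) holomorphic_on A" if "u \<in> sphere c r" for u
      using that sub nz
      by (intro holomorphic_intros hol1 deriv_holomorphic_param[OF cont A open_ball hol1 hol2]) auto
  qed (use r in auto)
  then have "(\<lambda>z. contour_integral (circlepath c r) (\<lambda>u. deriv (F z) u * u ^ p / F z u) / (2 * pi * \<i>))
      holomorphic_on A" by (intro holomorphic_intros) auto
  then show ?thesis by (simp add: moment_def[abs_def])
qed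

lemma card_roots_le_moment_0:
  assumes "z \<in> A" shows "real (card (roots z)) \<le> norm (moment 0 z)"
proof -
  have "real (card (roots z)) = (\<Sum>u\<in>roots z. 1)" by simp
  also have "\<dots> \<le> (\<Sum>u\<in>roots z. of_int (zorder (F z) u))"
    by (intro sum_mono) (use zorder_pos[OF assms] in force)
  also have "\<dots> = Re (moment 0 z)" by (simp add: moment_eq[OF assms])
  also have "\<dots> \<le> norm (moment 0 z)" by (rule complex_Re_le_cmod)
  finally show ?thesis .
qed

text \<open>
A single root \<open>v\<close> of multiplicity \<open>\<mu>\<close> has the moments \<open>\<mu>\<close> and \<open>\<mu> v\<close>, so it is a quotient of two
holomorphic functions.
\<close>

lemma unique_root_holomorphic:
  assumes "\<And>z. z \<in> A \<Longrightarrow> roots z = {v z}"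
  shows "v holomorphic_on A"
proof -
  have m: "moment p z = of_int (zorder (F z) (v z)) * v z ^ p" if "z \<in> A" for p z
    using moment_eq[OF that] assms[OF that] by simp
  have nz0: "moment 0 z \<noteq> 0" if "z \<in> A" for z
    using m[OF that, of 0] zorder_pos[OF that, of "v z"] assms[OF that] by simp
  have "(\<lambda>z. moment 1 z / moment 0 z) holomorphic_on A"
    using nz0 by (intro holomorphic_intros moment_holomorphic) auto
  then show ?thesis
    by (rule holomorphic_transform) (use m nz0 in auto)
qed

end

section \<open>Hankel determinants and the number of roots\<close>

definition hankel :: "nat \<Rightarrow> (nat \<Rightarrow> 'a::comm_ring_1) \<Rightarrow> 'a mat"
  where "hankel k s = mat k k (\<lambda>(i, j). s (i + j))"

lemma hankel_carrier [simp]: "hankel k s \<in> carrier_mat k k"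
  by (simp add: hankel_def)

lemma det_hankel_eq_0_iff:
  fixes s :: "nat \<Rightarrow> 'a::field"
  shows "Determinant.det (hankel k s) = 0 \<longleftrightarrow>
    (\<exists>a. (\<exists>j<k. a j \<noteq> 0) \<and> (\<forall>i<k. (\<Sum>j<k. s (i + j) * a j) = 0))"
proof -
  have mv: "(hankel k s *\<^sub>v v) $ i = (\<Sum>j<k. s (i + j) * v $ j)"
    if "v \<in> carrier_vec k" "i < k" for v i
    using that by (simp add: hankel_def scalar_prod_def lessThan_atLeast0)
  have "Determinant.det (hankel k s) = 0 \<longleftrightarrow>
      (\<exists>v. v \<in> carrier_vec k \<and> v \<noteq> 0\<^sub>v k \<and> hankel k s *\<^sub>v v = 0\<^sub>v k)"
    by (rule det_0_iff_vec_prod_zero_field) simp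
  also have "\<dots> \<longleftrightarrow> (\<exists>a. (\<exists>j<k. a j \<noteq> 0) \<and> (\<forall>i<k. (\<Sum>j<k. s (i + j) * a j) = 0))"
  proof
    assume "\<exists>v. v \<in> carrier_vec k \<and> v \<noteq> 0\<^sub>v k \<and> hankel k s *\<^sub>v v = 0\<^sub>v k"
    then obtain v where v: "v \<in> carrier_vec k" "v \<noteq> 0\<^sub>v k" "hankel k s *\<^sub>v v = 0\<^sub>v k" by auto
    have "\<exists>j<k. v $ j \<noteq> 0"
      using v(1,2) by (metis carrier_vecD eq_vecI index_zero_vec)
    moreover have "(\<Sum>j<k. s (i + j) * v $ j) = 0" if "i < k" for i
      using mv[OF v(1) that] v(3) that by simp
    ultimately show "\<exists>a. (\<exists>j<k. a j \<noteq> 0) \<and> (\<forall>i<k. (\<Sum>j<k. s (i + j) * a j) = 0)"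
      by blast
  next
    assume "\<exists>a. (\<exists>j<k. a j \<noteq> 0) \<and> (\<forall>i<k. (\<Sum>j<k. s (i + j) * a j) = 0)"
    then obtain a where a: "\<exists>j<k. a j \<noteq> 0" "\<forall>i<k. (\<Sum>j<k. s (i + j) * a j) = 0" by auto
    let ?v = "Matrix.vec k a"
    have "?v \<noteq> 0\<^sub>v k" using a(1) by (metis index_vec index_zero_vec(1))
    moreover have "hankel k s *\<^sub>v ?v = 0\<^sub>v k"
    proof (rule eq_vecI)
      fix i assume "i < dim_vec (0\<^sub>v k)"
      then show "(hankel k s *\<^sub>v ?v) $ i = 0\<^sub>v k $ i"
        using mv[of ?v i] a(2) by simp
    qed (simp add: hankel_def)
    ultimately show "\<exists>v. v \<in> carrier_vec k \<and> v \<noteq> 0\<^sub>v k \<and> hankel k s *\<^sub>v v = 0\<^sub>v k"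
      by (intro exI[of _ ?v]) simp
  qed
  finally show ?thesis .
qed

text \<open>
The Hankel matrix is the Gram matrix of the powers of \<open>u\<close> for the bilinear form with weights \<open>\<mu>\<close> on
polynomial functions on \<open>S\<close>, so its kernel consists of polynomials of degree less than \<open>k\<close> that are
orthogonal to all such polynomials. If \<open>k > card S\<close> then
the polynomial \<open>P\<close> with root set \<open>S\<close> is in the kernel. If \<open>k = card S\<close> then pairing with the product of
all but one of the linear factors shows that an element of the kernel vanishes on \<open>S\<close>, and its degree is
too small for that.
\<close>

lemma det_hankel_moments:
  fixes \<mu> :: "'a::field \<Rightarrow> 'a"
  assumes fin: "finite S" and nz: "\<And>u. u \<in> S \<Longrightarrow> \<mu> u \<noteq> 0"
  defines "D \<equiv> \<lambda>k. Determinant.det (hankel k (\<lambda>p. \<Sum>u\<in>S. \<mu> u * u ^ p))"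
  shows "D (card S) \<noteq> 0" and "card S < k \<Longrightarrow> D k = 0"
proof -
  have apply_poly: "(\<Sum>j<k. (\<Sum>u\<in>S. \<mu> u * u ^ (i + j)) * a j) = (\<Sum>u\<in>S. \<mu> u * u ^ i * (\<Sum>j<k. a j * u ^ j))"
    for k i and a :: "nat \<Rightarrow> 'a"
  proof -
    have "(\<Sum>j<k. (\<Sum>u\<in>S. \<mu> u * u ^ (i + j)) * a j) = (\<Sum>j<k. \<Sum>u\<in>S. \<mu> u * u ^ i * (a j * u ^ j))"
      by (simp add: sum_distrib_left sum_distrib_right power_add mult_ac)
    also have "\<dots> = (\<Sum>u\<in>S. \<mu> u * u ^ i * (\<Sum>j<k. a j * u ^ j))"
      by (subst sum.swap) (simp add: sum_distrib_left)
    finally show ?thesis .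
  qed
  define P where "P = (\<Prod>u\<in>S. [:- u, 1:])"
  have degP: "degree P = card S" and monic: "lead_coeff P = 1"
    unfolding P_def by (subst degree_prod_eq_sum_degree) (auto simp: lead_coeff_prod)
  have rootP: "poly P u = 0" if "u \<in> S" for u
    unfolding P_def poly_prod using fin that by (auto intro!: prod_zero)
  show "D k = 0" if "card S < k"
    unfolding D_def det_hankel_eq_0_iff apply_poly
  proof (intro exI conjI allI impI)
    show "coeff P (card S) \<noteq> 0" using monic degP by simp
    have "(\<Sum>j<k. coeff P j * u ^ j) = poly P u" for u
      by (simp add: poly_altdef) (rule sum.mono_neutral_right, use that degP in \<open>auto simp: coeff_eq_0\<close>)
    then show "(\<Sum>u\<in>S. \<mu> u * u ^ i * (\<Sum>j<k. coeff P j * u ^ j)) = 0" for i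
      using rootP by simp
  qed (use that in auto)
  show "D (card S) \<noteq> 0"
  proof
    assume "D (card S) = 0"
    then obtain a where a: "\<exists>j<card S. a j \<noteq> 0"
      and orth: "\<And>i. i < card S \<Longrightarrow> (\<Sum>u\<in>S. \<mu> u * u ^ i * (\<Sum>j<card S. a j * u ^ j)) = 0"
      unfolding D_def det_hankel_eq_0_iff apply_poly by auto
    define q where "q = (\<Sum>j<card S. monom (a j) j)"
    have q: "poly q u = (\<Sum>j<card S. a j * u ^ j)" for u
      by (simp add: q_def poly_sum poly_monom)
    have cq: "coeff q j = (if j < card S then a j else 0)" for j
      by (simp add: q_def coeff_sum)
    have qnz: "q \<noteq> 0" using a cq by (metis coeff_0)
    then have degq: "degree q < card S"
      using cq by (metis leading_coeff_0_iff)
    have orth': "(\<Sum>u\<in>S. \<mu> u * poly r u * poly q u) = 0" if r: "degree r < card S" for r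
    proof -
      have "(\<Sum>u\<in>S. \<mu> u * poly r u * poly q u) =
          (\<Sum>u\<in>S. \<Sum>i\<le>degree r. coeff r i * (\<mu> u * u ^ i * poly q u))"
        by (simp add: poly_altdef[of r] sum_distrib_left sum_distrib_right mult_ac)
      also have "\<dots> = (\<Sum>i\<le>degree r. coeff r i * (\<Sum>u\<in>S. \<mu> u * u ^ i * poly q u))"
        by (subst sum.swap) (simp add: sum_distrib_left)
      also have "\<dots> = 0" using orth r by (simp add: q)
      finally show ?thesis .
    qed
    have "poly q v = 0" if v: "v \<in> S" for v
    proof -
      define r where "r = (\<Prod>u\<in>S - {v}. [:- u, 1:])"
      have "degree r = card (S - {v})"
        unfolding r_def by (subst degree_prod_eq_sum_degree) auto
      then have "degree r < card S" using fin v by (metis card_Diff1_less)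
      then have "(\<Sum>u\<in>S. \<mu> u * poly r u * poly q u) = 0" by (rule orth')
      moreover have "\<mu> u * poly r u * poly q u = 0" if "u \<in> S - {v}" for u
        using that fin unfolding r_def poly_prod by (auto intro!: prod_zero)
      ultimately have "\<mu> v * poly r v * poly q v = 0"
        using v fin by (simp add: sum.remove)
      moreover have "poly r v \<noteq> 0" unfolding r_def poly_prod using fin by auto
      ultimately show ?thesis using nz v by simp
    qed
    then have "S \<subseteq> {x. poly q x = 0}" by auto
    then have "card S \<le> degree q"
      using card_mono[OF poly_roots_finite[OF qnz]] card_poly_roots_bound[OF qnz] le_trans by blast
    with degq show False by simp
  qed
qed

context root_family
begin

lemma det_hankel_moment_holomorphic:
  "(\<lambda>z. Determinant.det (hankel k (\<lambda>p. moment p z))) holomorphic_on A"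
proof -
  have "Determinant.det (hankel k (\<lambda>p. moment p z)) =
      (\<Sum>\<pi> | \<pi> permutes {0..<k}. signof \<pi> * (\<Prod>i = 0..<k. moment (i + \<pi> i) z))" for z
    unfolding det_def'[OF hankel_carrier]
  proof (rule sum.cong[OF refl])
    fix \<pi> assume "\<pi> \<in> {\<pi>. \<pi> permutes {0..<k}}"
    then have "\<pi> i < k" if "i < k" for i using permutes_in_image[of \<pi> "{0..<k}" i] that by simp
    then have "(\<Prod>i = 0..<k. hankel k (\<lambda>p. moment p z) $$ (i, \<pi> i)) = (\<Prod>i = 0..<k. moment (i + \<pi> i) z)"
      by (intro prod.cong[OF refl]) (simp add: hankel_def)
    then show "signof \<pi> * (\<Prod>i = 0..<k. hankel k (\<lambda>p. moment p z) $$ (i, \<pi> i)) =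
        signof \<pi> * (\<Prod>i = 0..<k. moment (i + \<pi> i) z)" by (rule arg_cong)
  qed
  then show ?thesis by (simp only:) (intro holomorphic_intros moment_holomorphic)
qed

lemma det_hankel_moment_card:
  assumes "z \<in> A"
  shows "Determinant.det (hankel (card (roots z)) (\<lambda>p. moment p z)) \<noteq> 0"
    and "card (roots z) < k \<Longrightarrow> Determinant.det (hankel k (\<lambda>p. moment p z)) = 0"
proof -
  have eq: "(\<lambda>p. moment p z) = (\<lambda>p. \<Sum>u\<in>roots z. of_int (zorder (F z) u) * u ^ p)"
    using moment_eq[OF assms] by (intro ext)
  have nz: "of_int (zorder (F z) u) \<noteq> (0 :: complex)" if "u \<in> roots z" for u
    using zorder_pos[OF assms that] by simp
  show "Determinant.det (hankel (card (roots z)) (\<lambda>p. moment p z)) \<noteq> 0"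
    unfolding eq by (rule det_hankel_moments(1)[OF finite_roots[OF assms] nz])
  show "Determinant.det (hankel k (\<lambda>p. moment p z)) = 0" if "card (roots z) < k"
    unfolding eq by (rule det_hankel_moments(2)[OF finite_roots[OF assms] nz that])
qed

text \<open>
Let \<open>k\<close> be the largest size for which the Hankel determinant of the moments is not identically zero near
\<open>a\<close>. It exists since the number of roots is locally bounded by the moment of order \<open>0\<close>. Being
holomorphic, this determinant has no zeros in a punctured neighbourhood of \<open>a\<close>, so there are at least
\<open>k\<close> roots there. More roots would give a larger nonvanishing determinant.
\<close>

lemma card_roots_generically_constant:
  assumes a: "a \<in> A"
  obtains \<eta> k where "\<eta> > 0" "ball a \<eta> \<subseteq> A" "\<And>z. z \<in> ball a \<eta> - {a} \<Longrightarrow> card (roots z) = k"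
proof -
  obtain \<rho> where \<rho>: "\<rho> > 0" "cball a \<rho> \<subseteq> A" using A a open_contains_cball by metis
  let ?D = "\<lambda>k z. Determinant.det (hankel k (\<lambda>p. moment p z))"
  have "continuous_on (cball a \<rho>) (moment 0)"
    using moment_holomorphic \<rho>(2) by (meson continuous_on_subset holomorphic_on_imp_continuous_on)
  then have "bounded (moment 0 ` cball a \<rho>)"
    by (intro compact_imp_bounded compact_continuous_image) auto
  then obtain B where B: "\<And>z. z \<in> cball a \<rho> \<Longrightarrow> norm (moment 0 z) \<le> B"
    unfolding bounded_iff by (metis imageI)
  define N where "N = {k. \<exists>z\<in>ball a \<rho>. ?D k z \<noteq> 0}"
  have "k \<le> nat \<lceil>B\<rceil>" if "k \<in> N" for k
  proof -
    from that obtain z where z: "z \<in> ball a \<rho>" "?D k z \<noteq> 0" by (auto simp: N_def)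
    then have "k \<le> card (roots z)"
      using det_hankel_moment_card(2)[of z k] \<rho> by (meson ball_subset_cball not_less subsetD)
    moreover have "real (card (roots z)) \<le> B"
      using card_roots_le_moment_0[of z] B[of z] z(1) \<rho>(2) ball_subset_cball[of a \<rho>]
      by (meson order_trans subsetD)
    ultimately show ?thesis by linarith
  qed
  then have finN: "finite N" by (meson finite_nat_set_iff_bounded_le)
  have "0 \<in> N" unfolding N_def using \<rho> by (auto simp: det_def'[OF hankel_carrier] intro!: exI[of _ a])
  define k where "k = Max N"
  have kN: "k \<in> N" unfolding k_def using finN \<open>0 \<in> N\<close> by (intro Max_in) auto
  have kmax: "j \<le> k" if "j \<in> N" for j unfolding k_def using finN that by (rule Max_ge)
  obtain \<beta> where \<beta>: "\<beta> \<in> ball a \<rho>" "?D k \<beta> \<noteq> 0" using kN by (auto simp: N_def)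
  have "\<forall>\<^sub>F w in at a. ?D k w \<noteq> 0 \<and> w \<in> ball a \<rho>"
  proof (rule non_zero_neighbour_alt[where \<beta> = \<beta>])
    have "ball a \<rho> \<subseteq> A" using \<rho>(2) ball_subset_cball by (rule order_trans[rotated])
    then show "?D k holomorphic_on ball a \<rho>"
      by (rule holomorphic_on_subset[OF det_hankel_moment_holomorphic])
    show "a \<in> ball a \<rho>" using \<rho>(1) by simp
  qed (rule open_ball connected_ball \<beta>)+
  then obtain d where d: "d > 0" "\<And>w. w \<noteq> a \<Longrightarrow> dist w a < d \<Longrightarrow> ?D k w \<noteq> 0 \<and> w \<in> ball a \<rho>"
    unfolding eventually_at by auto
  show ?thesis
  proof (rule that[of "min d \<rho>" k])
    fix z assume z: "z \<in> ball a (min d \<rho>) - {a}"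
    then have zA: "z \<in> A" using \<rho> by auto
    have zk: "?D k z \<noteq> 0" "z \<in> ball a \<rho>" using d(2)[of z] z by (auto simp: dist_commute)
    have "k \<le> card (roots z)" using det_hankel_moment_card(2)[OF zA] zk by (meson not_less)
    moreover have "card (roots z) \<in> N"
      using det_hankel_moment_card(1)[OF zA] zk(2) by (auto simp: N_def)
    ultimately show "card (roots z) = k" using kmax by (meson le_antisym)
  next
    show "min d \<rho> > 0" using d(1) \<rho>(1) by simp
    have "ball a (min d \<rho>) \<subseteq> cball a \<rho>" by auto
    then show "ball a (min d \<rho>) \<subseteq> A" using \<rho>(2) by (rule order_trans)
  qed
qed

end

section \<open>Branches of roots\<close>

context root_family
begin

lemma roots_near:
  assumes z0: "z0 \<in> A" and u0: "u0 \<in> roots z0" and e: "e > 0"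
  shows "\<forall>\<^sub>F z in at z0 within A. \<exists>q\<in>roots z. dist q u0 < e"
proof -
  obtain d where d: "d > 0" "\<And>x. x \<in> roots z0 \<Longrightarrow> x \<noteq> u0 \<Longrightarrow> d \<le> dist u0 x"
    using finite_set_avoid[OF finite_roots[OF z0], of u0] by blast
  have u0': "dist c u0 < r" "F z0 u0 = 0" using u0 by (auto simp: roots_def)
  define q where "q = min (d / 2) (min e (r - dist c u0) / 2)"
  have q: "q > 0" "q < d" "q < e" "q < r - dist c u0"
    using d e u0' by (auto simp: q_def min_def)
  have sub: "cball u0 q \<subseteq> ball c r"
  proof
    fix w assume "w \<in> cball u0 q"
    then show "w \<in> ball c r" using dist_triangle[of c w u0] q by simp
  qed
  then have sub': "cball u0 q \<subseteq> ball c R" using r by (meson less_imp_le order_trans subset_ball)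
  have "\<forall>\<^sub>F z in at z0 within A. \<exists>w\<in>ball u0 q. F z w = 0"
  proof (rule root_persists[OF continuous_on_subset[OF cont] z0 q(1)])
    show "F z0 w \<noteq> 0" if "w \<in> sphere u0 q" for w
    proof
      assume "F z0 w = 0"
      then have "w \<in> roots z0" using that sub by (auto simp: roots_def)
      then show False using d(2)[of w] that q by auto
    qed
    show "F z holomorphic_on ball u0 q" if "z \<in> A" for z
      using hol2[OF that] by (rule holomorphic_on_subset) (use sub' in auto)
    show "A \<times> cball u0 q \<subseteq> A \<times> ball c R" using sub' by (rule Sigma_mono[OF order_refl])
    show "F z0 u0 = 0" by (rule u0'(2))
  qed
  then show ?thesis
  proof eventually_elim
    case (elim z)
    then obtain w where w: "w \<in> ball u0 q" "F z w = 0" by auto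
    then have "w \<in> roots z" using subsetD[OF sub, of w] by (auto simp: roots_def)
    then show ?case using w q by (intro bexI[of _ w]) (auto simp: dist_commute)
  qed
qed

lemma varying_configuration_roots:
  assumes "X \<subseteq> A" "\<And>z. z \<in> X \<Longrightarrow> card (roots z) = k"
  shows "varying_configuration X roots k"
  unfolding varying_configuration_def
proof (intro ballI conjI allI impI)
  fix z p and e :: real assume "z \<in> X" "p \<in> roots z" "e > 0"
  then show "\<forall>\<^sub>F y in at z within X. \<exists>q\<in>roots y. dist q p < e"
    using roots_near[of z p e] assms(1) by (auto intro: filter_leD[OF at_le])
qed (use assms finite_roots in auto)

text \<open>
Near each point the family restricts to a small disc around the value of the section, where the section
is the only root.
\<close>

lemma section_holomorphic:
  assumes vc: "varying_configuration X roots k" and X: "open X" "X \<subseteq> A"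
    and v: "continuous_on X v" "\<And>z. z \<in> X \<Longrightarrow> v z \<in> roots z"
  shows "v holomorphic_on X"
proof -
  have "v field_differentiable (at z0)" if z0: "z0 \<in> X" for z0
  proof -
    let ?p = "v z0"
    have p: "?p \<in> roots z0" "dist c ?p < r" using v(2)[OF z0] by (auto simp: roots_def)
    obtain d where d: "d > 0" "\<And>p q. p \<in> roots z0 \<Longrightarrow> q \<in> roots z0 \<Longrightarrow> p \<noteq> q \<Longrightarrow> d \<le> dist p q"
      using finite_separated[OF varying_configuration_finite[OF vc z0]] by blast
    \<comment> \<open>the disc of radius \<open>e\<close> stays inside the disc of the family and contains no other root over \<open>z0\<close>\<close>
    define e where "e = min (d / 2) (r - dist c ?p)"
    have e: "e > 0" "\<forall>p\<in>roots z0. \<forall>q\<in>roots z0. p \<noteq> q \<longrightarrow> 2 * e \<le> dist p q"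
      using d p by (auto simp: e_def min_def) (smt (verit) d(2))+
    obtain U w where U: "open U" "z0 \<in> U"
      and "\<And>y. y \<in> X \<inter> U \<Longrightarrow> bij_betw (\<lambda>p. w p y) (roots z0) (roots y)"
      and "\<And>p. p \<in> roots z0 \<Longrightarrow> continuous_on (X \<inter> U) (w p)"
      and "\<And>p y. p \<in> roots z0 \<Longrightarrow> y \<in> X \<inter> U \<Longrightarrow> dist (w p y) p < e"
      and uniq: "\<And>p q y. p \<in> roots z0 \<Longrightarrow> y \<in> X \<inter> U \<Longrightarrow> q \<in> roots y \<Longrightarrow> dist q p < e \<Longrightarrow> q = w p y"
      by (rule varying_configuration_local_sections[OF vc z0 e]) (rule that)
    define N where "N = {z \<in> X. v z \<in> ball ?p (e / 2)} \<inter> U"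
    have "open {z \<in> X. v z \<in> ball ?p (e / 2)}"
      using continuous_open_preimage[OF v(1) X(1) open_ball, of ?p "e / 2"]
      by (simp add: vimage_def Int_def del: mem_ball)
    then have oN: "open N" using U by (simp add: N_def open_Int)
    have z0N: "z0 \<in> N" using z0 U e by (simp add: N_def)
    have sub: "ball ?p e \<subseteq> ball c r"
    proof
      fix x assume "x \<in> ball ?p e"
      then show "x \<in> ball c r" using dist_triangle[of c x ?p] by (simp add: e_def)
    qed
    have only: "q = v z" if z: "z \<in> N" and q: "F z q = 0" "q \<in> ball ?p e" for z q
    proof -
      have "q \<in> roots z" using q sub by (auto simp: roots_def)
      then have "q = w ?p z" using uniq[OF p(1), of z q] z q by (auto simp: N_def dist_commute)
      moreover have "v z = w ?p z"
        using uniq[OF p(1), of z "v z"] z v(2)[of z] e by (auto simp: N_def dist_commute)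
      ultimately show ?thesis by simp
    qed
    have subR: "ball ?p e \<subseteq> ball c R" using sub r by (meson less_imp_le order_trans subset_ball)
    interpret loc: root_family F N ?p "e / 2" e
    proof
      show "continuous_on (N \<times> ball ?p e) (\<lambda>(z, u). F z u)"
        by (rule continuous_on_subset[OF cont]) (use subR X in \<open>auto simp: N_def\<close>)
      show "(\<lambda>z. F z u) holomorphic_on N" if "u \<in> ball ?p e" for u
        by (rule holomorphic_on_subset[OF hol1]) (use subR that X in \<open>auto simp: N_def\<close>)
      show "F z holomorphic_on ball ?p e" if "z \<in> N" for z
        by (rule holomorphic_on_subset[OF hol2]) (use subR that X in \<open>auto simp: N_def\<close>)
      show "F z u \<noteq> 0" if "z \<in> N" "u \<in> sphere ?p (e / 2)" for z u
        using only[of z u] that e by (auto simp: N_def)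
    qed (use oN e in auto)
    have "v holomorphic_on N"
    proof (rule loc.unique_root_holomorphic)
      fix z assume z: "z \<in> N"
      then have "F z (v z) = 0" using v(2)[of z] by (auto simp: N_def roots_def)
      then have "v z \<in> loc.roots z" using z by (simp add: loc.roots_def N_def)
      moreover have "q = v z" if "q \<in> loc.roots z" for q
        using only[OF z, of q] that e by (auto simp: loc.roots_def)
      ultimately show "loc.roots z = {v z}" by blast
    qed
    then show ?thesis by (rule holomorphic_on_imp_differentiable_at[OF _ oN z0N])
  qed
  then show ?thesis by (simp add: holomorphic_on_def field_differentiable_at_within)
qed

end

text \<open>
Applied to a branch of roots: it cannot jump between the disjoint balls around the roots over \<open>0\<close>.
\<close>

lemma connected_in_one_ball:
  fixes f :: "'a::topological_space \<Rightarrow> 'b::metric_space"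
  assumes S: "connected S" "continuous_on S f" and C: "f ` S \<subseteq> (\<Union>c\<in>C. ball c e)"
    and sep: "\<And>c c'. c \<in> C \<Longrightarrow> c' \<in> C \<Longrightarrow> c \<noteq> c' \<Longrightarrow> 2 * e \<le> dist c c'"
    and xy: "x \<in> S" "y \<in> S"
  shows "dist (f x) (f y) < 2 * e"
proof -
  obtain c where c: "c \<in> C" "f x \<in> ball c e" using C xy by auto
  have conn: "connected (f ` S)" using S by (rule connected_continuous_image[rotated])
  have disj: "ball c e \<inter> ball c' e = {}" if "c' \<in> C - {c}" for c'
  proof (rule ccontr)
    assume "ball c e \<inter> ball c' e \<noteq> {}"
    then obtain q where "dist c q < e" "dist c' q < e" by auto
    then have "dist c c' < 2 * e" using dist_triangle2[of c c' q] by linarith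
    then show False using sep[of c c'] that c by force
  qed
  have "f y \<in> ball c e"
  proof (rule ccontr)
    assume n: "f y \<notin> ball c e"
    have "ball c e \<inter> f ` S = {} \<or> (\<Union>c'\<in>C - {c}. ball c' e) \<inter> f ` S = {}"
    proof (rule connectedD[OF conn])
      show "ball c e \<inter> (\<Union>c'\<in>C - {c}. ball c' e) \<inter> f ` S = {}" using disj by blast
      show "f ` S \<subseteq> ball c e \<union> (\<Union>c'\<in>C - {c}. ball c' e)" using C by blast
    qed auto
    moreover have "f y \<in> (\<Union>c'\<in>C - {c}. ball c' e)"
      using n subsetD[OF C imageI[OF xy(2)]] by blast
    ultimately show False using c xy by blast
  qed
  then show ?thesis using c dist_triangle3[of "f x" "f y" c] by simp
qed

section \<open>Roots on a sphere\<close>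

declare sqrt_1_plus_norm2_gt_0 [simp]

lemma isCont_nhds: "isCont f a \<Longrightarrow> (f \<longlongrightarrow> f a) (nhds a)"
  by (simp add: continuous_at tendsto_at_iff_tendsto_nhds)

lemma mult_sqrt_1_plus_norm2_eq_1_iff:
  "t * sqrt (1 + (norm u)\<^sup>2) = 1 \<longleftrightarrow> t = 1 / sqrt (1 + (norm u)\<^sup>2)"
  by (rule nonzero_eq_divide_eq[symmetric, OF sqrt_1_plus_norm2_gt_0(2)])

text \<open>
The derivative of \<open>t\<^sup>2 (1 + \<bar>v(t y)\<bar>\<^sup>2)\<close> with respect to \<open>t\<close> is at least
\<open>2 t (1 + \<bar>v\<bar>\<^sup>2 - \<bar>v\<bar>)\<close>, which is positive.
\<close>

lemma strict_mono_along_ray: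
  fixes v :: "complex \<Rightarrow> complex"
  assumes v: "\<And>t. 0 < t \<Longrightarrow> t \<le> T \<Longrightarrow> v field_differentiable (at (of_real t * y))"
    and small: "\<And>t. 0 < t \<Longrightarrow> t \<le> T \<Longrightarrow> norm (of_real t * y) * norm (deriv v (of_real t * y)) \<le> 1"
    and st: "0 < s" "s < t" "t \<le> T"
  shows "s * sqrt (1 + (norm (v (of_real s * y)))\<^sup>2) < t * sqrt (1 + (norm (v (of_real t * y)))\<^sup>2)"
proof -
  define h where "h t = t\<^sup>2 * (1 + v (of_real t * y) \<bullet> v (of_real t * y))" for t :: real
  have "h s < h t"
  proof (rule DERIV_pos_imp_increasing[OF st(2)])
    fix x assume x: "s \<le> x" "x \<le> t"
    then have x01: "0 < x" "x \<le> T" using st by auto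
    let ?w = "of_real x * y"
    let ?d = "deriv v ?w * y"
    have "(v has_field_derivative deriv v ?w) (at ?w)"
      using v[OF x01] by (simp add: DERIV_deriv_iff_field_differentiable)
    moreover have "((\<lambda>t. of_real t * y) has_vector_derivative y) (at x)"
      by (auto intro!: derivative_eq_intros)
    ultimately have dv: "((\<lambda>t. v (of_real t * y)) has_vector_derivative ?d) (at x)"
      using field_vector_diff_chain_at[of "\<lambda>t. of_real t * y" y x v "deriv v ?w"]
      by (simp add: o_def mult.commute)
    then have "((\<lambda>t. v (of_real t * y) \<bullet> v (of_real t * y)) has_vector_derivative
        v ?w \<bullet> ?d + ?d \<bullet> v ?w) (at x)"
      by (rule bounded_bilinear.has_vector_derivative[OF bounded_bilinear_inner, OF _ ])
        (rule dv)
    then have "((\<lambda>t. v (of_real t * y) \<bullet> v (of_real t * y)) has_real_derivative 2 * (v ?w \<bullet> ?d)) (at x)"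
      by (simp add: has_real_derivative_iff_has_vector_derivative inner_commute)
    then have "(h has_real_derivative 2 * x * (1 + v ?w \<bullet> v ?w) + x\<^sup>2 * (2 * (v ?w \<bullet> ?d))) (at x)"
      unfolding h_def by (auto intro!: derivative_eq_intros simp: power2_eq_square)
    moreover have "2 * x * (1 + v ?w \<bullet> v ?w) + x\<^sup>2 * (2 * (v ?w \<bullet> ?d)) > 0"
    proof -
      have "- (x * (v ?w \<bullet> ?d)) \<le> x * \<bar>v ?w \<bullet> ?d\<bar>"
        using mult_left_mono[OF abs_ge_minus_self[of "v ?w \<bullet> ?d"], of x] x01 by simp
      also have "\<dots> \<le> x * (norm (v ?w) * norm ?d)"
        using x01 by (intro mult_left_mono Cauchy_Schwarz_ineq2) auto
      also have "\<dots> = norm (v ?w) * (norm ?w * norm (deriv v ?w))"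
        using x01 by (simp add: norm_mult)
      also have "\<dots> \<le> norm (v ?w)"
        using small[OF x01] mult_left_mono[OF small[OF x01], of "norm (v ?w)"] by simp
      finally have "- (x * (v ?w \<bullet> ?d)) \<le> norm (v ?w)" .
      moreover have "a < 1 + a\<^sup>2" for a :: real
        using zero_le_power2[of "a - 1 / 2"] by (simp add: power2_eq_square algebra_simps)
      from this[of "norm (v ?w)"] have "norm (v ?w) < 1 + v ?w \<bullet> v ?w"
        by (simp add: power2_norm_eq_inner)
      ultimately have "0 < (1 + v ?w \<bullet> v ?w) + x * (v ?w \<bullet> ?d)"
        by linarith
      then have "0 < 2 * x * ((1 + v ?w \<bullet> v ?w) + x * (v ?w \<bullet> ?d))" using x01 by simp
      then show ?thesis by (simp add: power2_eq_square algebra_simps)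
    qed
    ultimately show "\<exists>y. (h has_real_derivative y) (at x) \<and> 0 < y" by blast
  qed
  then have "sqrt (h s) < sqrt (h t)" by simp
  moreover have "sqrt (h a) = a * sqrt (1 + (norm (v (of_real a * y)))\<^sup>2)" if "a > 0" for a
    using that by (simp add: h_def real_sqrt_mult power2_norm_eq_inner)
  ultimately show ?thesis using st by simp
qed

context root_family
begin

text \<open>
The slopes \<open>u\<close> of the points on the zero set whose radial coordinate is \<open>y\<close>: such a point has first
coordinate \<open>y / sqrt (1 + \<bar>u\<bar>\<^sup>2)\<close>.
\<close>

definition radial_roots :: "complex \<Rightarrow> complex set"
  where "radial_roots y = {u. u \<in> roots (y / of_real (sqrt (1 + (norm u)\<^sup>2)))}"

text \<open>
Near the ray of \<open>y\<close>, on a half disc, the roots form \<open>k\<close> holomorphic branches. Their values lie in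
small balls around the roots over \<open>0\<close>, so Cauchy's estimate bounds \<open>z v'(z)\<close> and the norm of the
corresponding points is strictly increasing along the ray. Thus each branch contributes exactly one slope.
For lower semicontinuity the increasing functions on neighbouring rays are compared by the
intermediate value theorem.
\<close>

lemma varying_configuration_radial_roots:
  assumes 0: "0 \<in> A"
  obtains \<delta> k where "\<delta> > 0" "ball 0 \<delta> \<subseteq> A" "varying_configuration (ball 0 \<delta> - {0}) radial_roots k"
proof -
  obtain \<eta> k where \<eta>: "\<eta> > 0" "ball 0 \<eta> \<subseteq> A"
    and card: "\<And>z. z \<in> ball 0 \<eta> - {0} \<Longrightarrow> card (roots z) = k"
    by (rule card_roots_generically_constant[OF 0]) (rule that)
  obtain d where d: "d > 0" "\<And>p q. p \<in> roots 0 \<Longrightarrow> q \<in> roots 0 \<Longrightarrow> p \<noteq> q \<Longrightarrow> d \<le> dist p q"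
    using finite_separated[OF finite_roots[OF 0]] by (elim exE conjE) auto
  \<comment> \<open>a branch varies by less than \<open>2 e\<close> on a disc of radius \<open>\<bar>z\<bar> / 2\<close>, so \<open>e \<le> 1 / 4\<close> gives
    \<open>\<bar>z v'(z)\<bar> \<le> 4 e \<le> 1\<close>\<close>
  define e where "e = min (1 / 4) (d / 2)"
  have e: "e > 0" "e \<le> 1 / 4" "2 * e \<le> d" using d by (auto simp: e_def)
  have sep: "2 * e \<le> dist p q" if "p \<in> roots 0" "q \<in> roots 0" "p \<noteq> q" for p q
    using d(2)[OF that] e by linarith
  let ?K = "cball c r - (\<Union>p\<in>roots 0. ball p e)"
  have "\<forall>\<^sub>F z in at 0 within A. \<forall>w\<in>?K. F z w \<noteq> 0"
  proof (rule eventually_nonzero_on_compact[OF continuous_on_subset[OF cont] 0])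
    show "compact ?K" by (intro compact_diff compact_cball open_UN ballI open_ball)
    show "F 0 w \<noteq> 0" if "w \<in> ?K" for w
      using that nz[OF 0, of w] e by (cases "dist c w = r") (fastforce simp: roots_def)+
  qed (use r in auto)
  then obtain \<epsilon> where \<epsilon>: "\<epsilon> > 0"
    "\<And>z w. z \<in> A \<Longrightarrow> z \<noteq> 0 \<Longrightarrow> norm z < \<epsilon> \<Longrightarrow> w \<in> ?K \<Longrightarrow> F z w \<noteq> 0"
    unfolding eventually_at dist_norm by (metis diff_zero)
  define \<delta>' where "\<delta>' = min \<eta> \<epsilon>"
  have \<delta>': "\<delta>' > 0" "\<delta>' \<le> \<eta>" "\<delta>' \<le> \<epsilon>" using \<eta> \<epsilon> by (auto simp: \<delta>'_def)
  have cover: "roots z \<subseteq> (\<Union>p\<in>roots 0. ball p e)" if "z \<noteq> 0" "norm z < \<delta>'" for z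
  proof
    fix u assume u: "u \<in> roots z"
    have "z \<in> A" using \<eta>(2) that \<delta>' by auto
    then show "u \<in> (\<Union>p\<in>roots 0. ball p e)"
      using \<epsilon>(2)[of z u] that \<delta>' u by (auto simp: roots_def)
  qed
  \<comment> \<open>a half disc around the ray of \<open>y\<close>, convex and avoiding the origin\<close>
  define W where "W y = {z. norm z < \<delta>' \<and> Re (z * cnj y) > 0}" for y
  have Re_self: "Re (of_real t * y * cnj y) = t * (norm y)\<^sup>2" for t y
    by (simp add: mult.assoc complex_mult_cnj cmod_power2)
  have W: "open (W y)" "convex (W y)" "W y \<subseteq> ball 0 \<eta> - {0}" "W y \<subseteq> A" for y
  proof -
    have eq: "W y = ball 0 \<delta>' \<inter> {z. y \<bullet> z > 0}"
    proof -
      have "Re (z * cnj y) = y \<bullet> z" for z by (simp add: inner_complex_def mult.commute)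
      then show ?thesis by (auto simp: W_def)
    qed
    show "open (W y)" unfolding eq by (rule open_Int[OF open_ball open_halfspace_gt])
    show "convex (W y)" unfolding eq by (rule convex_Int[OF convex_ball convex_halfspace_gt])
    show "W y \<subseteq> ball 0 \<eta> - {0}" using \<delta>' by (auto simp: W_def)
    then show "W y \<subseteq> A" using \<eta> by auto
  qed
  have vcW: "varying_configuration (W y) roots k" for y
    by (rule varying_configuration_roots[OF W(4)]) (rule card[OF subsetD[OF W(3)]])
  have ray: "of_real t * y \<in> W y" if "y \<noteq> 0" "norm y < \<delta>' / 4" "0 < t" "t \<le> 2" for y and t :: real
  proof -
    have "t * norm y \<le> 2 * norm y" using that by (simp add: mult_right_mono)
    moreover have "norm (of_real t * y) = t * norm y" using that by (simp add: norm_mult)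
    ultimately have "norm (of_real t * y) < \<delta>'" using that(2) \<delta>' by linarith
    moreover have "Re (of_real t * y * cnj y) > 0" unfolding Re_self using that by simp
    ultimately show ?thesis unfolding W_def by blast
  qed
  have small: "norm z * norm (deriv v z) \<le> 1"
    if y: "y \<noteq> 0" "norm y < \<delta>' / 4" and t: "0 < t" "t \<le> 2" and z: "z = of_real t * y"
      and v: "continuous_on (W y) v" "\<And>z. z \<in> W y \<Longrightarrow> v z \<in> roots z" for v y z and t :: real
  proof -
    let ?s = "norm z / 2"
    have z0: "norm z > 0" "norm z \<le> 2 * norm y" using y t by (auto simp: z norm_mult mult_right_mono)
    have sub: "cball z ?s \<subseteq> W y"
    proof
      fix x assume x: "x \<in> cball z ?s"
      have "norm x \<le> norm z + norm (x - z)" by (metis norm_triangle_sub add.commute)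
      moreover have "norm (x - z) \<le> ?s" using x by (simp add: dist_norm norm_minus_commute)
      ultimately have "norm x < \<delta>'" using z0(2) y(2) norm_ge_zero[of y] by linarith
      moreover have "\<bar>Re ((x - z) * cnj y)\<bar> \<le> ?s * norm y"
        using x abs_Re_le_cmod[of "(x - z) * cnj y"] mult_right_mono[of "norm (x - z)" ?s "norm y"]
        by (auto simp: dist_norm norm_minus_commute norm_mult)
      moreover have "Re (z * cnj y) = norm z * norm y"
        unfolding z Re_self using t by (simp add: norm_mult power2_eq_square)
      moreover have "Re ((x - z) * cnj y) = Re (x * cnj y) - Re (z * cnj y)"
        by (simp add: algebra_simps)
      moreover have "?s * norm y > 0" "norm z * norm y = 2 * (?s * norm y)" using z0 y by auto
      ultimately have "Re (x * cnj y) > 0" by linarith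
      with \<open>norm x < \<delta>'\<close> show "x \<in> W y" by (simp add: W_def)
    qed
    have hol: "v holomorphic_on W y" by (rule section_holomorphic[OF vcW W(1,4) v])
    have near: "norm (v x - v z) \<le> 2 * e" if "x \<in> cball z ?s" for x
    proof -
      have "dist (v x) (v z) < 2 * e"
      proof (rule connected_in_one_ball[where S = "cball z ?s" and f = v and C = "roots 0"])
        show "v ` cball z ?s \<subseteq> (\<Union>p\<in>roots 0. ball p e)"
        proof
          fix q assume "q \<in> v ` cball z ?s"
          then obtain x where x: "x \<in> cball z ?s" "q = v x" by auto
          then have "x \<in> W y" using sub by auto
          then have "v x \<in> roots x" "x \<noteq> 0" "norm x < \<delta>'"
            using v(2) W(3)[of y] by (auto simp: W_def)
          then show "q \<in> (\<Union>p\<in>roots 0. ball p e)" using cover x by blast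
        qed
      qed (use that sep continuous_on_subset[OF v(1) sub] in auto)
      then show ?thesis by (simp add: dist_norm)
    qed
    have "norm ((deriv ^^ 1) (\<lambda>x. v x - v z) z) \<le> fact 1 * (2 * e) / ?s ^ 1"
    proof (rule Cauchy_inequality)
      have "v holomorphic_on cball z ?s" using hol sub by (rule holomorphic_on_subset)
      then show "(\<lambda>x. v x - v z) holomorphic_on ball z ?s" "continuous_on (cball z ?s) (\<lambda>x. v x - v z)"
        by (auto intro!: holomorphic_intros continuous_intros holomorphic_on_imp_continuous_on
            elim: holomorphic_on_subset)
      show "norm (v x - v z) \<le> 2 * e" if "norm (z - x) = ?s" for x
        using near[of x] that by (simp add: dist_norm)
    qed (use z0 in auto)
    moreover have "deriv (\<lambda>x. v x - v z) z = deriv v z"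
    proof -
      have "z \<in> W y" using ray[of y t] y t \<delta>' by (simp add: z)
      then have "(v has_field_derivative deriv v z) (at z)"
        using hol W(1) holomorphic_derivI by blast
      then have "((\<lambda>x. v x - v z) has_field_derivative deriv v z) (at z)"
        by (auto intro!: derivative_eq_intros)
      then show ?thesis by (rule DERIV_imp_deriv)
    qed
    ultimately have "norm (deriv v z) \<le> 4 * e / norm z" by simp
    then have "norm z * norm (deriv v z) \<le> 4 * e" using z0 by (simp add: field_simps)
    then show ?thesis using e by simp
  qed
  show ?thesis
  proof (rule that[of "\<delta>' / 4" k])
    show "varying_configuration (ball 0 (\<delta>' / 4) - {0}) radial_roots k"
      unfolding varying_configuration_def
    proof (intro ballI)
      fix y :: complex assume "y \<in> ball 0 (\<delta>' / 4) - {0}"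
      then have y: "y \<noteq> 0" "norm y < \<delta>' / 4" by auto
      have ray1: "of_real t * y \<in> W y" if "0 < t" "t \<le> 1" for t
        by (rule ray[OF y]) (use that in auto)
      have yW: "y \<in> W y" using ray[OF y, of 1] by simp
      obtain v where bij: "\<And>x. x \<in> W y \<Longrightarrow> bij_betw (\<lambda>p. v p x) (roots y) (roots x)"
        and vc: "\<And>p. p \<in> roots y \<Longrightarrow> continuous_on (W y) (v p)"
        using varying_configuration_global_sections[OF vcW W(1,2) yW] by blast
      have vr: "v p x \<in> roots x" if "p \<in> roots y" "x \<in> W y" for p x
        using bij[OF that(2)] that(1) by (auto simp: bij_betw_def)
      have vh: "v p holomorphic_on W y" if "p \<in> roots y" for p
        by (rule section_holomorphic[OF vcW W(1,4) vc[OF that] vr[OF that]])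
      define h where "h p x t = t * sqrt (1 + (norm (v p (of_real t * x)))\<^sup>2)" for p x and t :: real
      have mono: "h p y s < h p y t" if p: "p \<in> roots y" and st: "0 < s" "s < t" "t \<le> 2" for p s t
        unfolding h_def
      proof (rule strict_mono_along_ray[OF _ _ st])
        show "v p field_differentiable at (of_real t * y)" if "0 < t" "t \<le> 2" for t
          using vh[OF p] W(1) ray[OF y that] by (simp add: holomorphic_on_imp_differentiable_at)
        show "norm (of_real t * y) * norm (deriv (v p) (of_real t * y)) \<le> 1" if "0 < t" "t \<le> 2" for t
          by (rule small[OF y that refl vc[OF p] vr[OF p]])
      qed
      have hcont: "continuous_on S (h p x)" if "p \<in> roots y" "\<And>t. t \<in> S \<Longrightarrow> of_real t * x \<in> W y" for p x S
        unfolding h_def using that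
        by (intro continuous_intros continuous_on_compose2[OF vc[OF that(1)]]) auto
      have rr: "v p (of_real t * x) \<in> radial_roots x"
        if "p \<in> roots y" "of_real t * x \<in> W y" "h p x t = 1" for p t x
      proof -
        let ?u = "v p (of_real t * x)"
        have conv: "of_real t * x = x / of_real s" if "t = 1 / s" for s by (simp add: that)
        have "t = 1 / sqrt (1 + (norm ?u)\<^sup>2)"
          using that(3) unfolding h_def mult_sqrt_1_plus_norm2_eq_1_iff .
        from conv[OF this] have "of_real t * x = x / of_real (sqrt (1 + (norm ?u)\<^sup>2))" .
        then show ?thesis using vr[OF that(1,2)] by (simp add: radial_roots_def)
      qed
      have ex: "\<exists>t. 0 < t \<and> t \<le> 1 \<and> h p y t = 1" if p: "p \<in> roots y" for p
      proof -
        define M where "M = norm c + r"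
        define a where "a = 1 / sqrt (1 + M\<^sup>2)"
        have M: "M \<ge> 0" using r by (simp add: M_def)
        have sq: "sqrt (1 + M\<^sup>2) \<ge> 1" by simp
        then have sq0: "sqrt (1 + M\<^sup>2) > 0" by linarith
        have a: "0 < a" "a \<le> 1"
          unfolding a_def using sq sq0 by (simp_all only: divide_le_eq_1_pos zero_less_divide_1_iff)
        have "norm (v p (of_real a * y)) \<le> M"
        proof -
          have "dist c (v p (of_real a * y)) < r"
            using vr[OF p ray1[OF a]] by (simp add: roots_def)
          then show ?thesis using norm_triangle_sub[of "v p (of_real a * y)" c]
            by (simp add: M_def dist_norm norm_minus_commute)
        qed
        then have "h p y a \<le> a * sqrt (1 + M\<^sup>2)"
          unfolding h_def using a by (intro mult_left_mono) (auto intro: power_mono)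
        also have "a * sqrt (1 + M\<^sup>2) = 1"
          unfolding a_def by (rule nonzero_eq_divide_eq[THEN iffD1]) (use sq0 in linarith, rule refl)
        finally have "h p y a \<le> 1" .
        moreover have "1 \<le> h p y 1" by (simp add: h_def)
        moreover have "continuous_on {a..1} (h p y)"
        proof (rule hcont[OF p])
          show "of_real t * y \<in> W y" if "t \<in> {a..1}" for t
            by (rule ray1) (use that a in auto)
        qed
        ultimately obtain t where "a \<le> t" "t \<le> 1" "h p y t = 1"
          using IVT'[of "h p y" a 1 1] a by auto
        then show ?thesis using a by (intro exI[of _ t]) auto
      qed
      then obtain \<tau> where \<tau>: "\<And>p. p \<in> roots y \<Longrightarrow> 0 < \<tau> p \<and> \<tau> p \<le> 1 \<and> h p y (\<tau> p) = 1" by metis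
      have uniq: "t = \<tau> p" if "p \<in> roots y" "0 < t" "t \<le> 1" "h p y t = 1" for p t
        using mono[OF that(1), of t "\<tau> p"] mono[OF that(1), of "\<tau> p" t] \<tau>[OF that(1)] that
        by (cases t "\<tau> p" rule: linorder_cases) auto
      define w where "w p = v p (of_real (\<tau> p) * y)" for p
      have \<tau>W: "of_real (\<tau> p) * y \<in> W y" if "p \<in> roots y" for p
        using ray[OF y] \<tau>[OF that] by auto
      have \<tau>_eq: "\<tau> p = 1 / sqrt (1 + (norm (w p))\<^sup>2)" if "p \<in> roots y" for p
        using \<tau>[OF that] unfolding h_def w_def mult_sqrt_1_plus_norm2_eq_1_iff by blast
      have bijw: "bij_betw w (roots y) (radial_roots y)"
      proof (rule bij_betw_imageI)
        show "inj_on w (roots y)"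
        proof (rule inj_onI)
          fix p q assume pq: "p \<in> roots y" "q \<in> roots y" "w p = w q"
          then have "\<tau> p = \<tau> q" using \<tau>_eq by simp
          then show "p = q" using bij[OF \<tau>W[OF pq(1)]] pq by (auto simp: w_def bij_betw_def inj_on_def)
        qed
        show "w ` roots y = radial_roots y"
        proof
          show "w ` roots y \<subseteq> radial_roots y" using rr \<tau> \<tau>W by (auto simp: w_def)
          show "radial_roots y \<subseteq> w ` roots y"
          proof
            fix u assume u: "u \<in> radial_roots y"
            define t where "t = 1 / sqrt (1 + (norm u)\<^sup>2)"
            have "sqrt (1 + (norm u)\<^sup>2) \<ge> 1" by simp
            then have t: "0 < t" "t \<le> 1"
              unfolding t_def using sqrt_1_plus_norm2_gt_0(1)[of u]
              by (simp_all only: divide_le_eq_1_pos zero_less_divide_1_iff)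
            have "u \<in> roots (of_real t * y)" using u by (simp add: radial_roots_def t_def)
            then obtain p where p: "p \<in> roots y" "u = v p (of_real t * y)"
              using bij[OF ray1[OF t]] by (auto simp: bij_betw_def)
            have "h p y t = 1" unfolding h_def p(2)[symmetric] mult_sqrt_1_plus_norm2_eq_1_iff by (rule t_def)
            then have "t = \<tau> p" using uniq p t by blast
            then show "u \<in> w ` roots y" using p by (auto simp: w_def)
          qed
        qed
      qed
      have yA: "y \<in> A" using yW W(4) by auto
      show "finite (radial_roots y) \<and> card (radial_roots y) = k \<and>
          (\<forall>u\<in>radial_roots y. \<forall>\<epsilon>>0. \<forall>\<^sub>F x in at y within ball 0 (\<delta>' / 4) - {0}. \<exists>q\<in>radial_roots x. dist q u < \<epsilon>)"
      proof (intro conjI ballI allI impI)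
        show "finite (radial_roots y)" using bij_betw_finite[OF bijw] finite_roots[OF yA] by simp
        show "card (radial_roots y) = k"
          using bij_betw_same_card[OF bijw] card[of y] y \<delta>' by simp
        fix u and \<epsilon> :: real assume u: "u \<in> radial_roots y" "\<epsilon> > 0"
        then obtain p where p: "p \<in> roots y" "u = w p" using bijw by (auto simp: bij_betw_def)
        have vcp: "isCont (v p) (of_real (\<tau> p) * y)"
          using vc[OF p(1)] W(1) \<tau>W[OF p(1)] continuous_on_eq_continuous_at by blast
        have lim: "((\<lambda>q. of_real (fst q) * snd q) \<longlongrightarrow> of_real (\<tau> p) * y) (nhds (\<tau> p, y))"
        proof -
          have "isCont (\<lambda>q. of_real (fst q) * snd q) (\<tau> p, y)" by (intro continuous_intros)
          from isCont_nhds[OF this] show ?thesis by simp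
        qed
        have "((\<lambda>q. v p (of_real (fst q) * snd q)) \<longlongrightarrow> u) (nhds (\<tau> p, y))"
          unfolding p(2) w_def
        proof (rule filterlim_compose[of "v p"])
          show "filterlim (v p) (nhds (v p (of_real (\<tau> p) * y))) (nhds (of_real (\<tau> p) * y))"
            using vcp by (rule isCont_nhds)
          show "((\<lambda>q. of_real (fst q) * snd q) \<longlongrightarrow> of_real (\<tau> p) * y) (nhds (\<tau> p, y))"
            by (rule lim)
        qed
        then have "\<forall>\<^sub>F q in nhds (\<tau> p, y). dist (v p (of_real (fst q) * snd q)) u < \<epsilon>"
          using u(2) by (rule tendstoD)
        moreover have "\<forall>\<^sub>F q in nhds (\<tau> p, y). of_real (fst q) * snd q \<in> W y"
          by (rule topological_tendstoD[OF lim]) (use W(1) \<tau>W[OF p(1)] in auto)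
        ultimately have "\<forall>\<^sub>F q in nhds (\<tau> p, y). dist (v p (of_real (fst q) * snd q)) u < \<epsilon> \<and> of_real (fst q) * snd q \<in> W y"
          by (rule eventually_conj)
        then obtain P Q where P: "eventually P (nhds (\<tau> p))" and Q: "eventually Q (nhds y)"
          and PQ: "\<And>t x. P t \<Longrightarrow> Q x \<Longrightarrow> dist (v p (of_real t * x)) u < \<epsilon> \<and> of_real t * x \<in> W y"
          unfolding nhds_prod eventually_prod_filter by auto
        obtain b where b: "b > 0" "\<And>t. dist t (\<tau> p) < b \<Longrightarrow> P t"
          using P unfolding eventually_nhds_metric by auto
        \<comment> \<open>\<open>t2\<close> may exceed \<open>1\<close>, since \<open>\<tau> p = 1\<close> for the slope \<open>0\<close>; the estimates hold up to \<open>2\<close>\<close>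
        define t1 where "t1 = \<tau> p - min b (\<tau> p) / 2"
        define t2 where "t2 = \<tau> p + min b 1 / 2"
        have \<tau>p: "0 < \<tau> p" "\<tau> p \<le> 1" "h p y (\<tau> p) = 1" using \<tau>[OF p(1)] by auto
        have t12: "0 < t1" "t1 < \<tau> p" "\<tau> p < t2" "t2 \<le> 2" using b \<tau>p by (auto simp: t1_def t2_def min_def)
        have "\<tau> p - b / 2 \<le> t1" "t2 \<le> \<tau> p + b / 2" by (simp_all add: t1_def t2_def)
        then have "dist t (\<tau> p) < b" if "t1 \<le> t" "t \<le> t2" for t
          unfolding dist_real_def using that b(1) by linarith
        then have Pt: "P t" if "t1 \<le> t" "t \<le> t2" for t using b(2) that by blast
        have ht: "isCont (\<lambda>x. h p x t) y" if "0 < t" "t \<le> 2" for t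
        proof -
          have "isCont (v p) (of_real t * y)"
            using vc[OF p(1)] W(1) ray[OF y that] continuous_on_eq_continuous_at by blast
          moreover have "isCont (\<lambda>x. of_real t * x) y" by (intro continuous_intros)
          ultimately have "isCont (\<lambda>x. v p (of_real t * x)) y" by (rule isCont_o2[rotated])
          then show ?thesis unfolding h_def by (intro continuous_intros)
        qed
        have "h p y t1 < 1" using mono[OF p(1), of t1 "\<tau> p"] t12 \<tau>p by auto
        then have "\<forall>\<^sub>F x in nhds y. h p x t1 < 1"
          using isCont_nhds[OF ht[of t1]] t12 \<tau>p by (intro order_tendstoD(2)[where y = "h p y t1"]) auto
        moreover have "1 < h p y t2" using mono[OF p(1), of "\<tau> p" t2] t12 \<tau>p by auto
        then have "\<forall>\<^sub>F x in nhds y. h p x t2 > 1"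
          using isCont_nhds[OF ht[of t2]] t12 \<tau>p by (intro order_tendstoD(1)[where y = "h p y t2"]) auto
        ultimately have "\<forall>\<^sub>F x in nhds y. \<exists>q\<in>radial_roots x. dist q u < \<epsilon>"
          using Q
        proof eventually_elim
          case (elim x)
          have "continuous_on {t1..t2} (h p x)"
            by (rule hcont[OF p(1)]) (use PQ Pt elim in auto)
          then obtain t where t: "t1 \<le> t" "t \<le> t2" "h p x t = 1"
            using IVT'[of "h p x" t1 1 t2] elim t12 by auto
          have "dist (v p (of_real t * x)) u < \<epsilon> \<and> of_real t * x \<in> W y"
            using PQ Pt t elim by auto
          then show ?case using rr[OF p(1), of t x] t by blast
        qed
        then show "\<forall>\<^sub>F x in at y within ball 0 (\<delta>' / 4) - {0}. \<exists>q\<in>radial_roots x. dist q u < \<epsilon>"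
          by (auto simp: eventually_at_filter elim: eventually_mono)
      qed
    qed
    show "\<delta>' / 4 > 0" using \<delta>' by simp
    have "ball (0 :: complex) (\<delta>' / 4) \<subseteq> ball 0 \<eta>" using \<delta>' by (intro subset_ball) simp
    then show "ball 0 (\<delta>' / 4) \<subseteq> A" using \<eta>(2) by (rule order_trans)
  qed
qed

end

section \<open>Blowing up a germ\<close>

lemma holomorphic2_compose:
  assumes f: "holomorphic2_on f U" and S: "open S"
    and p: "p holomorphic_on S" and q: "q holomorphic_on S" and U: "\<And>t. t \<in> S \<Longrightarrow> (p t, q t) \<in> U"
  shows "(\<lambda>t. f (p t, q t)) holomorphic_on S"
  unfolding holomorphic_on_open[OF S]
proof
  fix t assume t: "t \<in> S"
  obtain a b where ab: "(f has_derivative (\<lambda>(h, k). a * h + b * k)) (at (p t, q t))"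
    using f U[OF t] unfolding holomorphic2_on_def by blast
  have "(p has_derivative (\<lambda>h. deriv p t * h)) (at t)" "(q has_derivative (\<lambda>h. deriv q t * h)) (at t)"
    using holomorphic_derivI[OF p S t] holomorphic_derivI[OF q S t] by (simp_all add: has_field_derivative_def)
  then have "((\<lambda>t. (p t, q t)) has_derivative (\<lambda>h. (deriv p t * h, deriv q t * h))) (at t)"
    by (rule has_derivative_Pair)
  from has_derivative_compose[OF this ab]
  have "((\<lambda>t. f (p t, q t)) has_derivative (\<lambda>h. (a * deriv p t + b * deriv q t) * h)) (at t)"
    by (simp add: algebra_simps)
  then show "\<exists>f'. ((\<lambda>t. f (p t, q t)) has_field_derivative f') (at t)"
    unfolding has_field_derivative_def by blast
qed

lemma holomorphic2_continuous_on: "holomorphic2_on f U \<Longrightarrow> continuous_on U f"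
  unfolding holomorphic2_on_def
  by (meson continuous_at_imp_continuous_on has_derivative_continuous)

definition cscale :: "complex \<Rightarrow> complex \<times> complex \<Rightarrow> complex \<times> complex"
  where "cscale t v = (t * fst v, t * snd v)"

lemma norm_cscale [simp]: "norm (cscale t v) = norm t * norm v"
proof -
  have "norm (cscale t v) = sqrt ((norm t)\<^sup>2 * ((norm (fst v))\<^sup>2 + (norm (snd v))\<^sup>2))"
    by (simp add: cscale_def norm_Pair norm_mult power_mult_distrib distrib_left)
  also have "\<dots> = norm t * norm v"
    by (cases v) (simp add: norm_Pair real_sqrt_mult)
  finally show ?thesis .
qed

lemma cscale_cscale: "cscale s (cscale t v) = cscale (s * t) v"
  by (simp add: cscale_def mult.assoc)

text \<open>
The identity principle in the form needed for quotients by powers of \<open>t\<close>: these are determined by \<open>f\<close>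
only for \<open>t \<noteq> 0\<close>.
\<close>

lemma holomorphic_eq_at_puncture:
  assumes g: "g holomorphic_on S" "h holomorphic_on S" and S: "open S" "0 \<in> S"
    and eq: "\<And>t. t \<in> S \<Longrightarrow> t \<noteq> (0 :: complex) \<Longrightarrow> g t = h t"
  shows "g 0 = h 0"
proof -
  have lim: "(f \<longlongrightarrow> f 0) (at 0)" if "f holomorphic_on S" for f :: "complex \<Rightarrow> complex"
    using holomorphic_on_imp_continuous_on[OF that] S
    by (simp add: continuous_on_eq_continuous_at continuous_at)
  have "\<forall>\<^sub>F t in at 0. g t = h t"
    using eventually_at_in_open[OF S] by (rule eventually_mono) (use eq in auto)
  then have "(h \<longlongrightarrow> g 0) (at 0)" using lim[OF g(1)] by (rule Lim_transform_eventually[rotated])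
  then show ?thesis using lim[OF g(2)] by (rule tendsto_unique[rotated]) simp
qed

locale holomorphic_germ =
  fixes f :: "complex \<times> complex \<Rightarrow> complex" and R :: real
  assumes R: "R > 0" and hol: "holomorphic2_on f (ball 0 R)" and f0: "f 0 = 0"
    and nonzero: "\<exists>p\<in>ball 0 R. f p \<noteq> 0"
begin

definition line :: "complex \<times> complex \<Rightarrow> complex set"
  where "line v = {t. norm t * norm v < R}"

lemma line: "open (line v)" "connected (line v)" "0 \<in> line v"
proof -
  show "open (line v)" unfolding line_def by (intro open_Collect_less continuous_intros)
  have "line v = (if v = 0 then UNIV else ball 0 (R / norm v))"
    using R by (auto simp: line_def field_simps)
  then show "connected (line v)" by (simp add: connected_ball connected_UNIV)
  show "0 \<in> line v" using R by (simp add: line_def)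
qed

lemma restrict_line_holomorphic: "(\<lambda>t. f (cscale t v)) holomorphic_on line v"
  unfolding cscale_def
proof (rule holomorphic2_compose[OF hol line(1)])
  show "(t * fst v, t * snd v) \<in> ball 0 R" if "t \<in> line v" for t
    using that norm_cscale[of t v] by (simp add: line_def cscale_def)
qed (auto intro!: holomorphic_intros)

text \<open>
The germ vanishes to order at least \<open>m\<close> along every complex line through the origin. The
function \<open>G v\<close> is the quotient by \<open>t\<^sup>m\<close> on the line in direction \<open>v\<close>, including its value at \<open>t = 0\<close>, which as
a function of \<open>v\<close> is the part of degree \<open>m\<close> in the expansion of \<open>f\<close>.
\<close>

definition line_quotients :: "nat \<Rightarrow> (complex \<times> complex \<Rightarrow> complex \<Rightarrow> complex) \<Rightarrow> bool"
  where "line_quotients m G \<longleftrightarrow>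
    (\<forall>v. G v holomorphic_on line v \<and> (\<forall>t\<in>line v. f (cscale t v) = t ^ m * G v t))"

lemma line_quotientsD:
  assumes "line_quotients m G"
  shows "G v holomorphic_on line v" "t \<in> line v \<Longrightarrow> f (cscale t v) = t ^ m * G v t"
  using assms unfolding line_quotients_def by blast+

lemma line_quotients_scale:
  assumes G: "line_quotients m G" and t: "t \<in> line (cscale c v)"
  shows "G (cscale c v) t = c ^ m * G v (c * t)"
proof -
  let ?S = "line (cscale c v)"
  have mem: "c * t \<in> line v" if "t \<in> ?S" for t using that by (simp add: line_def norm_mult mult_ac)
  have eq: "G (cscale c v) t = c ^ m * G v (c * t)" if "t \<in> ?S" "t \<noteq> 0" for t
  proof -
    have "t ^ m * G (cscale c v) t = f (cscale t (cscale c v))"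
      using line_quotientsD(2)[OF G that(1)] by simp
    also have "\<dots> = (c * t) ^ m * G v (c * t)"
      using line_quotientsD(2)[OF G mem[OF that(1)]] by (simp add: cscale_cscale mult.commute)
    finally show ?thesis using that(2) by (simp add: power_mult_distrib)
  qed
  show ?thesis
  proof (cases "t = 0")
    case True
    have "(\<lambda>t. G v (c * t)) holomorphic_on ?S"
      using line_quotientsD(1)[OF G] mem
      by (intro holomorphic_on_compose_gen[of "\<lambda>t. c * t" _ "G v" "line v", unfolded o_def])
        (auto intro!: holomorphic_intros)
    then have "(\<lambda>t. c ^ m * G v (c * t)) holomorphic_on ?S" by (intro holomorphic_intros)
    moreover have "G (cscale c v) holomorphic_on ?S" by (rule line_quotientsD(1)[OF G])
    ultimately have "G (cscale c v) 0 = c ^ m * G v (c * 0)"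
      using holomorphic_eq_at_puncture[OF _ _ line(1,3), of "G (cscale c v)" "cscale c v" "\<lambda>t. c ^ m * G v (c * t)"] eq
      by blast
    then show ?thesis using True by simp
  qed (use eq t in auto)
qed

lemma line_quotients_bounded:
  obtains N where "\<And>m G. line_quotients m G \<Longrightarrow> m \<le> N"
proof -
  obtain p where p: "p \<in> ball 0 R" "f p \<noteq> 0" using nonzero by blast
  let ?\<phi> = "\<lambda>t. f (cscale t p)"
  have 1: "cscale 1 p = p" "cscale 0 p = 0" by (simp_all add: cscale_def zero_prod_def)
  obtain k n r where k: "k > 0" "r > 0" "ball 0 r \<subseteq> line p"
    "\<And>w. w \<in> ball 0 r \<Longrightarrow> k * norm (w - 0) ^ n \<le> norm (?\<phi> w - ?\<phi> 0)"
  proof (rule holomorphic_lower_bound_difference[OF restrict_line_holomorphic line])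
    show "1 \<in> line p" using p by (simp add: line_def)
  qed (use p 1 f0 in auto)
  show ?thesis
  proof (rule that[of n], rule ccontr)
    fix m G assume G: "line_quotients m G" and "\<not> m \<le> n"
    then obtain j where m: "m = n + Suc j" using less_imp_Suc_add by (metis add_Suc_right not_le)
    have "\<forall>\<^sub>F t in at 0. t \<in> ball 0 r - {0 :: complex}"
      using k by (intro eventually_at_in_open) auto
    then have "\<forall>\<^sub>F t in at 0. k \<le> norm (t * (t ^ j * G p t))"
    proof (rule eventually_mono)
      fix t :: complex assume t: "t \<in> ball 0 r - {0}"
      have "k * norm t ^ n \<le> norm (f (cscale t p))" using k(4)[of t] t 1 f0 by simp
      also have "f (cscale t p) = t ^ m * G p t" 
        by (rule line_quotientsD(2)[OF G]) (use t k(3) in blast)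
      finally have "k * norm t ^ n \<le> norm (t * (t ^ j * G p t)) * norm t ^ n"
        by (simp add: m power_add norm_mult norm_power mult_ac)
      then show "k \<le> norm (t * (t ^ j * G p t))" using t by simp
    qed
    moreover have "((\<lambda>t. norm (t * (t ^ j * G p t))) \<longlongrightarrow> norm (0 * (0 ^ j * G p 0))) (at 0)"
    proof -
      have "isCont (G p) 0"
        using line_quotientsD(1)[OF G] line holomorphic_on_imp_continuous_on continuous_on_eq_continuous_at
        by blast
      then have "isCont (\<lambda>t. norm (t * (t ^ j * G p t))) 0" by (intro continuous_intros)
      then show ?thesis by (simp only: continuous_at)
    qed
    ultimately have "k \<le> norm (0 * (0 ^ j * G p 0))"
      by (intro tendsto_lowerbound) auto
    then show False using k by simp
  qed
qed

text \<open>
The order \<open>m\<close> is chosen maximal. If all quotients vanished at \<open>0\<close> they could be divided by \<open>t\<close> once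
more. A direction in which the quotient does not vanish is not tangent to the curve.
\<close>

lemma multiplicity:
  obtains m G v where "line_quotients m G" "norm v = 1" "G v 0 \<noteq> 0"
proof -
  obtain N where N: "\<And>m G. line_quotients m G \<Longrightarrow> m \<le> N" by (rule line_quotients_bounded) (rule that)
  have "line_quotients 0 (\<lambda>v t. f (cscale t v))"
    by (simp add: line_quotients_def restrict_line_holomorphic)
  then have ex: "\<exists>m G. line_quotients m G" by blast
  define m where "m = (GREATEST m. \<exists>G. line_quotients m G)"
  have "\<exists>G. line_quotients m G" unfolding m_def
    using ex N by (intro GreatestI_ex_nat[of "\<lambda>m. \<exists>G. line_quotients m G" N]) auto
  then obtain G where G: "line_quotients m G" by blast
  have max: "m' \<le> m" if "line_quotients m' G'" for m' G'
    unfolding m_def using that N by (intro Greatest_le_nat[of "\<lambda>m. \<exists>G. line_quotients m G" _ N]) auto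
  have "\<exists>v. G v 0 \<noteq> 0"
  proof (rule ccontr)
    assume "\<not> ?thesis"
    then have 0: "G v 0 = 0" for v by blast
    have "line_quotients (Suc m) (\<lambda>v t. if t = 0 then deriv (G v) 0 else (G v t - G v 0) / (t - 0))"
      unfolding line_quotients_def
    proof (intro allI conjI ballI)
      fix v
      show "(\<lambda>t. if t = 0 then deriv (G v) 0 else (G v t - G v 0) / (t - 0)) holomorphic_on line v"
        by (rule pole_lemma[OF line_quotientsD(1)[OF G]]) (simp add: interior_open line)
      fix t assume "t \<in> line v"
      then show "f (cscale t v) = t ^ Suc m * (if t = 0 then deriv (G v) 0 else (G v t - G v 0) / (t - 0))"
        using line_quotientsD(2)[OF G, of t v] 0 f0 by (auto simp: cscale_def zero_prod_def[symmetric])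
    qed
    from max[OF this] show False by simp
  qed
  then obtain v where v: "G v 0 \<noteq> 0" by blast
  have v0: "v \<noteq> 0"
  proof
    assume v_0: "v = 0"
    have "f (cscale t v) = 0" for t using f0 by (simp add: v_0 cscale_def zero_prod_def)
    then have "G v t = 0" if "t \<in> line v" "t \<noteq> 0" for t using line_quotientsD(2)[OF G that(1)] that(2) by auto
    then have "G v 0 = (\<lambda>t. 0) 0"
      using line_quotientsD(1)[OF G] line by (intro holomorphic_eq_at_puncture[of "G v" "line v" "\<lambda>t. 0"]) auto
    then show False using v by simp
  qed
  let ?w = "cscale (1 / of_real (norm v)) v"
  have "norm ?w = 1" using v0 by (simp add: norm_divide)
  moreover have "G ?w 0 \<noteq> 0" using line_quotients_scale[OF G line(3)] v v0 by simp
  ultimately show ?thesis using G that by blast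
qed

end

context holomorphic_germ
begin

lemma line_quotients_continuous:
  assumes G: "line_quotients m G" and V: "V > 0"
  shows "continuous_on (ball 0 (R / V) \<times> {v. norm v \<le> V}) (\<lambda>(t, v). G v t)"
proof -
  have line: "t \<in> line v" if "t \<in> ball 0 (R / V)" "norm v \<le> V" for t v
  proof -
    have "norm t * norm v \<le> norm t * V" using that by (intro mult_left_mono) auto
    also have "\<dots> < R" using that V by (simp add: field_simps)
    finally show ?thesis by (simp add: line_def)
  qed
  show ?thesis
  proof (rule removable_continuous_on_Times[where G = "\<lambda>t v. G v t" and a = 0])
    let ?S = "(ball 0 (R / V) - {0 :: complex}) \<times> {v :: complex \<times> complex. norm v \<le> V}"
    have "continuous_on ?S (\<lambda>q. f (cscale (fst q) (snd q)))"
    proof (rule continuous_on_compose2[OF holomorphic2_continuous_on[OF hol]])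
      show "continuous_on ?S (\<lambda>q. cscale (fst q) (snd q))"
        unfolding cscale_def by (intro continuous_intros)
      show "(\<lambda>q. cscale (fst q) (snd q)) ` ?S \<subseteq> ball 0 R" using line by (auto simp: line_def)
    qed
    then have "continuous_on ?S (\<lambda>q. f (cscale (fst q) (snd q)) / fst q ^ m)"
      by (intro continuous_intros) auto
    then show "continuous_on ?S (\<lambda>(t, v). G v t)"
    proof (rule continuous_on_eq)
      fix q assume q: "q \<in> ?S"
      then have "f (cscale (fst q) (snd q)) = fst q ^ m * G (snd q) (fst q)"
        by (intro line_quotientsD(2)[OF G] line) auto
      then show "f (cscale (fst q) (snd q)) / fst q ^ m = (\<lambda>(t, v). G v t) q"
        using q by (auto simp: case_prod_beta)
    qed
    show "(\<lambda>t. G v t) holomorphic_on ball 0 (R / V)" if "v \<in> {v. norm v \<le> V}" for v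
    proof (rule holomorphic_on_subset[OF line_quotientsD(1)[OF G]])
      show "ball 0 (R / V) \<subseteq> line v" using line[of _ v] that by blast
    qed
  qed simp
qed

text \<open>
The vertical axis is not tangent to the curve, so a whole cone around it meets the curve only at the
origin.
\<close>

lemma nonzero_near_axis:
  assumes G: "line_quotients m G" and G01: "G (0, 1) 0 \<noteq> 0"
  obtains \<kappa> where "0 < \<kappa>" "\<kappa> < 1" "\<kappa> < R / 2"
    "\<And>t x. norm t < \<kappa> \<Longrightarrow> norm x < \<kappa> \<Longrightarrow> G (x, 1) t \<noteq> 0"
    "\<And>z w. 0 < norm w \<Longrightarrow> norm w < \<kappa> \<Longrightarrow> norm z < \<kappa> * norm w \<Longrightarrow> f (z, w) \<noteq> 0"
proof -
  let ?S = "ball (0 :: complex) (R / 2) \<times> {v :: complex \<times> complex. norm v \<le> 2}"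
  have "continuous_on ?S (\<lambda>(t, v). G v t)" by (rule line_quotients_continuous[OF G]) simp
  moreover have "(0, (0, 1)) \<in> ?S" using R by (simp add: norm_Pair)
  ultimately obtain e where e: "e > 0" "\<And>q. q \<in> ?S \<Longrightarrow> dist (0, (0, 1)) q < e \<Longrightarrow> (\<lambda>(t, v). G v t) q \<noteq> 0"
    using continuous_on_avoid[of ?S "\<lambda>(t, v). G v t" "(0, (0, 1))" 0] G01 by auto
  define \<kappa> where "\<kappa> = min (min (1 / 2) (R / 4)) (e / 2)"
  have \<kappa>: "0 < \<kappa>" "\<kappa> \<le> 1 / 2" "\<kappa> \<le> R / 4" "\<kappa> \<le> e / 2" using R e by (auto simp: \<kappa>_def)
  have G1: "G (x, 1) t \<noteq> 0" if "norm t < \<kappa>" "norm x < \<kappa>" for t x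
  proof -
    have "norm (x, 1 :: complex) \<le> norm x + norm (1 :: complex)" by (rule norm_Pair_le)
    then have "(t, (x, 1)) \<in> ?S" using that \<kappa> R by auto
    moreover have "dist (0, (0, 1)) (t, (x, 1 :: complex)) \<le> norm t + norm x"
      using norm_Pair_le[of t "(x, 0 :: complex)"] by (simp add: dist_norm norm_Pair)
    then have "dist (0, (0, 1)) (t, (x, 1 :: complex)) < e" using that \<kappa> by linarith
    ultimately show ?thesis using e(2)[of "(t, (x, 1))"] by simp
  qed
  show ?thesis
  proof (rule that[OF _ _ _ G1])
    fix z w :: complex assume w: "0 < norm w" "norm w < \<kappa>" "norm z < \<kappa> * norm w"
    have x: "norm (z / w) < \<kappa>" using w by (simp add: norm_divide field_simps)
    have "norm (z / w, 1 :: complex) \<le> norm (z / w) + norm (1 :: complex)" by (rule norm_Pair_le)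
    then have n2: "norm (z / w, 1 :: complex) \<le> 2" using x \<kappa> by simp
    have "norm w * norm (z / w, 1 :: complex) \<le> norm w * 2" using n2 by (intro mult_left_mono) auto
    also have "\<dots> < R" using w \<kappa> R by linarith
    finally have "w \<in> line (z / w, 1)" by (simp add: line_def)
    then have "f (cscale w (z / w, 1)) = w ^ m * G (z / w, 1) w" by (rule line_quotientsD(2)[OF G])
    moreover have "cscale w (z / w, 1) = (z, w)" using w by (simp add: cscale_def)
    moreover have "G (z / w, 1) w \<noteq> 0" by (rule G1[OF w(2) x])
    ultimately show "f (z, w) \<noteq> 0" using w by simp
  qed (use \<kappa> R in auto)
qed

text \<open>
The strict transform of the curve under the blow-up of the origin is the zero set of
\<open>F z u = f (z, z u) / z\<^sup>m\<close>. By the choice of \<open>K\<close> all slopes of points on the curve near the origin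
have absolute value less than \<open>K\<close>, so that \<open>F\<close> is a family of functions on the disc of radius \<open>K + 1\<close> without
zeros on the circle of radius \<open>K\<close>.
\<close>

lemma conic_near_0:
  assumes G: "line_quotients m G" and G01: "G (0, 1) 0 \<noteq> 0"
    and C: "\<forall>\<^sub>F p in nhds 0. p \<in> C \<longleftrightarrow> f p = 0"
  obtains \<epsilon>\<^sub>0 where "\<epsilon>\<^sub>0 > 0" "\<And>\<epsilon>. 0 < \<epsilon> \<Longrightarrow> \<epsilon> < \<epsilon>\<^sub>0 \<Longrightarrow> conic_at \<epsilon> C"
proof -
  obtain \<kappa> where \<kappa>: "0 < \<kappa>" "\<kappa> < 1" "\<kappa> < R / 2"
    and G1: "\<And>t x. norm t < \<kappa> \<Longrightarrow> norm x < \<kappa> \<Longrightarrow> G (x, 1) t \<noteq> 0"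
    and axis: "\<And>z w. 0 < norm w \<Longrightarrow> norm w < \<kappa> \<Longrightarrow> norm z < \<kappa> * norm w \<Longrightarrow> f (z, w) \<noteq> 0"
    by (rule nonzero_near_axis[OF G G01]) (rule that)
  obtain s where s: "s > 0" "\<And>p. norm p < s \<Longrightarrow> p \<in> C \<longleftrightarrow> f p = 0"
    using C unfolding eventually_nhds_metric by auto
  \<comment> \<open>slopes beyond \<open>1 / \<kappa>\<close> do not occur on the curve; the factor \<open>2\<close> makes this strict on the circle\<close>
  define K where "K = 2 / \<kappa>"
  have K: "K > 2" "\<kappa> * K = 2" using \<kappa> by (auto simp: K_def field_simps)
  define \<rho> where "\<rho> = min (R / (K + 2)) (\<kappa> / (K + 1))"
  have \<rho>: "0 < \<rho>" "\<rho> \<le> R / (K + 2)" using R \<kappa> K by (simp_all add: \<rho>_def)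
  have "\<rho> \<le> \<kappa> / (K + 1)" by (simp add: \<rho>_def)
  then have \<rho>': "\<rho> * (K + 1) \<le> \<kappa>" using K by (simp add: pos_le_divide_eq)
  have n1: "norm (1 :: complex, u :: complex) \<le> K + 2" if "norm u < K + 1" for u
    using norm_Pair_le[of "1 :: complex" u] that by simp
  have line1: "z \<in> line (1, u)" if "norm z < \<rho>" "norm u < K + 1" for z u
  proof -
    have "norm z < R / (K + 2)" using that(1) \<rho>(2) by linarith
    then have zK: "norm z * (K + 2) < R" using K by (simp add: pos_less_divide_eq)
    have "norm z * norm (1 :: complex, u) \<le> norm z * (K + 2)"
      using n1[OF that(2)] by (intro mult_left_mono) auto
    also note zK
    finally show ?thesis by (simp add: line_def)
  qed
  have cs: "cscale z (1, u) = (z, z * u)" for z u by (simp add: cscale_def)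
  have fG: "f (z, z * u) = z ^ m * G (1, u) z" if "norm z < \<rho>" "norm u < K + 1" for z u
    using line_quotientsD(2)[OF G line1[OF that]] by (simp add: cs)
  define F where "F z u = G (1, u) z" for z u
  have contF: "continuous_on (ball 0 \<rho> \<times> ball 0 (K + 1)) (\<lambda>(z, u). F z u)"
  proof -
    have "continuous_on (ball 0 (R / (K + 2)) \<times> {v. norm v \<le> K + 2}) (\<lambda>(t, v). G v t)"
      by (rule line_quotients_continuous[OF G]) (use K in simp)
    then have "continuous_on (ball 0 \<rho> \<times> ball 0 (K + 1)) (\<lambda>q. (\<lambda>(t, v). G v t) (fst q, (1, snd q)))"
      by (rule continuous_on_compose2) (use \<rho>(2) n1 in \<open>auto intro!: continuous_intros\<close>)
    then show ?thesis by (simp add: F_def case_prod_beta)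
  qed
  have hol1: "(\<lambda>z. F z u) holomorphic_on ball 0 \<rho>" if "u \<in> ball 0 (K + 1)" for u
    unfolding F_def by (rule holomorphic_on_subset[OF line_quotientsD(1)[OF G]]) (use line1 that in auto)
  have hol2': "F z holomorphic_on ball 0 (K + 1)" if z: "z \<in> ball 0 \<rho> - {0}" for z
  proof -
    have "(\<lambda>u. f (z, z * u)) holomorphic_on ball 0 (K + 1)"
    proof (rule holomorphic2_compose[OF hol])
      show "(z, z * u) \<in> ball 0 R" if "u \<in> ball 0 (K + 1)" for u
        using line1[of z u] norm_cscale[of z "(1, u)"] z that by (simp add: cs line_def)
    qed (auto intro!: holomorphic_intros)
    then have "(\<lambda>u. f (z, z * u) / z ^ m) holomorphic_on ball 0 (K + 1)"
      using z by (intro holomorphic_intros) auto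
    then show ?thesis by (rule holomorphic_transform) (use fG z in \<open>auto simp: F_def\<close>)
  qed
  have hol2: "F z holomorphic_on ball 0 (K + 1)" if z: "z \<in> ball 0 \<rho>" for z
  proof (cases "z = 0")
    case True
    have "F 0 holomorphic_on ball 0 (K + 1)"
      by (rule removable_holomorphic_param[OF contF open_ball _ open_ball hol1 hol2']) (use \<rho> in auto)
    then show ?thesis using True by simp
  qed (use hol2' z in auto)
  have far: "f (z, z * u) \<noteq> 0" if "z \<noteq> 0" "K \<le> norm u" "norm (z * u) < \<kappa>" for z u
  proof (rule axis)
    have "u \<noteq> 0" using that K by auto
    then show "0 < norm (z * u)" using that by simp
    have "1 < \<kappa> * norm u" using that(2) mult_left_mono[of K "norm u" \<kappa>] \<kappa> K by linarith
    then have "norm z * 1 < norm z * (\<kappa> * norm u)" using that(1) by (intro mult_strict_left_mono) auto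
    then show "norm z < \<kappa> * norm (z * u)" by (simp add: norm_mult mult_ac)
  qed (rule that)
  interpret rf: root_family F "ball 0 \<rho>" 0 K "K + 1"
  proof
    fix z u assume z: "z \<in> ball (0 :: complex) \<rho>" and u: "u \<in> sphere (0 :: complex) K"
    show "F z u \<noteq> 0"
    proof (cases "z = 0")
      case True
      have u0: "u \<noteq> 0" using u K by auto
      have "cscale u (1 / u, 1) = (1, u)" using u0 by (simp add: cscale_def)
      then have "F 0 u = u ^ m * G (1 / u, 1) 0"
        using line_quotients_scale[OF G line(3), of u "(1 / u, 1)"] by (simp add: F_def)
      moreover have "norm (1 / u) < \<kappa>" using u \<kappa> by (simp add: norm_divide K_def)
      then have "G (1 / u, 1) 0 \<noteq> 0" using G1 \<kappa> by simp
      ultimately show ?thesis using True u0 by simp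
    next
      case False
      have "norm (z * u) < \<kappa>"
      proof -
        have "norm z * K < \<rho> * K" using z K by (intro mult_strict_right_mono) auto
        also have "\<dots> \<le> \<kappa>" using \<rho>(1) \<rho>' by (simp add: distrib_left)
        finally show ?thesis using u by (simp add: norm_mult)
      qed
      then have "f (z, z * u) \<noteq> 0" using far[of z u] False u by simp
      then show ?thesis using fG[of z u] z u by (auto simp: F_def)
    qed
  qed (use K contF hol1 hol2 in auto)
  obtain \<delta> k where \<delta>: "\<delta> > 0" "ball 0 \<delta> \<subseteq> ball (0 :: complex) \<rho>"
    and vc: "varying_configuration (ball 0 \<delta> - {0}) rf.radial_roots k"
    by (rule rf.varying_configuration_radial_roots) (use \<rho> that in auto)
  show ?thesis
  proof (rule that[of "min \<delta> (min \<kappa> s)"])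
    fix \<epsilon> assume \<epsilon>: "0 < \<epsilon>" "\<epsilon> < min \<delta> (min \<kappa> s)"
    interpret rc: radial_configuration rf.radial_roots \<epsilon> K k
    proof
      show "varying_configuration (cball 0 \<epsilon> - {0}) rf.radial_roots k"
        by (rule varying_configuration_subset[OF vc]) (use \<epsilon> in auto)
    qed (use \<epsilon> in \<open>auto simp: rf.radial_roots_def rf.roots_def\<close>)
    show "conic_at \<epsilon> C"
    proof (rule rc.conic_structure[of C])
      show "0 \<in> C" using s(2)[of 0] s(1) f0 by simp
      show "(0, w) \<notin> C" if "w \<noteq> 0" "norm w \<le> \<epsilon>" for w
        using s(2)[of "(0, w)"] axis[of w 0] that \<epsilon> \<kappa> by (simp add: norm_Pair)
      show "chart y u \<in> C \<longleftrightarrow> u \<in> rf.radial_roots y" if y: "y \<in> cball 0 \<epsilon> - {0}" for y u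
      proof -
        define z where "z = y / of_real (sqrt (1 + (norm u)\<^sup>2))"
        have ch: "chart y u = (z, z * u)" by (simp add: chart_def z_def)
        have z0: "z \<noteq> 0" using fst_chart_nonzero[of y u] y by (simp add: ch)
        have nc: "norm (z, z * u) = norm y" using norm_chart[of y u] by (simp add: ch)
        have "norm (chart y u) < s" using y \<epsilon> by simp
        then have "chart y u \<in> C \<longleftrightarrow> f (z, z * u) = 0" using s(2) ch by metis
        also have "\<dots> \<longleftrightarrow> u \<in> rf.roots z"
        proof (cases "norm u < K")
          case True
          have "norm z \<le> norm y" using norm_fst_le[of z "z * u"] nc by simp
          then have "z \<in> ball 0 \<delta>" using y \<epsilon> by simp
          then have "norm z < \<rho>" using \<delta>(2) by auto
          then show ?thesis using fG[of z u] True z0 by (simp add: rf.roots_def F_def)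
        next
          case False
          have "norm (z * u) \<le> norm y" using norm_snd_le[of "z * u" z] nc by simp
          then have "norm (z * u) < \<kappa>" using y \<epsilon> by simp
          then show ?thesis using far[of z u] z0 False by (simp add: rf.roots_def)
        qed
        finally show ?thesis by (simp add: rf.radial_roots_def z_def)
      qed
    qed (auto simp: conic_at_def)
  qed (use \<delta> \<kappa> s in auto)
qed

end

section \<open>Conic structure of plane curve germs\<close>

lemma conic_at_isometry:
  fixes A B :: "'a::real_normed_vector \<Rightarrow> 'a"
  assumes AB: "\<And>x. A (B x) = x" "\<And>x. B (A x) = x"
    and A: "linear A" "\<And>x. norm (A x) = norm x" "continuous_on UNIV A" and B: "continuous_on UNIV B"
    and con: "conic_at \<epsilon> (A -` C)"
  shows "conic_at \<epsilon> C"
proof -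
  have nB: "norm (B x) = norm x" for x using A(2)[of "B x"] AB by simp
  obtain H H' where H: "homeomorphism (cball 0 \<epsilon>) (cball 0 \<epsilon>) H H'" "\<forall>x\<in>sphere 0 \<epsilon>. H x = x"
    "H ` link_cone \<epsilon> (A -` C) = A -` C \<inter> cball 0 \<epsilon>"
    using con unfolding conic_at_def by blast
  have A0: "A x = 0 \<longleftrightarrow> x = 0" for x using A(2)[of x] by (metis norm_eq_zero)
  have hA: "homeomorphism (cball 0 \<epsilon>) (cball 0 \<epsilon>) A B"
    by (rule homeomorphismI)
      (use A(2) nB AB in \<open>auto intro: continuous_on_subset[OF A(3)] continuous_on_subset[OF B]\<close>)
  have "homeomorphism (cball 0 \<epsilon>) (cball 0 \<epsilon>) (A \<circ> (H \<circ> B)) ((A \<circ> H') \<circ> B)"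
    by (rule homeomorphism_compose[OF homeomorphism_compose[OF homeomorphism_symD[OF hA] H(1)] hA])
  moreover have "(A \<circ> (H \<circ> B)) x = x" if "x \<in> sphere 0 \<epsilon>" for x
    using H(2) that nB AB by simp
  moreover have "(A \<circ> (H \<circ> B)) ` link_cone \<epsilon> C = C \<inter> cball 0 \<epsilon>"
  proof -
    have "link_cone \<epsilon> (A -` C) = B ` link_cone \<epsilon> C"
    proof
      show "link_cone \<epsilon> (A -` C) \<subseteq> B ` link_cone \<epsilon> C"
      proof
        fix x assume "x \<in> link_cone \<epsilon> (A -` C)"
        then have "A x \<in> link_cone \<epsilon> C" using A A0 by (auto simp: link_cone_def linear_cmul)
        then show "x \<in> B ` link_cone \<epsilon> C" by (rule rev_image_eqI) (simp add: AB)
      qed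
      show "B ` link_cone \<epsilon> C \<subseteq> link_cone \<epsilon> (A -` C)"
      proof
        fix x assume "x \<in> B ` link_cone \<epsilon> C"
        then obtain y where y: "y \<in> link_cone \<epsilon> C" "x = B y" by blast
        then have "A x = y" by (simp add: AB)
        then show "x \<in> link_cone \<epsilon> (A -` C)"
          using y(1) A A0[of x] nB[of y] y(2) by (auto simp: link_cone_def linear_cmul)
      qed
    qed
    then have "H ` B ` link_cone \<epsilon> C = A -` C \<inter> cball 0 \<epsilon>" using H(3) by simp
    moreover have "(A \<circ> (H \<circ> B)) ` link_cone \<epsilon> C = A ` H ` B ` link_cone \<epsilon> C"
      by (simp only: image_comp)
    ultimately have "(A \<circ> (H \<circ> B)) ` link_cone \<epsilon> C = A ` (A -` C \<inter> cball 0 \<epsilon>)" by simp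
    also have "\<dots> = C \<inter> cball 0 \<epsilon>"
    proof
      show "C \<inter> cball 0 \<epsilon> \<subseteq> A ` (A -` C \<inter> cball 0 \<epsilon>)"
      proof
        fix x assume "x \<in> C \<inter> cball 0 \<epsilon>"
        then have "B x \<in> A -` C \<inter> cball 0 \<epsilon>" using AB nB by simp
        then show "x \<in> A ` (A -` C \<inter> cball 0 \<epsilon>)" by (rule rev_image_eqI) (simp add: AB)
      qed
    qed (use A in auto)
    finally show ?thesis .
  qed
  ultimately show ?thesis unfolding conic_at_def by blast
qed

text \<open>
The unitary map that sends the vertical unit vector to \<open>(a, b)\<close>. Unitary maps preserve the round
balls and the complex lines.
\<close>

definition unitary :: "complex \<Rightarrow> complex \<Rightarrow> complex \<times> complex \<Rightarrow> complex \<times> complex"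
  where "unitary a b p = (cnj b * fst p + a * snd p, b * snd p - cnj a * fst p)"

definition unitary_inv :: "complex \<Rightarrow> complex \<Rightarrow> complex \<times> complex \<Rightarrow> complex \<times> complex"
  where "unitary_inv a b p = (b * fst p - a * snd p, cnj a * fst p + cnj b * snd p)"

context
  fixes a b :: complex
  assumes ab: "norm (a, b) = 1"
begin

lemma unit_vector: "a * cnj a + b * cnj b = 1"
proof -
  have "(norm a)\<^sup>2 + (norm b)\<^sup>2 = 1" using ab by (simp add: norm_Pair real_sqrt_eq_1_iff)
  then have "of_real ((norm a)\<^sup>2 + (norm b)\<^sup>2) = (1 :: complex)" by (simp only: of_real_1)
  then show ?thesis by (simp only: of_real_add complex_norm_square)
qed

lemma unitary_unitary_inv: "unitary a b (unitary_inv a b p) = p" "unitary_inv a b (unitary a b p) = p"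
proof -
  obtain z w where p: "p = (z, w)" by (cases p)
  have unit: "(a * cnj a + b * cnj b) * x = x" for x using unit_vector by simp
  have "unitary a b (unitary_inv a b p) = ((a * cnj a + b * cnj b) * z, (a * cnj a + b * cnj b) * w)"
    "unitary_inv a b (unitary a b p) = ((a * cnj a + b * cnj b) * z, (a * cnj a + b * cnj b) * w)"
    by (simp_all add: p unitary_def unitary_inv_def algebra_simps)
  then show "unitary a b (unitary_inv a b p) = p" "unitary_inv a b (unitary a b p) = p"
    by (simp_all only: unit p)
qed

lemma norm_unitary: "norm (unitary a b p) = norm p"
proof -
  obtain z w where p: "p = (z, w)" by (cases p)
  have "of_real ((norm (cnj b * z + a * w))\<^sup>2 + (norm (b * w - cnj a * z))\<^sup>2)
      = (a * cnj a + b * cnj b) * (z * cnj z + w * cnj w)"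
    by (simp only: of_real_add complex_norm_square) (simp add: algebra_simps)
  also have "\<dots> = of_real ((norm z)\<^sup>2 + (norm w)\<^sup>2)"
    unfolding unit_vector by (simp only: of_real_add complex_norm_square mult_1)
  finally have "(norm (cnj b * z + a * w))\<^sup>2 + (norm (b * w - cnj a * z))\<^sup>2 = (norm z)\<^sup>2 + (norm w)\<^sup>2"
    by (simp only: of_real_eq_iff)
  then show ?thesis by (simp add: p unitary_def norm_Pair)
qed

lemma unitary_vertical: "unitary a b (0, 1) = (a, b)"
  by (simp add: unitary_def)

lemma unitary_cscale: "unitary a b (cscale t v) = cscale t (unitary a b v)"
  by (simp add: unitary_def cscale_def algebra_simps)

lemma linear_unitary: "linear (unitary a b)"
  by (rule linearI) (simp_all add: unitary_def algebra_simps scaleR_conv_of_real)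

lemma continuous_on_unitary: "continuous_on S (unitary a b)" "continuous_on S (unitary_inv a b)"
  unfolding unitary_def[abs_def] unitary_inv_def[abs_def] by (intro continuous_intros)+

lemma has_derivative_unitary: "(unitary a b has_derivative unitary a b) (at p)"
  unfolding unitary_def[abs_def] by (auto intro!: derivative_eq_intros)

lemma holomorphic2_unitary:
  assumes "holomorphic2_on f (ball 0 R)"
  shows "holomorphic2_on (\<lambda>p. f (unitary a b p)) (ball 0 R)"
  unfolding holomorphic2_on_def
proof
  fix p :: "complex \<times> complex" assume "p \<in> ball 0 R"
  then have "unitary a b p \<in> ball 0 R" by (simp add: norm_unitary)
  then obtain c d where "(f has_derivative (\<lambda>(h, k). c * h + d * k)) (at (unitary a b p))"
    using assms unfolding holomorphic2_on_def by blast
  from has_derivative_compose[OF has_derivative_unitary this]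
  have "((\<lambda>p. f (unitary a b p)) has_derivative
      (\<lambda>(h, k). (c * cnj b - d * cnj a) * h + (c * a + d * b) * k)) (at p)"
  proof (rule has_derivative_eq_rhs)
    show "(\<lambda>x. case unitary a b x of (h, k) \<Rightarrow> c * h + d * k) =
        (\<lambda>(h, k). (c * cnj b - d * cnj a) * h + (c * a + d * b) * k)"
      by (auto simp: unitary_def algebra_simps fun_eq_iff)
  qed
  then show "\<exists>c d. ((\<lambda>p. f (unitary a b p)) has_derivative (\<lambda>(h, k). c * h + d * k)) (at p)" by blast
qed

end

text \<open>
A direction that is not tangent to the curve is moved to the vertical axis by a unitary map.
\<close>

theorem curve_germ_conic:
  assumes "represents_curve_germ C"
  obtains \<epsilon>\<^sub>0 where "\<epsilon>\<^sub>0 > 0" "\<And>\<epsilon>. 0 < \<epsilon> \<Longrightarrow> \<epsilon> < \<epsilon>\<^sub>0 \<Longrightarrow> conic_at \<epsilon> C"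
proof -
  obtain U f where U: "open U" "0 \<in> U" and hol: "holomorphic2_on f U" and f0: "f 0 = 0"
    and nz: "\<exists>\<^sub>F p in nhds 0. f p \<noteq> 0" and C: "\<forall>\<^sub>F p in nhds 0. p \<in> C \<longleftrightarrow> f p = 0"
    using assms unfolding represents_curve_germ_def by blast
  obtain R where R: "R > 0" "ball 0 R \<subseteq> U" using U openE by blast
  have "\<forall>\<^sub>F p in nhds 0. p \<in> ball (0 :: complex \<times> complex) R"
    using R by (intro eventually_nhds_in_open) auto
  from frequently_eventually_frequently[OF nz this]
  have "\<exists>p\<in>ball 0 R. f p \<noteq> 0" using frequently_ex by blast
  then interpret holomorphic_germ f R
    by unfold_locales (use R hol f0 in \<open>auto simp: holomorphic2_on_def\<close>)
  obtain m G v where G: "line_quotients m G" and v: "norm v = 1" "G v 0 \<noteq> 0"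
    by (rule multiplicity) (rule that)
  obtain a b where ab: "v = (a, b)" by (cases v)
  let ?A = "unitary a b" and ?B = "unitary_inv a b"
  have u: "norm (a, b) = 1" using v ab by simp
  have A0: "?A 0 = 0" by (simp add: unitary_def zero_prod_def)
  interpret rot: holomorphic_germ "\<lambda>p. f (?A p)" R
  proof
    obtain p where "p \<in> ball 0 R" "f p \<noteq> 0" using nonzero by blast
    then show "\<exists>p\<in>ball 0 R. f (?A p) \<noteq> 0"
      using unitary_unitary_inv[OF u] norm_unitary[OF u, of "?B p"] by (intro bexI[of _ "?B p"]) simp_all
  qed (use R f0 A0 holomorphic2_unitary[OF u local.hol] in auto)
  have line: "line (?A v) = line v" for v by (simp add: line_def norm_unitary[OF u])
  have "rot.line_quotients m (\<lambda>v. G (?A v))"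
    unfolding rot.line_quotients_def
  proof (intro allI conjI ballI)
    fix v show "G (?A v) holomorphic_on line v" using line_quotientsD(1)[OF G, of "?A v"] line by simp
    fix t assume "t \<in> line v"
    then show "f (?A (cscale t v)) = t ^ m * G (?A v) t"
      using line_quotientsD(2)[OF G, of t "?A v"] line by (simp add: unitary_cscale[OF u])
  qed
  moreover have "G (?A (0, 1)) 0 \<noteq> 0" using v ab unitary_vertical[OF u] by simp
  moreover have "\<forall>\<^sub>F p in nhds 0. p \<in> ?A -` C \<longleftrightarrow> f (?A p) = 0"
  proof -
    obtain s where "s > 0" "\<And>p. norm p < s \<Longrightarrow> p \<in> C \<longleftrightarrow> f p = 0"
      using C unfolding eventually_nhds_metric by auto
    then show ?thesis unfolding eventually_nhds_metric
      by (intro exI[of _ s]) (simp add: norm_unitary[OF u])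
  qed
  ultimately obtain \<epsilon>\<^sub>0 where \<epsilon>\<^sub>0: "\<epsilon>\<^sub>0 > 0" "\<And>\<epsilon>. 0 < \<epsilon> \<Longrightarrow> \<epsilon> < \<epsilon>\<^sub>0 \<Longrightarrow> conic_at \<epsilon> (?A -` C)"
    by (rule rot.conic_near_0) (rule that)
  show ?thesis
  proof (rule that[OF \<epsilon>\<^sub>0(1)])
    show "conic_at \<epsilon> C" if "0 < \<epsilon>" "\<epsilon> < \<epsilon>\<^sub>0" for \<epsilon>
      by (rule conic_at_isometry[of ?A ?B])
        (use \<epsilon>\<^sub>0(2)[OF that] in \<open>simp_all add: unitary_unitary_inv[OF u] linear_unitary[OF u]
          norm_unitary[OF u] continuous_on_unitary[OF u]\<close>)
  qed
qed

section \<open>Topological type and links\<close>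

theorem corollary3p1p5:
  fixes C C' :: "(complex \<times> complex) set"
  assumes "represents_curve_germ C" and "represents_curve_germ C'"
  shows "topologically_equivalent C C' \<longleftrightarrow>
    (\<exists>\<epsilon>\<^sub>0>0. \<forall>\<epsilon>. 0 < \<epsilon> \<and> \<epsilon> < \<epsilon>\<^sub>0 \<longrightarrow>
       (\<exists>h. orientation_preserving_homeo 3 (sphere 0 \<epsilon>) {} h \<and>
            h ` (C \<inter> sphere 0 \<epsilon>) = C' \<inter> sphere 0 \<epsilon>))"
proof
  assume "topologically_equivalent C C'"
  then obtain \<epsilon>\<^sub>0 where \<epsilon>\<^sub>0: "\<epsilon>\<^sub>0 > 0"
    and ex: "\<And>\<epsilon>. 0 < \<epsilon> \<Longrightarrow> \<epsilon> < \<epsilon>\<^sub>0 \<Longrightarrow> \<exists>h. orientation_preserving_homeo 4 (cball 0 \<epsilon>) (sphere 0 \<epsilon>) h \<and>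
            h ` (C \<inter> cball 0 \<epsilon>) = C' \<inter> cball 0 \<epsilon>"
    unfolding topologically_equivalent_def by blast
  have "\<exists>h. orientation_preserving_homeo 3 (sphere 0 \<epsilon>) {} h \<and>
            h ` (C \<inter> sphere 0 \<epsilon>) = C' \<inter> sphere 0 \<epsilon>" if \<epsilon>: "0 < \<epsilon>" "\<epsilon> < \<epsilon>\<^sub>0" for \<epsilon>
  proof -
    obtain h where h: "orientation_preserving_homeo 4 (cball 0 \<epsilon>) (sphere 0 \<epsilon>) h"
      and im: "h ` (C \<inter> cball 0 \<epsilon>) = C' \<inter> cball 0 \<epsilon>" using ex[OF \<epsilon>] by blast
    obtain k where hk: "homeomorphism (cball 0 \<epsilon>) (cball 0 \<epsilon>) h k"
      using h by (auto simp: orientation_preserving_homeo_def homeomorphic_map_top_of_set_iff)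
    have hks: "homeomorphism (sphere 0 \<epsilon>) (sphere 0 \<epsilon>) h k" by (rule homeomorphism_cball_sphere[OF hk \<epsilon>(1)])
    have "h ` (C \<inter> sphere 0 \<epsilon>) = C' \<inter> sphere 0 \<epsilon>"
    proof
      show "h ` (C \<inter> sphere 0 \<epsilon>) \<subseteq> C' \<inter> sphere 0 \<epsilon>"
        using im homeomorphism_image1[OF hks] sphere_cball by blast
      show "C' \<inter> sphere 0 \<epsilon> \<subseteq> h ` (C \<inter> sphere 0 \<epsilon>)"
      proof
        fix y assume y: "y \<in> C' \<inter> sphere 0 \<epsilon>"
        then obtain x where x: "x \<in> C \<inter> cball 0 \<epsilon>" "y = h x"
          using im sphere_cball by blast
        then have "x = k y" using homeomorphism_apply1[OF hk] by simp
        moreover have "k y \<in> sphere 0 \<epsilon>" using homeomorphism_image2[OF hks] y by blast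
        ultimately show "y \<in> h ` (C \<inter> sphere 0 \<epsilon>)" using x by blast
      qed
    qed
    then show ?thesis using orientation_preserving_ball_iff_sphere[OF \<epsilon>(1) hk] h by blast
  qed
  then show "\<exists>\<epsilon>\<^sub>0>0. \<forall>\<epsilon>. 0 < \<epsilon> \<and> \<epsilon> < \<epsilon>\<^sub>0 \<longrightarrow>
       (\<exists>h. orientation_preserving_homeo 3 (sphere 0 \<epsilon>) {} h \<and>
            h ` (C \<inter> sphere 0 \<epsilon>) = C' \<inter> sphere 0 \<epsilon>)"
    using \<epsilon>\<^sub>0 by blast
next
  assume "\<exists>\<epsilon>\<^sub>0>0. \<forall>\<epsilon>. 0 < \<epsilon> \<and> \<epsilon> < \<epsilon>\<^sub>0 \<longrightarrow>
       (\<exists>h. orientation_preserving_homeo 3 (sphere 0 \<epsilon>) {} h \<and>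
            h ` (C \<inter> sphere 0 \<epsilon>) = C' \<inter> sphere 0 \<epsilon>)"
  then obtain \<epsilon>\<^sub>0 where \<epsilon>\<^sub>0: "\<epsilon>\<^sub>0 > 0"
    and ex: "\<And>\<epsilon>. 0 < \<epsilon> \<Longrightarrow> \<epsilon> < \<epsilon>\<^sub>0 \<Longrightarrow> \<exists>h. orientation_preserving_homeo 3 (sphere 0 \<epsilon>) {} h \<and>
            h ` (C \<inter> sphere 0 \<epsilon>) = C' \<inter> sphere 0 \<epsilon>"
    by blast
  obtain \<epsilon>\<^sub>1 where \<epsilon>\<^sub>1: "\<epsilon>\<^sub>1 > 0" "\<And>\<epsilon>. 0 < \<epsilon> \<Longrightarrow> \<epsilon> < \<epsilon>\<^sub>1 \<Longrightarrow> conic_at \<epsilon> C"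
    by (rule curve_germ_conic[OF assms(1)]) (rule that)
  obtain \<epsilon>\<^sub>2 where \<epsilon>\<^sub>2: "\<epsilon>\<^sub>2 > 0" "\<And>\<epsilon>. 0 < \<epsilon> \<Longrightarrow> \<epsilon> < \<epsilon>\<^sub>2 \<Longrightarrow> conic_at \<epsilon> C'"
    by (rule curve_germ_conic[OF assms(2)]) (rule that)
  have "\<exists>h. orientation_preserving_homeo 4 (cball 0 \<epsilon>) (sphere 0 \<epsilon>) h \<and>
            h ` (C \<inter> cball 0 \<epsilon>) = C' \<inter> cball 0 \<epsilon>"
    if \<epsilon>: "0 < \<epsilon>" "\<epsilon> < min \<epsilon>\<^sub>0 (min \<epsilon>\<^sub>1 \<epsilon>\<^sub>2)" for \<epsilon>
  proof -
    obtain h where h: "orientation_preserving_homeo 3 (sphere 0 \<epsilon>) {} h"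
      and im: "h ` (C \<inter> sphere 0 \<epsilon>) = C' \<inter> sphere 0 \<epsilon>" using ex[of \<epsilon>] \<epsilon> by auto
    obtain k where hk: "homeomorphism (sphere 0 \<epsilon>) (sphere 0 \<epsilon>) h k"
      using h by (auto simp: orientation_preserving_homeo_def homeomorphic_map_top_of_set_iff)
    have con: "conic_at \<epsilon> C" "conic_at \<epsilon> C'" using \<epsilon>\<^sub>1(2) \<epsilon>\<^sub>2(2) \<epsilon> by auto
    obtain g g' where g: "homeomorphism (cball 0 \<epsilon>) (cball 0 \<epsilon>) g g'"
      and gh: "\<And>x. x \<in> sphere 0 \<epsilon> \<Longrightarrow> g x = h x" and gC: "g ` (C \<inter> cball 0 \<epsilon>) = C' \<inter> cball 0 \<epsilon>"
      by (rule extend_link_homeomorphism[OF \<epsilon>(1) con hk im]) (rule that)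
    have "orientation_preserving_homeo 3 (sphere 0 \<epsilon>) {} g"
      using orientation_preserving_homeo_cong[of "sphere 0 \<epsilon>" g h 3 "{}"] gh h by blast
    then show ?thesis using orientation_preserving_ball_iff_sphere[OF \<epsilon>(1) g] gC by blast
  qed
  then show "topologically_equivalent C C'"
    unfolding topologically_equivalent_def using \<epsilon>\<^sub>0 \<epsilon>\<^sub>1(1) \<epsilon>\<^sub>2(1)
    by (intro exI[of _ "min \<epsilon>\<^sub>0 (min \<epsilon>\<^sub>1 \<epsilon>\<^sub>2)"]) auto
qed

end
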